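(* Let $u,v\in H^\infty$ be two nonconstant scalar inner functions, with compressed shifts $\mathbf T_u$ on $\mathfrak K_u=H^2\ominus uH^2$ and $\mathbf T_v$ on $\mathfrak K_v=H^2\ominus vH^2$. Let $$T=\begin{pmatrix}\mathbf T_u & X\\ 0&\mathbf T_v\end{pmatrix}\in\mathcal L(\mathfrak K_u\oplus\mathfrak K_v)$$ be a contraction, and let $Y:\mathcal D_{\mathbf T_v}\to\mathcal D_{\mathbf T_u^*}$ be the contraction such that $X=D_{\mathbf T_u^*}YD_{\mathbf T_v}$. Then $T$ is complex symmetric precisely in the following cases: (i) $Y=0$; (ii) $\|Y\|=1$; (iii) $0<\|Y\|<1$ and there exist $\lambda\in\mathbb D$ and $\mu\in\mathbb T$ such that $v=\mu\, b_\lambda(u)$ (i.e. $v=\mu\,(b_\lambda\circ u)$), where $$b_\lambda(z)=\frac{\lambda-z}{1-\overline\lambda z}.$$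
   Context: $\mathbb D$ is the open unit disc, $\mathbb T$ the unit circle, $H^2$, $H^\infty$ the usual scalar Hardy spaces. A scalar inner function is a function in $H^\infty$ with boundary values of modulus 1 a.e. on $\mathbb T$. For a nonconstant scalar inner function $u$, the model space is $\mathfrak K_u=H^2\ominus uH^2$ and the model operator (compressed shift) $\mathbf T_u\in\mathcal L(\mathfrak K_u)$ is $\mathbf T_uf=P_{\mathfrak K_u}(zf)$, where $P_{\mathfrak K_u}$ is the orthogonal projection of $H^2$ onto $\mathfrak K_u$. It is a contraction whose defect spaces are one-dimensional. For a contraction $A$ on a Hilbert space $\mathcal H$, $D_A=(I-A^*A)^{1/2}$, $D_{A^*}=(I-AA^* )^{1/2}$, $\mathcal D_A=\overline{D_A\mathcal H}$, $\mathcal D_{A^*}=\overline{D_{A^*}\mathcal H}$. Whenever $T=\begin{pmatrix}\mathbf T_u & X\\ 0&\mathbf T_v\end{pmatrix}$ is a contraction, one has $X=D_{\mathbf T_u^*}YD_{\mathbf T_v}$ for a contraction $Y:\mathcal D_{\mathbf T_v}\to\mathcal D_{\mathbf T_u^*}$; since both spaces are one-dimensional, $Y$ can be identified with a complex number of modulus at most 1. A conjugation on a complex Hilbert space $\mathcal H$ is an anti-linear, isometric, involutive map $C:\mathcal H\to\mathcal H$ (so $C^2=I$ and $\langle Cf,Cg\rangle=\langle g,f\rangle$). An operator $T\in\mathcal L(\mathcal H)$ is complex symmetric if there exists a conjugation $C$ on $\mathcal H$ with $T=CT^*C$. *)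

theory Defs
  imports "HOL-Complex_Analysis.Complex_Analysis"
begin

section \<open>Complex inner product spaces\<close>

text \<open>
  The complex inner product is linear in its first and conjugate-linear in its second argument.
  Norm and topology are those of the underlying real inner product space.
\<close>

class complex_inner = real_inner +
  fixes scaleC :: "complex \<Rightarrow> 'a \<Rightarrow> 'a" (infixr \<open>*\<^sub>C\<close> 75)
    and cinner :: "'a \<Rightarrow> 'a \<Rightarrow> complex"
  assumes scaleC_add_right: "a *\<^sub>C (x + y) = a *\<^sub>C x + a *\<^sub>C y"
    and scaleC_add_left: "(a + b) *\<^sub>C x = a *\<^sub>C x + b *\<^sub>C x"
    and scaleC_scaleC: "a *\<^sub>C b *\<^sub>C x = (a * b) *\<^sub>C x"
    and scaleC_of_real: "of_real r *\<^sub>C x = r *\<^sub>R x"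
    and cinner_commute: "cinner x y = cnj (cinner y x)"
    and cinner_add_left: "cinner (x + y) z = cinner x z + cinner y z"
    and cinner_scaleC_left: "cinner (a *\<^sub>C x) y = a * cinner x y"
    and Re_cinner: "Re (cinner x y) = inner x y"

instantiation prod :: (complex_inner, complex_inner) complex_inner
begin

definition scaleC_prod_def: "a *\<^sub>C p = (a *\<^sub>C fst p, a *\<^sub>C snd p)"
definition cinner_prod_def: "cinner p q = cinner (fst p) (fst q) + cinner (snd p) (snd q)"

instance
proof
  fix x y :: "'a \<times> 'b"
  show "cinner x y = cnj (cinner y x)"
    unfolding cinner_prod_def complex_cnj_add
    by (metis cinner_commute)
qed (simp_all add: scaleC_prod_def cinner_prod_def scaleC_add_right scaleC_add_left scaleC_scaleC
  scaleC_of_real cinner_add_left cinner_scaleC_left Re_cinner algebra_simps prod_eq_iff inner_prod_def)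

end

section \<open>Operators between closed subspaces\<close>

text \<open>
  Hilbert spaces are represented as closed complex subspaces \<open>S\<close>, \<open>S'\<close> of an ambient space, and an
  operator from \<open>S\<close> to \<open>S'\<close> as a function on the ambient type, whose values outside \<open>S\<close> are irrelevant.
\<close>

definition bounded_op_on ::
    "'a::complex_inner set \<Rightarrow> 'b::complex_inner set \<Rightarrow> ('a \<Rightarrow> 'b) \<Rightarrow> bool" where
  "bounded_op_on S S' A \<longleftrightarrow>
     (\<forall>x\<in>S. A x \<in> S') \<and>
     (\<forall>x\<in>S. \<forall>y\<in>S. A (x + y) = A x + A y) \<and>
     (\<forall>c. \<forall>x\<in>S. A (c *\<^sub>C x) = c *\<^sub>C A x) \<and>
     (\<exists>M. \<forall>x\<in>S. norm (A x) \<le> M * norm x)"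

definition contraction_on ::
    "'a::complex_inner set \<Rightarrow> 'b::complex_inner set \<Rightarrow> ('a \<Rightarrow> 'b) \<Rightarrow> bool" where
  "contraction_on S S' A \<longleftrightarrow> bounded_op_on S S' A \<and> (\<forall>x\<in>S. norm (A x) \<le> norm x)"

text \<open>The operator norm, relativised from \<^const>\<open>onorm\<close>; it is 0 on the zero space.\<close>

definition onorm_on :: "'a::complex_inner set \<Rightarrow> ('a \<Rightarrow> 'b::complex_inner) \<Rightarrow> real" where
  "onorm_on S A = (SUP x\<in>S. norm (A x) / norm x)"

definition orth_proj :: "'a::complex_inner set \<Rightarrow> 'a \<Rightarrow> 'a" where
  "orth_proj S x = (THE y. y \<in> S \<and> (\<forall>z\<in>S. cinner (x - y) z = 0))"

definition adj_on :: "'a::complex_inner set \<Rightarrow> ('a \<Rightarrow> 'a) \<Rightarrow> 'a \<Rightarrow> 'a" where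
  "adj_on S A y = (THE z. z \<in> S \<and> (\<forall>x\<in>S. cinner (A x) y = cinner x z))"

definition positive_on :: "'a::complex_inner set \<Rightarrow> ('a \<Rightarrow> 'a) \<Rightarrow> bool" where
  "positive_on S A \<longleftrightarrow> bounded_op_on S S A \<and> (\<forall>x\<in>S. cinner (A x) x \<in> \<real>\<^sub>\<ge>\<^sub>0)"

text \<open>
  The positive square root on \<open>S\<close> of a positive operator; the last conjunct only makes it unique as a
  function on the ambient type.
\<close>

definition sqrt_on :: "'a::complex_inner set \<Rightarrow> ('a \<Rightarrow> 'a) \<Rightarrow> 'a \<Rightarrow> 'a" where
  "sqrt_on S A =
     (THE B. positive_on S B \<and> (\<forall>x\<in>S. B (B x) = A x) \<and> (\<forall>x. x \<notin> S \<longrightarrow> B x = 0))"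

text \<open>\<open>defect_op S A\<close> is $D_A$ and \<open>codefect_op S A\<close> is $D_{A^*}$.\<close>

definition defect_op :: "'a::complex_inner set \<Rightarrow> ('a \<Rightarrow> 'a) \<Rightarrow> 'a \<Rightarrow> 'a" where
  "defect_op S A = sqrt_on S (\<lambda>x. x - adj_on S A (A x))"

definition codefect_op :: "'a::complex_inner set \<Rightarrow> ('a \<Rightarrow> 'a) \<Rightarrow> 'a \<Rightarrow> 'a" where
  "codefect_op S A = sqrt_on S (\<lambda>x. x - A (adj_on S A x))"

definition defect_space :: "'a::complex_inner set \<Rightarrow> ('a \<Rightarrow> 'a) \<Rightarrow> 'a set" where
  "defect_space S A = closure (defect_op S A ` S)"

definition codefect_space :: "'a::complex_inner set \<Rightarrow> ('a \<Rightarrow> 'a) \<Rightarrow> 'a set" where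
  "codefect_space S A = closure (codefect_op S A ` S)"

definition conjugation_on :: "'a::complex_inner set \<Rightarrow> ('a \<Rightarrow> 'a) \<Rightarrow> bool" where
  "conjugation_on S C \<longleftrightarrow>
     (\<forall>x\<in>S. C x \<in> S) \<and>
     (\<forall>x\<in>S. \<forall>y\<in>S. C (x + y) = C x + C y) \<and>
     (\<forall>c. \<forall>x\<in>S. C (c *\<^sub>C x) = cnj c *\<^sub>C C x) \<and>
     (\<forall>x\<in>S. norm (C x) = norm x) \<and>
     (\<forall>x\<in>S. C (C x) = x)"

definition complex_symmetric_on :: "'a::complex_inner set \<Rightarrow> ('a \<Rightarrow> 'a) \<Rightarrow> bool" where
  "complex_symmetric_on S A \<longleftrightarrow>
     bounded_op_on S S A \<and>
     (\<exists>C. conjugation_on S C \<and> (\<forall>x\<in>S. A x = C (adj_on S A (C x))))"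

text \<open>The operator matrix with rows $(A, X)$ and $(0, B)$.\<close>

definition upper_block :: "('a \<Rightarrow> 'a::complex_inner) \<Rightarrow> ('b \<Rightarrow> 'a) \<Rightarrow> ('b \<Rightarrow> 'b) \<Rightarrow> 'a \<times> 'b \<Rightarrow> 'a \<times> 'b" where
  "upper_block A X B = (\<lambda>(f, g). (A f + X g, B g))"

section \<open>The Hardy space $H^2$\<close>

definition taylor_coeff :: "(complex \<Rightarrow> complex) \<Rightarrow> nat \<Rightarrow> complex" where
  "taylor_coeff f n = fps_nth (fps_expansion f 0) n"

text \<open>
  $H^2$ consists of the holomorphic functions on the unit disc with square-summable Taylor
  coefficients. Values outside the disc are normalised to 0, so that equality in the type is equality
  on the disc.
\<close>

definition hardy2_set :: "(complex \<Rightarrow> complex) set" where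
  "hardy2_set = {f. f holomorphic_on ball 0 1 \<and> (\<forall>z. z \<notin> ball 0 1 \<longrightarrow> f z = 0) \<and>
                    summable (\<lambda>n. (cmod (taylor_coeff f n))\<^sup>2)}"

lemma hardy2_set_has_fps:
  "f holomorphic_on ball 0 1 \<Longrightarrow> f has_fps_expansion fps_expansion f 0"
  by (rule has_fps_expansion_fps_expansion[of "ball 0 1"]) auto

lemma taylor_coeff_eqI: "f has_fps_expansion F \<Longrightarrow> taylor_coeff f n = fps_nth F n"
  by (simp add: taylor_coeff_def fps_expansion_eqI)

lemma taylor_coeff_zero: "taylor_coeff (\<lambda>z. 0) n = 0"
  by (subst taylor_coeff_eqI[OF has_fps_expansion_0]) simp

lemma taylor_coeff_add:
  assumes "f holomorphic_on ball 0 1" "g holomorphic_on ball 0 1"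
  shows "taylor_coeff (\<lambda>z. f z + g z) n = taylor_coeff f n + taylor_coeff g n"
  by (subst taylor_coeff_eqI[OF has_fps_expansion_add[OF assms[THEN hardy2_set_has_fps]]])
     (simp add: taylor_coeff_def)

lemma taylor_coeff_cmult:
  assumes "f holomorphic_on ball 0 1"
  shows "taylor_coeff (\<lambda>z. c * f z) n = c * taylor_coeff f n"
  by (subst taylor_coeff_eqI[OF has_fps_expansion_cmult_left[OF assms[THEN hardy2_set_has_fps]]])
     (simp add: taylor_coeff_def)

lemma taylor_coeff_shift:
  assumes "f holomorphic_on ball 0 1"
  shows "taylor_coeff (\<lambda>z. z * f z) n = (if n = 0 then 0 else taylor_coeff f (n - 1))"
  by (subst taylor_coeff_eqI[OF has_fps_expansion_mult[OF has_fps_expansion_fps_X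
        assms[THEN hardy2_set_has_fps]]])
     (simp add: taylor_coeff_def)

lemma taylor_coeff_all_zero_imp:
  assumes "f \<in> hardy2_set" "\<And>n. taylor_coeff f n = 0"
  shows "f = (\<lambda>z. 0)"
proof
  fix z
  have hol: "f holomorphic_on ball 0 1" using assms(1) by (simp add: hardy2_set_def)
  have "fps_expansion f 0 = 0" using assms(2) by (simp add: fps_eq_iff taylor_coeff_def)
  then have "f has_fps_expansion 0" using hardy2_set_has_fps[OF hol] by simp
  then show "f z = 0"
    using has_fps_expansion_0_analytic_continuation[OF _ hol, of z] assms(1)
    by (cases "z \<in> ball 0 1") (auto simp: hardy2_set_def)
qed

lemma summable_sq_add:
  fixes a b :: "nat \<Rightarrow> complex"
  assumes "summable (\<lambda>n. (cmod (a n))\<^sup>2)" "summable (\<lambda>n. (cmod (b n))\<^sup>2)"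
  shows "summable (\<lambda>n. (cmod (a n + b n))\<^sup>2)"
proof (rule summable_comparison_test')
  show "summable (\<lambda>n. 2 * (cmod (a n))\<^sup>2 + 2 * (cmod (b n))\<^sup>2)"
    using assms by (intro summable_add summable_mult)
  fix n
  have "(cmod (a n + b n))\<^sup>2 \<le> (cmod (a n) + cmod (b n))\<^sup>2"
    by (intro power_mono norm_triangle_ineq) simp
  also have "\<dots> \<le> 2 * (cmod (a n))\<^sup>2 + 2 * (cmod (b n))\<^sup>2"
    using sum_squares_bound[of "cmod (a n)" "cmod (b n)"] by (simp add: power2_sum)
  finally show "norm ((cmod (a n + b n))\<^sup>2) \<le> 2 * (cmod (a n))\<^sup>2 + 2 * (cmod (b n))\<^sup>2"
    by simp
qed

lemma summable_mult_cnj: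
  fixes a b :: "nat \<Rightarrow> complex"
  assumes "summable (\<lambda>n. (cmod (a n))\<^sup>2)" "summable (\<lambda>n. (cmod (b n))\<^sup>2)"
  shows "summable (\<lambda>n. a n * cnj (b n))"
proof (rule summable_comparison_test')
  show "summable (\<lambda>n. (cmod (a n))\<^sup>2 + (cmod (b n))\<^sup>2)"
    using assms by (intro summable_add)
  fix n
  have "2 * (cmod (a n) * cmod (b n)) \<le> (cmod (a n))\<^sup>2 + (cmod (b n))\<^sup>2"
    using sum_squares_bound[of "cmod (a n)" "cmod (b n)"] by simp
  moreover have "0 \<le> cmod (a n) * cmod (b n)" by simp
  ultimately show "norm (a n * cnj (b n)) \<le> (cmod (a n))\<^sup>2 + (cmod (b n))\<^sup>2"
    unfolding norm_mult complex_mod_cnj by linarith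
qed

lemma hardy2_zero: "(\<lambda>z. 0) \<in> hardy2_set"
  by (simp add: hardy2_set_def taylor_coeff_zero)

lemma hardy2_add:
  "f \<in> hardy2_set \<Longrightarrow> g \<in> hardy2_set \<Longrightarrow> (\<lambda>z. f z + g z) \<in> hardy2_set"
  by (auto simp: hardy2_set_def taylor_coeff_add intro!: holomorphic_intros summable_sq_add)

lemma hardy2_cmult: "f \<in> hardy2_set \<Longrightarrow> (\<lambda>z. c * f z) \<in> hardy2_set"
  by (auto simp: hardy2_set_def taylor_coeff_cmult norm_mult power_mult_distrib
      intro!: holomorphic_intros summable_mult)

lemma hardy2_shift:
  assumes "f \<in> hardy2_set" shows "(\<lambda>z. z * f z) \<in> hardy2_set"
proof -
  have hol: "f holomorphic_on ball 0 1" using assms by (simp add: hardy2_set_def)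
  have "summable (\<lambda>n. (cmod (taylor_coeff (\<lambda>z. z * f z) n))\<^sup>2)"
    using assms by (subst summable_Suc_iff[symmetric]) (simp add: taylor_coeff_shift[OF hol] hardy2_set_def)
  then show ?thesis using assms by (auto simp: hardy2_set_def intro!: holomorphic_intros)
qed

typedef hardy2 = hardy2_set
  morphisms hardy2_fun Abs_hardy2
  using hardy2_zero by blast

setup_lifting type_definition_hardy2

definition hcoeff :: "hardy2 \<Rightarrow> nat \<Rightarrow> complex" where
  "hcoeff f = taylor_coeff (hardy2_fun f)"

lemma hcoeff_summable: "summable (\<lambda>n. (cmod (hcoeff f n))\<^sup>2)"
  using hardy2_fun[of f] by (simp add: hcoeff_def hardy2_set_def)

lemma hardy2_fun_holomorphic: "hardy2_fun f holomorphic_on ball 0 1"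
  using hardy2_fun[of f] by (simp add: hardy2_set_def)

lemma hcoeff_mult_summable: "summable (\<lambda>n. hcoeff f n * cnj (hcoeff g n))"
  by (intro summable_mult_cnj hcoeff_summable)

instantiation hardy2 :: real_vector
begin

lift_definition zero_hardy2 :: hardy2 is "\<lambda>z. 0" by (rule hardy2_zero)
lift_definition plus_hardy2 :: "hardy2 \<Rightarrow> hardy2 \<Rightarrow> hardy2" is "\<lambda>f g z. f z + g z"
  by (rule hardy2_add)
lift_definition uminus_hardy2 :: "hardy2 \<Rightarrow> hardy2" is "\<lambda>f z. - f z"
  subgoal for f using hardy2_cmult[of f "-1"] by simp done
lift_definition minus_hardy2 :: "hardy2 \<Rightarrow> hardy2 \<Rightarrow> hardy2" is "\<lambda>f g z. f z - g z"
  subgoal for f g using hardy2_add[OF _ hardy2_cmult[of g "-1"], of f] by simp done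
lift_definition scaleR_hardy2 :: "real \<Rightarrow> hardy2 \<Rightarrow> hardy2" is "\<lambda>r f z. of_real r * f z"
  by (rule hardy2_cmult)

instance
  by standard (transfer; simp add: algebra_simps)+

end

lemma hcoeff_zero: "hcoeff 0 n = 0"
  unfolding hcoeff_def zero_hardy2.rep_eq by (rule taylor_coeff_zero)

lemma hcoeff_add: "hcoeff (f + g) n = hcoeff f n + hcoeff g n"
  unfolding hcoeff_def plus_hardy2.rep_eq by (intro taylor_coeff_add hardy2_fun_holomorphic)

lemma hcoeff_scaleR: "hcoeff (r *\<^sub>R f) n = of_real r * hcoeff f n"
  unfolding hcoeff_def scaleR_hardy2.rep_eq by (intro taylor_coeff_cmult hardy2_fun_holomorphic)

lemma hcoeff_eq_0_imp: "(\<And>n. hcoeff f n = 0) \<Longrightarrow> f = 0"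
  unfolding hcoeff_def using taylor_coeff_all_zero_imp[OF hardy2_fun, of f]
  by (simp add: hardy2_fun_inject[symmetric] zero_hardy2.rep_eq)

instantiation hardy2 :: complex_inner
begin

lift_definition scaleC_hardy2 :: "complex \<Rightarrow> hardy2 \<Rightarrow> hardy2" is "\<lambda>c f z. c * f z"
  by (rule hardy2_cmult)

definition cinner_hardy2 :: "hardy2 \<Rightarrow> hardy2 \<Rightarrow> complex" where
  "cinner_hardy2 f g = (\<Sum>n. hcoeff f n * cnj (hcoeff g n))"
definition inner_hardy2 :: "hardy2 \<Rightarrow> hardy2 \<Rightarrow> real" where
  "inner_hardy2 f g = Re (cinner f g)"
definition norm_hardy2 :: "hardy2 \<Rightarrow> real" where
  "norm_hardy2 f = sqrt (inner f f)"
definition dist_hardy2 :: "hardy2 \<Rightarrow> hardy2 \<Rightarrow> real" where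
  "dist_hardy2 f g = norm (f - g)"
definition sgn_hardy2 :: "hardy2 \<Rightarrow> hardy2" where
  "sgn_hardy2 f = f /\<^sub>R norm f"
definition uniformity_hardy2 :: "(hardy2 \<times> hardy2) filter" where
  "uniformity_hardy2 = (INF e\<in>{0<..}. principal {(f, g). dist f g < e})"
definition open_hardy2 :: "hardy2 set \<Rightarrow> bool" where
  "open_hardy2 U = (\<forall>f\<in>U. eventually (\<lambda>(f', g). f' = f \<longrightarrow> g \<in> U) uniformity)"

instance
proof
  fix f g h :: hardy2 and r :: real and a b :: complex
  have coeffC: "hcoeff (a *\<^sub>C f) n = a * hcoeff f n" for a f n
    unfolding hcoeff_def scaleC_hardy2.rep_eq by (intro taylor_coeff_cmult hardy2_fun_holomorphic)
  show comm: "cinner f g = cnj (cinner g f)" for f g :: hardy2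
    unfolding cinner_hardy2_def
    using sums_cnj[of "\<lambda>n. hcoeff g n * cnj (hcoeff f n)"] hcoeff_mult_summable[of g f]
    by (intro sums_unique[symmetric]) (simp add: summable_sums mult.commute)
  show add: "cinner (f + g) h = cinner f h + cinner g h"
    unfolding cinner_hardy2_def hcoeff_add distrib_right
    by (rule suminf_add[symmetric]) (rule hcoeff_mult_summable)+
  show scaleC: "cinner (a *\<^sub>C f) g = a * cinner f g" for a
    unfolding cinner_hardy2_def coeffC mult.assoc
    by (rule suminf_mult) (rule hcoeff_mult_summable)
  show of_real: "of_real r *\<^sub>C f = r *\<^sub>R f" for r by transfer simp
  show "a *\<^sub>C (f + g) = a *\<^sub>C f + a *\<^sub>C g" by transfer (simp add: algebra_simps)
  show "(a + b) *\<^sub>C f = a *\<^sub>C f + b *\<^sub>C f" by transfer (simp add: algebra_simps)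
  show "a *\<^sub>C b *\<^sub>C f = (a * b) *\<^sub>C f" by transfer (simp add: algebra_simps)
  show "Re (cinner f g) = inner f g" by (simp add: inner_hardy2_def)
  show "inner f g = inner g f" unfolding inner_hardy2_def by (subst comm) simp
  show "inner (f + g) h = inner f h + inner g h" by (simp add: inner_hardy2_def add)
  show "inner (r *\<^sub>R f) g = r * inner f g"
    by (simp add: inner_hardy2_def scaleC flip: of_real)
  have *: "inner f f = (\<Sum>n. (cmod (hcoeff f n))\<^sup>2)"
    unfolding inner_hardy2_def cinner_hardy2_def
    by (subst bounded_linear.suminf[OF bounded_linear_Re hcoeff_mult_summable])
       (simp add: cmod_power2 flip: power2_eq_square)
  show "0 \<le> inner f f" unfolding * by (intro suminf_nonneg hcoeff_summable) simp
  show "inner f f = 0 \<longleftrightarrow> f = 0"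
    unfolding * using suminf_eq_zero_iff[OF hcoeff_summable[of f]]
    by (auto intro: hcoeff_eq_0_imp simp: hcoeff_zero)
qed (fact norm_hardy2_def dist_hardy2_def sgn_hardy2_def uniformity_hardy2_def open_hardy2_def)+

end

text \<open>Multiplication by the independent variable.\<close>

lift_definition hardy2_shift_op :: "hardy2 \<Rightarrow> hardy2" is "\<lambda>f z. z * f z"
  by (rule hardy2_shift)

section \<open>Inner functions, model spaces and compressed shifts\<close>

text \<open>Boundary values are radial limits. Only the values of \<open>u\<close> on the open disc matter.\<close>

definition inner_function :: "(complex \<Rightarrow> complex) \<Rightarrow> bool" where
  "inner_function u \<longleftrightarrow>
     u holomorphic_on ball 0 1 \<and> bounded (u ` ball 0 1) \<and>
     (AE t in lebesgue_on {0..2 * pi}.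
        \<exists>w. ((\<lambda>r. u (complex_of_real r * cis t)) \<longlongrightarrow> w) (at_left 1) \<and> cmod w = 1)"

definition mult_range :: "(complex \<Rightarrow> complex) \<Rightarrow> hardy2 set" where
  "mult_range u = {f. \<exists>g. \<forall>z\<in>ball 0 1. hardy2_fun f z = u z * hardy2_fun g z}"

definition model_space :: "(complex \<Rightarrow> complex) \<Rightarrow> hardy2 set" where
  "model_space u = {f. \<forall>h\<in>mult_range u. cinner f h = 0}"

definition model_op :: "(complex \<Rightarrow> complex) \<Rightarrow> hardy2 \<Rightarrow> hardy2" where
  "model_op u f = orth_proj (model_space u) (hardy2_shift_op f)"

definition blaschke_factor :: "complex \<Rightarrow> complex \<Rightarrow> complex" where
  "blaschke_factor a z = (a - z) / (1 - cnj a * z)"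

end

theory Submission
  imports Defs
begin

text \<open>
  For an inner function \<open>u\<close>, let \<open>k\<^sub>u = 1 - u(0)\<^sup>* u\<close> be the reproducing kernel of the model space
  \<open>K\<^sub>u\<close> at 0 and \<open>k'\<^sub>u = (u - u(0)) / z\<close>. On \<open>K\<^sub>u\<close> one has \<open>T\<^sub>u f = z f - \<langle>f, k'\<^sub>u\<rangle> u\<close>, and the adjoint is
  the backward shift; hence \<open>I - T\<^sub>u\<^sup>* T\<^sub>u\<close> and \<open>I - T\<^sub>u T\<^sub>u\<^sup>*\<close> are \<open>\<langle>-, k'\<^sub>u\<rangle> k'\<^sub>u\<close> and \<open>\<langle>-, k\<^sub>u\<rangle> k\<^sub>u\<close>, and the
  corner of the operator matrix is \<open>X g = y \<langle>g, k'\<^sub>v\<rangle> k\<^sub>u\<close> with a number \<open>y\<close> of modulus \<open>\<parallel>Y\<parallel>\<close>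
  (\<open>corner_scalar\<close>). The whole matrix is explicit from here on, and the theorem becomes a statement
  about the one parameter \<open>y\<close>.

  The only analytic input is that multiplication by an inner function is isometric on \<open>H\<^sup>2\<close>
  (\<open>norm_mult_op\<close>); it comes from Parseval's identity on circles and dominated convergence.

  The map \<open>f \<mapsto> u \<zeta>\<^sup>* f\<^sup>*\<close> on the unit circle is a conjugation \<open>J\<close> of \<open>K\<^sub>u\<close>. It makes \<open>T\<^sub>u\<close> complex
  symmetric and exchanges \<open>k\<^sub>u\<close> and \<open>k'\<^sub>u\<close>. This yields the three sufficient conditions. For \<open>y = 0\<close>
  the two conjugations are combined. For \<open>\<bar>y\<bar> = 1\<close> the matrix is unitarily equivalent to the
  compressed shift for the inner function \<open>u v\<close> (\<open>symmetric_if_unimodular\<close>). If \<open>v\<close> is a Moebius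
  transform of \<open>u\<close>, the Crofoot transform identifies \<open>K\<^sub>v\<close> with \<open>K\<^sub>u\<close> and turns the matrix into
  \<open>T\<^sub>u \<otimes> I + (k\<^sub>u \<otimes> k'\<^sub>u) \<otimes> R\<close> with a two by two matrix \<open>R\<close>, which is complex symmetric for some
  conjugation of \<open>\<complex>\<^sup>2\<close> (\<open>symmetric_if_blaschke\<close>).

  Conversely, let \<open>0 < \<bar>y\<bar> < 1\<close> and \<open>T = C T\<^sup>* C\<close>. Then \<open>C\<close> maps the span of \<open>(k\<^sub>u, 0)\<close> and \<open>(0, k\<^sub>v)\<close>,
  which is the range of \<open>I - T T\<^sup>*\<close>, into the span of \<open>(k'\<^sub>u, 0)\<close> and \<open>(0, k'\<^sub>v)\<close>. Comparing
  matrix entries of the resolvents of \<open>T\<close> and \<open>T\<^sup>*\<close> on these spaces gives two algebraic relations between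
  \<open>u\<close> and \<open>v\<close> (\<open>proportional_if_complex_symmetric\<close>). They force
  \<open>(v - v(0)) / (1 - v(0)\<^sup>* v)\<close> to be a constant multiple of \<open>(u - u(0)) / (1 - u(0)\<^sup>* u)\<close>, and the
  constant has modulus 1; so \<open>v\<close> is of the required form.
\<close>

section \<open>Complex inner products\<close>

lemma scaleC_one [simp]: "1 *\<^sub>C x = (x::'a::complex_inner)"
  using scaleC_of_real[of 1 x] by simp

lemma scaleC_zero_left [simp]: "0 *\<^sub>C x = (0::'a::complex_inner)"
  using scaleC_of_real[of 0 x] by simp

lemma scaleC_zero_right [simp]: "a *\<^sub>C (0::'a::complex_inner) = 0"
  using scaleC_scaleC[of a 0 0] by simp

lemma scaleC_minus_left: "(- a) *\<^sub>C x = - (a *\<^sub>C (x::'a::complex_inner))"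
  using scaleC_add_left[of a "- a" x] by (simp add: eq_neg_iff_add_eq_0 add.commute)

lemma scaleC_minus_right: "a *\<^sub>C (- x) = - (a *\<^sub>C (x::'a::complex_inner))"
  using scaleC_add_right[of a x "- x"] by (simp add: eq_neg_iff_add_eq_0 add.commute)

lemma scaleC_diff_right: "a *\<^sub>C (x - y) = a *\<^sub>C x - a *\<^sub>C (y::'a::complex_inner)"
  using scaleC_add_right[of a x "- y"] by (simp add: scaleC_minus_right)

lemma scaleC_diff_left: "(a - b) *\<^sub>C x = a *\<^sub>C x - b *\<^sub>C (x::'a::complex_inner)"
  using scaleC_add_left[of a "- b" x] by (simp add: scaleC_minus_left)

lemma cinner_add_right: "cinner x (y + z) = cinner x y + cinner x (z::'a::complex_inner)"
  by (metis cinner_commute cinner_add_left complex_cnj_add)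

lemma cinner_scaleC_right: "cinner x (a *\<^sub>C y) = cnj a * cinner x (y::'a::complex_inner)"
  by (metis cinner_commute cinner_scaleC_left complex_cnj_mult)

lemma cinner_zero_left [simp]: "cinner 0 (x::'a::complex_inner) = 0"
  using cinner_scaleC_left[of 0 0 x] by simp

lemma cinner_zero_right [simp]: "cinner (x::'a::complex_inner) 0 = 0"
  using cinner_scaleC_right[of x 0 0] by simp

lemma cinner_minus_left: "cinner (- x) y = - cinner x (y::'a::complex_inner)"
  using cinner_scaleC_left[of "-1" x y] by (simp add: scaleC_minus_left)

lemma cinner_minus_right: "cinner x (- y) = - cinner x (y::'a::complex_inner)"
  using cinner_scaleC_right[of x "-1" y] by (simp add: scaleC_minus_left)

lemma cinner_diff_left: "cinner (x - y) z = cinner x z - cinner y (z::'a::complex_inner)"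
  using cinner_add_left[of x "- y" z] by (simp add: cinner_minus_left)

lemma cinner_diff_right: "cinner x (y - z) = cinner x y - cinner x (z::'a::complex_inner)"
  using cinner_add_right[of x y "- z"] by (simp add: cinner_minus_right)

lemma cinner_sum_left: "cinner (\<Sum>i\<in>I. f i) y = (\<Sum>i\<in>I. cinner (f i) (y::'a::complex_inner))"
  by (induction I rule: infinite_finite_induct) (simp_all add: cinner_add_left)

lemma cinner_sum_right: "cinner y (\<Sum>i\<in>I. f i) = (\<Sum>i\<in>I. cinner (y::'a::complex_inner) (f i))"
  by (induction I rule: infinite_finite_induct) (simp_all add: cinner_add_right)

lemmas cinner_simps = cinner_add_left cinner_add_right cinner_diff_left cinner_diff_right
  cinner_scaleC_left cinner_scaleC_right cinner_minus_left cinner_minus_right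

lemmas scaleC_simps = scaleC_add_left scaleC_add_right scaleC_diff_left scaleC_diff_right
  scaleC_minus_left scaleC_minus_right scaleC_scaleC

lemma cinner_self: "cinner x x = of_real ((norm (x::'a::complex_inner))\<^sup>2)"
proof (rule complex_eqI)
  show "Re (cinner x x) = Re (of_real ((norm x)\<^sup>2))"
    by (simp add: Re_cinner power2_norm_eq_inner)
  show "Im (cinner x x) = Im (of_real ((norm x)\<^sup>2))"
    using arg_cong[OF cinner_commute[of x x], of Im] by simp
qed

lemma cinner_self_eq_0 [simp]: "cinner x x = 0 \<longleftrightarrow> x = (0::'a::complex_inner)"
  by (simp add: cinner_self)

lemma norm_scaleC: "norm (a *\<^sub>C x) = cmod a * norm (x::'a::complex_inner)"
proof -
  have "complex_of_real ((norm (a *\<^sub>C x))\<^sup>2) = a * cnj a * cinner x x"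
    unfolding cinner_self[symmetric] by (simp add: cinner_simps)
  also have "\<dots> = of_real ((cmod a * norm x)\<^sup>2)"
    by (simp add: complex_norm_square[symmetric] cinner_self power_mult_distrib)
  finally have "(norm (a *\<^sub>C x))\<^sup>2 = (cmod a * norm x)\<^sup>2"
    by (simp only: of_real_eq_iff)
  then show ?thesis by (simp add: power2_eq_iff_nonneg)
qed

lemma cmod_cinner_le: "cmod (cinner x y) \<le> norm x * norm (y::'a::complex_inner)"
proof (cases "cinner x y = 0")
  case False
  define c where "c = cnj (cinner x y) / cmod (cinner x y)"
  have c: "cmod c = 1" using False by (simp add: c_def norm_divide)
  have "cinner (c *\<^sub>C x) y = cmod (cinner x y)"
    using False
    by (simp add: c_def cinner_simps field_simps complex_norm_square[symmetric] power2_eq_square)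
  then have "cmod (cinner x y) = inner (c *\<^sub>C x) y"
    by (metis Re_cinner Re_complex_of_real)
  also have "\<dots> \<le> norm (c *\<^sub>C x) * norm y" by (rule norm_cauchy_schwarz)
  finally show ?thesis by (simp add: norm_scaleC c)
qed simp

lemma bounded_linear_cinner_left: "bounded_linear (\<lambda>x. cinner x (y::'a::complex_inner))"
proof (rule bounded_linear_intro[where K = "norm y"])
  show "cinner (r *\<^sub>R x) y = r *\<^sub>R cinner x y" for r x
    by (simp add: cinner_scaleC_left scaleR_conv_of_real flip: scaleC_of_real)
qed (simp_all add: cinner_add_left cmod_cinner_le)

lemma bounded_linear_scaleC_right: "bounded_linear (\<lambda>x. c *\<^sub>C (x::'a::complex_inner))"
proof (rule bounded_linear_intro)
  show "c *\<^sub>C (r *\<^sub>R x) = r *\<^sub>R (c *\<^sub>C x)" for r x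
    by (simp add: scaleC_scaleC mult.commute flip: scaleC_of_real)
  show "norm (c *\<^sub>C x) \<le> norm x * cmod c" for x by (simp add: norm_scaleC)
qed (simp add: scaleC_add_right)

lemma bounded_linear_scaleC_left: "bounded_linear (\<lambda>c. c *\<^sub>C (x::'a::complex_inner))"
proof (rule bounded_linear_intro)
  show "(r *\<^sub>R c) *\<^sub>C x = r *\<^sub>R (c *\<^sub>C x)" for r c
    by (simp add: scaleC_scaleC scaleR_conv_of_real flip: scaleC_of_real)
  show "norm (c *\<^sub>C x) \<le> cmod c * norm x" for c by (simp add: norm_scaleC)
qed (simp add: scaleC_add_left)

lemma norm_diff_scaleC_sq:
  fixes x y :: "'a::complex_inner"
  shows "(norm (x - c *\<^sub>C y))\<^sup>2 = (norm x)\<^sup>2 + (cmod c)\<^sup>2 * (norm y)\<^sup>2 - 2 * Re (cnj c * cinner x y)"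
proof -
  have "complex_of_real ((norm (x - c *\<^sub>C y))\<^sup>2) =
      cinner x x + c * cnj c * cinner y y - (cnj c * cinner x y + cnj (cnj c * cinner x y))"
    unfolding cinner_self[symmetric] by (simp add: cinner_simps cinner_commute[of y x] algebra_simps)
  also have "\<dots> = of_real ((norm x)\<^sup>2 + (cmod c)\<^sup>2 * (norm y)\<^sup>2 - 2 * Re (cnj c * cinner x y))"
    unfolding complex_add_cnj by (simp add: complex_norm_square[symmetric] cinner_self)
  finally show ?thesis by (simp only: of_real_eq_iff)
qed

text \<open>Polarisation, in the form that shows that linear isometries preserve inner products.\<close>

lemma cinner_eq_if_norm_eq:
  fixes x y :: "'a::complex_inner" and x' y' :: "'b::complex_inner"
  assumes "\<And>c. norm (x - c *\<^sub>C y) = norm (x' - c *\<^sub>C y')"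
  shows "cinner x y = cinner x' y'"
proof -
  define f where "f c = (norm (x - c *\<^sub>C y))\<^sup>2" for c
  define g where "g c = (norm (x' - c *\<^sub>C y'))\<^sup>2" for c
  have fg: "f c = g c" for c using assms by (simp add: f_def g_def)
  have f: "f 1 - f (-1) = - 4 * Re (cinner x y)" "f \<i> - f (- \<i>) = - 4 * Im (cinner x y)"
    unfolding f_def norm_diff_scaleC_sq by simp_all
  have g: "g 1 - g (-1) = - 4 * Re (cinner x' y')" "g \<i> - g (- \<i>) = - 4 * Im (cinner x' y')"
    unfolding g_def norm_diff_scaleC_sq by simp_all
  show ?thesis using f g by (simp add: fg complex_eq_iff)
qed

lemma fst_snd_scaleC: "fst (c *\<^sub>C p) = c *\<^sub>C fst p" "snd (c *\<^sub>C p) = c *\<^sub>C snd p"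
  by (simp_all add: scaleC_prod_def)

lemma scaleC_Pair: "c *\<^sub>C (f, g) = (c *\<^sub>C f, c *\<^sub>C g)"
  by (simp add: scaleC_prod_def)

lemma cinner_Pair: "cinner (f, g) (f', g') = cinner f f' + cinner g g'"
  by (simp add: cinner_prod_def)

lemma norm_Pair_eqI:
  assumes "(norm a)\<^sup>2 + (norm b)\<^sup>2 = (norm c)\<^sup>2 + (norm d)\<^sup>2" shows "norm (a, b) = norm (c, d)"
  using assms by (simp add: norm_Pair)

section \<open>Operators on subspaces\<close>

definition csubspace :: "'a::complex_inner set \<Rightarrow> bool" where
  "csubspace S \<longleftrightarrow> 0 \<in> S \<and> (\<forall>x\<in>S. \<forall>y\<in>S. x + y \<in> S) \<and> (\<forall>c. \<forall>x\<in>S. c *\<^sub>C x \<in> S)"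

lemma csubspace_zero: "csubspace S \<Longrightarrow> 0 \<in> S"
  and csubspace_add: "csubspace S \<Longrightarrow> x \<in> S \<Longrightarrow> y \<in> S \<Longrightarrow> x + y \<in> S"
  and csubspace_scaleC: "csubspace S \<Longrightarrow> x \<in> S \<Longrightarrow> c *\<^sub>C x \<in> S"
  by (simp_all add: csubspace_def)

lemma csubspace_diff: "csubspace S \<Longrightarrow> x \<in> S \<Longrightarrow> y \<in> S \<Longrightarrow> x - y \<in> S"
  using csubspace_add[of S x "(-1) *\<^sub>C y"] csubspace_scaleC[of S y "-1"]
  by (simp add: scaleC_minus_left)

lemmas csubspace_intros = csubspace_zero csubspace_add csubspace_diff csubspace_scaleC

lemma csubspace_Times: "csubspace S \<Longrightarrow> csubspace S' \<Longrightarrow> csubspace (S \<times> S')"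
  by (auto simp: csubspace_def scaleC_prod_def zero_prod_def)

lemma eq_if_cinner_eq:
  assumes "csubspace S" "x \<in> S" "y \<in> S" "\<And>z. z \<in> S \<Longrightarrow> cinner z x = cinner z y"
  shows "x = y"
  using assms(4)[OF csubspace_diff[OF assms(1-3)]]
  by (metis cinner_diff_right cinner_self_eq_0 right_minus_eq)

lemma adj_on_eqI:
  assumes "csubspace S" "z \<in> S" "\<And>x. x \<in> S \<Longrightarrow> cinner (A x) y = cinner x z"
  shows "adj_on S A y = z"
  unfolding adj_on_def
proof (rule the_equality)
  show "z \<in> S \<and> (\<forall>x\<in>S. cinner (A x) y = cinner x z)" using assms by blast
  show "z' = z" if "z' \<in> S \<and> (\<forall>x\<in>S. cinner (A x) y = cinner x z')" for z'
    using that assms by (intro eq_if_cinner_eq[of S]) auto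
qed

lemma orth_proj_eqI:
  assumes "csubspace S" "y \<in> S" "\<And>z. z \<in> S \<Longrightarrow> cinner (x - y) z = 0"
  shows "orth_proj S x = y"
  unfolding orth_proj_def
proof (rule the_equality)
  show "y \<in> S \<and> (\<forall>z\<in>S. cinner (x - y) z = 0)" using assms by blast
  fix y' assume y': "y' \<in> S \<and> (\<forall>z\<in>S. cinner (x - y') z = 0)"
  have "cinner z y' = cinner z y" if z: "z \<in> S" for z
  proof -
    have "cinner y' z = cinner y z" using assms(3)[OF z] y' z by (simp add: cinner_diff_left)
    then show ?thesis using cinner_commute[of z] by simp
  qed
  then show "y' = y" using assms y' by (intro eq_if_cinner_eq[of S]) auto
qed

text \<open>
  The positive square root of the operator \<open>x \<mapsto> \<langle>x, k\<rangle> k\<close> of rank one is \<open>x \<mapsto> \<langle>x, k\<rangle> k / \<parallel>k\<parallel>\<close>. A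
  positive square root \<open>B\<close> vanishes on the orthogonal complement of \<open>k\<close>, because
  \<open>\<parallel>B x\<parallel>\<^sup>2 = \<langle>x, B\<^sup>2 x\<rangle>\<close>, and since \<open>B\<close> is self-adjoint, \<open>B k\<close> is a multiple of \<open>k\<close>.
\<close>

lemma sqrt_on_rank_one:
  fixes k :: "'a::complex_inner"
  assumes S: "csubspace S" and k: "k \<in> S" "k \<noteq> 0"
    and A: "\<And>x. x \<in> S \<Longrightarrow> A x = cinner x k *\<^sub>C k" and x: "x \<in> S"
  shows "sqrt_on S A x = (cinner x k / of_real (norm k)) *\<^sub>C k"
proof -
  define R where "R x = (if x \<in> S then (cinner x k / of_real (norm k)) *\<^sub>C k else 0)" for x
  note [intro] = csubspace_intros[OF S]
  have nk: "norm k \<noteq> 0" using k by simp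
  have "sqrt_on S A = R"
    unfolding sqrt_on_def
  proof (rule the_equality)
    have "positive_on S R"
      unfolding positive_on_def bounded_op_on_def
    proof (intro conjI ballI allI exI)
      fix x assume x: "x \<in> S"
      show "R x \<in> S" using k by (auto simp: R_def)
      show "norm (R x) \<le> norm k * norm x"
        using cmod_cinner_le[of x k] x nk by (simp add: R_def norm_scaleC norm_divide mult.commute)
      show "R (c *\<^sub>C x) = c *\<^sub>C R x" for c
        using x by (auto simp: R_def cinner_simps scaleC_simps)
      have "cinner (R x) x = of_real ((cmod (cinner x k))\<^sup>2 / norm k)"
        using x by (simp add: R_def cinner_simps cinner_commute[of k x] complex_norm_square
            del: of_real_power)
      moreover have "(cmod (cinner x k))\<^sup>2 / norm k \<ge> 0" by simp
      ultimately show "cinner (R x) x \<in> \<real>\<^sub>\<ge>\<^sub>0" by (metis nonneg_Reals_of_real_iff)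
      fix y assume y: "y \<in> S"
      show "R (x + y) = R x + R y"
        using x y by (auto simp: R_def cinner_simps add_divide_distrib simp flip: scaleC_add_left)
    qed
    moreover have "R (R x) = A x" if "x \<in> S" for x
      using that k nk csubspace_scaleC[OF S k(1)]
      by (simp add: R_def A cinner_simps scaleC_simps cinner_self power2_eq_square)
    ultimately show "positive_on S R \<and> (\<forall>x\<in>S. R (R x) = A x) \<and> (\<forall>x. x \<notin> S \<longrightarrow> R x = 0)"
      by (simp add: R_def)
  next
    fix B assume B: "positive_on S B \<and> (\<forall>x\<in>S. B (B x) = A x) \<and> (\<forall>x. x \<notin> S \<longrightarrow> B x = 0)"
    have BS: "B x \<in> S" and Badd: "B (x + y) = B x + B y" and Bsc: "B (c *\<^sub>C x) = c *\<^sub>C B x"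
      and BB: "B (B x) = A x" if "x \<in> S" "y \<in> S" for x y c
      using B that by (auto simp: positive_on_def bounded_op_on_def)
    have Bpos: "cinner (B x) x \<in> \<real>\<^sub>\<ge>\<^sub>0" if "x \<in> S" for x
      using B that by (auto simp: positive_on_def)
    have sa: "cinner (B x) y = cinner x (B y)" if xy: "x \<in> S" "y \<in> S" for x y
    proof -
      have im: "Im (cinner (B z) z) = 0" if "z \<in> S" for z
        using Bpos[OF that] by (simp add: complex_nonneg_Reals_iff)
      have 1: "Im (cinner (B x) y) = - Im (cinner (B y) x)"
        using im[of "x + y"] xy csubspace_add[OF S xy] by (simp add: Badd cinner_simps im eq_neg_iff_add_eq_0)
      have iy: "\<i> *\<^sub>C y \<in> S" using xy by auto
      have "x + \<i> *\<^sub>C y \<in> S" using xy by auto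
      from im[OF this] have 2: "Re (cinner (B x) y) = Re (cinner (B y) x)"
        using xy im[OF xy(1)] im[OF xy(2)] by (simp add: Badd[OF xy(1) iy] Bsc[OF xy(2) xy(1)] cinner_simps)
      show ?thesis using 1 2 by (subst cinner_commute[of x]) (simp add: complex_eq_iff)
    qed
    have perp: "B x = 0" if "x \<in> S" "cinner x k = 0" for x
    proof -
      have "cinner (B x) (B x) = cinner x (B (B x))" using that by (intro sa BS) auto
      then show ?thesis using that by (simp add: BB A)
    qed
    have split: "x - (cinner x k / cinner k k) *\<^sub>C k \<in> S"
      "cinner (x - (cinner x k / cinner k k) *\<^sub>C k) k = 0" if "x \<in> S" for x
      using that k by (auto simp: cinner_simps)
    have B_eq: "B x = (cinner x k / cinner k k) *\<^sub>C B k" if "x \<in> S" for x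
    proof -
      have "B x = B ((x - (cinner x k / cinner k k) *\<^sub>C k) + (cinner x k / cinner k k) *\<^sub>C k)" by simp
      also have "\<dots> = B (x - (cinner x k / cinner k k) *\<^sub>C k) + (cinner x k / cinner k k) *\<^sub>C B k"
        using that k by (subst Badd) (auto simp: Bsc[OF k(1) k(1)])
      also have "B (x - (cinner x k / cinner k k) *\<^sub>C k) = 0" by (rule perp[OF split[OF that]])
      finally show ?thesis by simp
    qed
    define b where "b = cinner (B k) k / cinner k k"
    have Bk: "B k = b *\<^sub>C k"
    proof -
      let ?z = "B k - b *\<^sub>C k"
      have z: "?z \<in> S" "cinner ?z k = 0" using split[OF BS[OF k(1) k(1)]] by (auto simp: b_def)
      have "cinner (B k) ?z = 0" using sa[OF k(1) z(1)] perp[OF z] by simp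
      moreover have "cinner k ?z = 0" using z(2) cinner_commute[of k ?z] by simp
      ultimately have "cinner ?z ?z = 0" by (subst cinner_diff_left) (simp add: cinner_scaleC_left)
      then show ?thesis by simp
    qed
    have "cinner (B k) k = of_real (Re (cinner (B k) k))" "Re (cinner (B k) k) \<ge> 0"
      using Bpos[OF k(1)] by (auto simp: complex_nonneg_Reals_iff complex_eq_iff)
    then obtain \<beta> where \<beta>: "b = of_real \<beta>" "\<beta> \<ge> 0"
      using that[of "Re (cinner (B k) k) / (norm k)\<^sup>2"] by (simp add: b_def cinner_self)
    have "(b * b) *\<^sub>C k = cinner k k *\<^sub>C k"
      using BB[OF k(1) k(1)] A[OF k(1)] by (simp add: Bk Bsc[OF k(1) k(1)] scaleC_scaleC)
    then have "(b * b - cinner k k) *\<^sub>C k = 0" by (simp add: scaleC_diff_left)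
    then have "b * b = cinner k k" using k by (metis norm_scaleC mult_eq_0_iff norm_eq_zero right_minus_eq)
    then have "complex_of_real (\<beta>\<^sup>2) = of_real ((norm k)\<^sup>2)"
      by (simp add: \<beta> cinner_self power2_eq_square)
    then have "\<beta>\<^sup>2 = (norm k)\<^sup>2" by (simp only: of_real_eq_iff)
    then have b: "b = of_real (norm k)" using \<beta> by (simp add: power2_eq_iff_nonneg)
    show "B = R"
    proof
      fix x
      show "B x = R x"
        using B B_eq[of x] nk
        by (cases "x \<in> S") (simp_all add: R_def Bk b scaleC_scaleC cinner_self power2_eq_square)
    qed
  qed
  then show ?thesis using x by (simp add: R_def)
qed

lemma closed_complex_line: "closed (range (\<lambda>c. c *\<^sub>C (k::'a::complex_inner)))"
proof (cases "k = 0")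
  case False
  let ?F = "\<lambda>x. cinner k k *\<^sub>C x - cinner x k *\<^sub>C k"
  have "range (\<lambda>c. c *\<^sub>C k) = {x. ?F x = 0}"
  proof (intro set_eqI iffI)
    fix x assume "x \<in> {x. ?F x = 0}"
    then have "cinner k k *\<^sub>C x = cinner x k *\<^sub>C k" by simp
    then have "(1 / cinner k k) *\<^sub>C cinner k k *\<^sub>C x = (1 / cinner k k) *\<^sub>C cinner x k *\<^sub>C k" by simp
    then have "x = (cinner x k / cinner k k) *\<^sub>C k" using False by (simp add: scaleC_scaleC)
    then show "x \<in> range (\<lambda>c. c *\<^sub>C k)" by blast
  qed (auto simp: cinner_simps scaleC_simps mult.commute)
  moreover have "bounded_linear ?F"
    by (intro bounded_linear_sub bounded_linear_scaleC_right
        bounded_linear_compose[OF bounded_linear_scaleC_left bounded_linear_cinner_left])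
  then have "continuous_on UNIV ?F" by (simp add: linear_continuous_on)
  then have "closed {x. ?F x = 0}" by (rule closed_Collect_eq) simp
  ultimately show ?thesis by simp
qed simp

section \<open>Conjugations and complex symmetry\<close>

lemma conjugation_onD:
  assumes "conjugation_on S C" "x \<in> S"
  shows "C x \<in> S" "norm (C x) = norm x" "C (C x) = x" "C (c *\<^sub>C x) = cnj c *\<^sub>C C x"
    "y \<in> S \<Longrightarrow> C (x + y) = C x + C y"
  using assms by (auto simp: conjugation_on_def)

lemma conjugation_diff:
  assumes "csubspace S" "conjugation_on S C" "x \<in> S" "y \<in> S"
  shows "C (x - y) = C x - C y"
proof -
  have "C (x - y) = C (x + (-1) *\<^sub>C y)" by (simp add: scaleC_minus_left)
  also have "\<dots> = C x + cnj (-1) *\<^sub>C C y"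
    using assms by (metis conjugation_onD(4,5) csubspace_scaleC)
  finally show ?thesis by (simp add: scaleC_minus_left)
qed

lemma conjugation_cinner:
  assumes S: "csubspace S" and C: "conjugation_on S C" and xy: "x \<in> S" "y \<in> S"
  shows "cinner (C x) (C y) = cinner y x"
proof -
  have "(norm (x - cnj c *\<^sub>C y))\<^sup>2 = (norm (C x - c *\<^sub>C C y))\<^sup>2" for c
    using conjugation_onD(2)[OF C, of "x - cnj c *\<^sub>C y"] csubspace_intros[OF S] xy
    by (simp add: conjugation_diff[OF S C] conjugation_onD(4)[OF C])
  then have *: "Re (c * cinner x y) = Re (cnj c * cinner (C x) (C y))" for c
    using conjugation_onD(2)[OF C] xy
    unfolding norm_diff_scaleC_sq by (smt (verit) complex_cnj_cnj complex_mod_cnj)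
  have "cinner (C x) (C y) = cnj (cinner x y)"
    using *[of 1] *[of \<i>] by (simp add: complex_eq_iff)
  then show ?thesis using cinner_commute[of y x] by simp
qed

text \<open>
  A conjugation \<open>C\<close> defines the complex bilinear form \<open>\<langle>x, C y\<rangle>\<close>, and \<open>A = C A\<^sup>* C\<close> says that
  \<open>A\<close> is symmetric for this form. In this formulation the adjoint disappears: it is \<open>C A C\<close>.
\<close>

definition symmetric_wrt :: "'a::complex_inner set \<Rightarrow> ('a \<Rightarrow> 'a) \<Rightarrow> ('a \<Rightarrow> 'a) \<Rightarrow> bool" where
  "symmetric_wrt S C A \<longleftrightarrow> (\<forall>x\<in>S. \<forall>y\<in>S. cinner (A x) (C y) = cinner (A y) (C x))"

lemma complex_symmetric_onI:
  assumes S: "csubspace S" and A: "bounded_op_on S S A" and C: "conjugation_on S C"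
    and sym: "symmetric_wrt S C A"
  shows "complex_symmetric_on S A"
  unfolding complex_symmetric_on_def
proof (intro conjI exI ballI)
  have AS: "A x \<in> S" if "x \<in> S" for x using A that by (simp add: bounded_op_on_def)
  note CD = conjugation_onD[OF C]
  have adj: "adj_on S A y = C (A (C y))" if y: "y \<in> S" for y
  proof (rule adj_on_eqI[OF S])
    show "C (A (C y)) \<in> S" using y by (simp add: CD AS)
    fix x assume x: "x \<in> S"
    have "cinner (A x) (C (C y)) = cinner (A (C y)) (C x)"
      using sym x CD(1)[OF y] by (simp add: symmetric_wrt_def)
    also have "\<dots> = cinner x (C (A (C y)))"
      using conjugation_cinner[OF S C, of "C x" "A (C y)"] x y by (simp add: CD AS)
    finally show "cinner (A x) y = cinner x (C (A (C y)))" by (simp add: CD y)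
  qed
  show "A x = C (adj_on S A (C x))" if "x \<in> S" for x
    using that by (simp add: adj CD AS)
qed (use A C in auto)

lemma bounded_op_on_cong:
  assumes "csubspace S" "\<And>x. x \<in> S \<Longrightarrow> A x = B x"
  shows "bounded_op_on S S' A \<longleftrightarrow> bounded_op_on S S' B"
  using assms by (simp add: bounded_op_on_def csubspace_def cong: ball_cong)

lemma complex_symmetric_on_cong:
  assumes "csubspace S" "\<And>x. x \<in> S \<Longrightarrow> A x = B x"
  shows "complex_symmetric_on S A \<longleftrightarrow> complex_symmetric_on S B"
proof -
  have "adj_on S A = adj_on S B" using assms(2) by (simp add: adj_on_def fun_eq_iff cong: ball_cong)
  then show ?thesis
    using assms(2) by (simp add: complex_symmetric_on_def bounded_op_on_cong[OF assms] cong: ball_cong)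
qed

text \<open>
  Complex symmetry is invariant under unitary equivalence: the conjugation is carried back along the
  unitary map \<open>W\<close> with inverse \<open>U\<close>.
\<close>

lemma complex_symmetric_on_transport:
  fixes W :: "'a::complex_inner \<Rightarrow> 'b::complex_inner"
  assumes S: "csubspace S" and A: "bounded_op_on S S A"
    and S0: "csubspace S0" and C0: "conjugation_on S0 C0" and sym: "symmetric_wrt S0 C0 A0"
    and W: "\<And>x. x \<in> S \<Longrightarrow> W x \<in> S0" "\<And>x y. x \<in> S \<Longrightarrow> y \<in> S \<Longrightarrow> W (x + y) = W x + W y"
      "\<And>c x. x \<in> S \<Longrightarrow> W (c *\<^sub>C x) = c *\<^sub>C W x" "\<And>x. x \<in> S \<Longrightarrow> norm (W x) = norm x"
    and U: "\<And>x. x \<in> S0 \<Longrightarrow> U x \<in> S" "\<And>x. x \<in> S0 \<Longrightarrow> W (U x) = x"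
    and int: "\<And>x. x \<in> S \<Longrightarrow> W (A x) = A0 (W x)"
  shows "complex_symmetric_on S A"
proof (rule complex_symmetric_onI[OF S A, of "\<lambda>x. U (C0 (W x))"])
  note CD = conjugation_onD[OF C0]
  note SI = csubspace_intros[OF S]
  have Wd: "W (x - c *\<^sub>C y) = W x - c *\<^sub>C W y" if "x \<in> S" "y \<in> S" for x y c
    using W(2)[of x "(- c) *\<^sub>C y"] W(3)[of y "- c"] SI(4)[of y "- c"] that
    by (simp add: scaleC_minus_left)
  have inj: "x = y" if "x \<in> S" "y \<in> S" "W x = W y" for x y
    using W(4)[of "x - y"] Wd[of x y 1] that SI by simp
  have WC: "cinner (W x) (W y) = cinner x y" if "x \<in> S" "y \<in> S" for x y
  proof (rule cinner_eq_if_norm_eq)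
    show "norm (W x - c *\<^sub>C W y) = norm (x - c *\<^sub>C y)" for c
      using that SI by (simp add: W(4) flip: Wd)
  qed
  have US: "U (C0 (W x)) \<in> S" if "x \<in> S" for x using that by (simp add: W U CD)
  show "conjugation_on S (\<lambda>x. U (C0 (W x)))"
    unfolding conjugation_on_def
  proof (intro conjI ballI allI)
    fix x assume x: "x \<in> S"
    show "U (C0 (W x)) \<in> S" by (rule US[OF x])
    show "U (C0 (W (U (C0 (W x))))) = x"
      by (rule inj) (use x US in \<open>simp_all add: U W CD\<close>)
    show "norm (U (C0 (W x))) = norm x"
      using W(4)[OF US[OF x]] x by (simp add: U W CD)
    show "U (C0 (W (c *\<^sub>C x))) = cnj c *\<^sub>C U (C0 (W x))" for c
      by (rule inj) (use x US csubspace_intros[OF S0] SI in \<open>simp_all add: U W CD\<close>)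
    fix y assume y: "y \<in> S"
    show "U (C0 (W (x + y))) = U (C0 (W x)) + U (C0 (W y))"
      by (rule inj) (use x y US csubspace_intros[OF S0] SI in \<open>simp_all add: U W CD\<close>)
  qed
  show "symmetric_wrt S (\<lambda>x. U (C0 (W x))) A"
    unfolding symmetric_wrt_def
  proof (intro ballI)
    fix x y assume xy: "x \<in> S" "y \<in> S"
    have AS: "A x \<in> S" if "x \<in> S" for x using A that by (simp add: bounded_op_on_def)
    have *: "cinner (A x) (U (C0 (W y))) = cinner (A0 (W x)) (C0 (W y))" if "x \<in> S" "y \<in> S" for x y
      using WC[OF AS[OF that(1)] US[OF that(2)]] that by (simp add: U W CD int)
    show "cinner (A x) (U (C0 (W y))) = cinner (A y) (U (C0 (W x)))"
      using sym xy by (simp add: * symmetric_wrt_def W)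
  qed
qed

section \<open>Coefficients and evaluation in the Hardy space\<close>

lemma hardy2_fun_zero: "hardy2_fun 0 z = 0"
  by (simp add: zero_hardy2.rep_eq)

lemma hardy2_fun_add: "hardy2_fun (f + g) z = hardy2_fun f z + hardy2_fun g z"
  by (simp add: plus_hardy2.rep_eq)

lemma hardy2_fun_diff: "hardy2_fun (f - g) z = hardy2_fun f z - hardy2_fun g z"
  by (simp add: minus_hardy2.rep_eq)

lemma hardy2_fun_scaleC: "hardy2_fun (c *\<^sub>C f) z = c * hardy2_fun f z"
  by (simp add: scaleC_hardy2.rep_eq)

lemma hardy2_fun_shift: "hardy2_fun (hardy2_shift_op f) z = z * hardy2_fun f z"
  by (simp add: hardy2_shift_op.rep_eq)

lemma hardy2_fun_outside: "z \<notin> ball 0 1 \<Longrightarrow> hardy2_fun f z = 0"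
  using hardy2_fun[of f] by (auto simp: hardy2_set_def)

lemma hardy2_eqI: "(\<And>z. z \<in> ball 0 1 \<Longrightarrow> hardy2_fun f z = hardy2_fun g z) \<Longrightarrow> f = g"
  by (rule hardy2_fun_inject[THEN iffD1], rule ext) (metis hardy2_fun_outside)

lemma hcoeff_scaleC: "hcoeff (c *\<^sub>C f) n = c * hcoeff f n"
  unfolding hcoeff_def scaleC_hardy2.rep_eq by (intro taylor_coeff_cmult hardy2_fun_holomorphic)

lemma hcoeff_diff: "hcoeff (f - g) n = hcoeff f n - hcoeff g n"
  using hcoeff_add[of "f - g" g n] by simp

lemma hcoeff_sum: "hcoeff (\<Sum>i\<in>I. f i) n = (\<Sum>i\<in>I. hcoeff (f i) n)"
  by (induction I rule: infinite_finite_induct) (simp_all add: hcoeff_add hcoeff_zero)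

lemma hardy2_eqI_hcoeff:
  assumes "\<And>n. hcoeff f n = hcoeff g n" shows "f = g"
  using hcoeff_eq_0_imp[of "f - g"] assms by (simp add: hcoeff_diff)

lemma hardy2_fun_sums:
  assumes "z \<in> ball 0 1" shows "(\<lambda>n. hcoeff f n * z ^ n) sums hardy2_fun f z"
  using holomorphic_power_series[OF hardy2_fun_holomorphic assms, of f]
  by (simp add: hcoeff_def taylor_coeff_def fps_expansion_def)

lemma hcoeff_0: "hcoeff f 0 = hardy2_fun f 0"
  using hardy2_fun_sums[of 0 f] sums_unique2[OF _ powser_sums_zero] by fastforce

lemma cinner_hcoeff_sums: "(\<lambda>n. hcoeff f n * cnj (hcoeff g n)) sums cinner f g"
  unfolding cinner_hardy2_def using hcoeff_mult_summable by (rule summable_sums)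

lemma norm_hcoeff_sums: "(\<lambda>n. (cmod (hcoeff f n))\<^sup>2) sums (norm f)\<^sup>2"
proof -
  have "(\<lambda>n. complex_of_real ((cmod (hcoeff f n))\<^sup>2)) sums complex_of_real ((norm f)\<^sup>2)"
    using cinner_hcoeff_sums[of f f] by (simp add: complex_norm_square cinner_self del: of_real_power)
  then show ?thesis by (simp only: sums_of_real_iff)
qed

definition hardy2_of :: "(nat \<Rightarrow> complex) \<Rightarrow> hardy2" where
  "hardy2_of a = Abs_hardy2 (\<lambda>z. if z \<in> ball 0 1 then \<Sum>n. a n * z ^ n else 0)"

lemma hcoeff_hardy2_of:
  assumes a: "summable (\<lambda>n. (cmod (a n))\<^sup>2)"
  shows "hcoeff (hardy2_of a) n = a n"
proof -
  define F where "F = Abs_fps a"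
  define f where "f z = (if z \<in> ball 0 1 then \<Sum>n. a n * z ^ n else 0)" for z
  have "(\<lambda>n. (cmod (a n))\<^sup>2) \<longlonglongrightarrow> 0" using a by (rule summable_LIMSEQ_zero)
  then have "(\<lambda>n. sqrt ((cmod (a n))\<^sup>2)) \<longlonglongrightarrow> sqrt 0" by (intro tendsto_real_sqrt)
  then have "a \<longlonglongrightarrow> 0" by (simp add: tendsto_norm_zero_iff)
  then have "Bseq a" by (intro convergent_imp_Bseq) (auto simp: convergent_def)
  then obtain M where M: "\<And>n. cmod (a n) \<le> M" by (auto simp: Bseq_def)
  have "conv_radius a \<ge> 1"
  proof (rule conv_radius_geI_ex')
    fix r :: real assume r: "0 < r" "ereal r < 1"
    show "summable (\<lambda>n. a n * complex_of_real r ^ n)"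
    proof (rule summable_comparison_test')
      show "summable (\<lambda>n. M * r ^ n)" using r by (intro summable_mult summable_geometric) auto
      show "norm (a n * complex_of_real r ^ n) \<le> M * r ^ n" for n
        using M[of n] r by (simp add: norm_mult norm_power mult_right_mono)
    qed
  qed
  then have R: "fps_conv_radius F \<ge> 1" by (simp add: fps_conv_radius_def F_def)
  have f_eq: "f z = eval_fps F z" if "z \<in> ball 0 1" for z
    using that by (simp add: f_def eval_fps_def F_def)
  have "ball 0 1 \<subseteq> eball (0::complex) 1" by (auto simp: one_ereal_def)
  also have "\<dots> \<subseteq> eball 0 (fps_conv_radius F)" using R by (intro eball_mono) simp_all
  finally have "eval_fps F holomorphic_on ball 0 1" by (rule holomorphic_on_eval_fps)
  then have hol: "f holomorphic_on ball 0 1"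
    by (rule holomorphic_transform) (simp add: f_eq)
  have "eventually (\<lambda>z. z \<in> ball 0 1) (nhds (0::complex))" by (intro eventually_nhds_in_open) auto
  then have "eventually (\<lambda>z. eval_fps F z = f z) (nhds 0)"
    by eventually_elim (simp add: f_eq)
  moreover have "fps_conv_radius F > 0" using R by (rule less_le_trans[rotated]) simp
  ultimately have "f has_fps_expansion F" by (simp add: has_fps_expansion_def)
  then have tc: "taylor_coeff f n = a n" for n by (simp add: taylor_coeff_eqI F_def)
  have "f \<in> hardy2_set" using hol a by (simp add: hardy2_set_def tc f_def)
  then have "hardy2_fun (hardy2_of a) = f"
    unfolding hardy2_of_def using Abs_hardy2_inverse[of f] by (simp add: f_def[abs_def])
  then show ?thesis by (simp add: hcoeff_def tc)
qed

text \<open>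
  Membership in the Hardy space, with a norm bound, only needs a bound on finite sections of the
  coefficient sequence. An operator can therefore be defined by its matrix in the monomials, once it is
  bounded on polynomials.
\<close>

lemma hardy2_of_bounded:
  assumes "\<And>N. (\<Sum>n<N. (cmod (a n))\<^sup>2) \<le> M\<^sup>2" "M \<ge> 0"
  shows "hcoeff (hardy2_of a) n = a n" "norm (hardy2_of a) \<le> M"
proof -
  have sm: "summable (\<lambda>n. (cmod (a n))\<^sup>2)"
    using assms by (intro summableI_nonneg_bounded[where x="M\<^sup>2"]) auto
  then show *: "hcoeff (hardy2_of a) n = a n" for n by (rule hcoeff_hardy2_of)
  have "(norm (hardy2_of a))\<^sup>2 = (\<Sum>n. (cmod (a n))\<^sup>2)"
    using norm_hcoeff_sums[of "hardy2_of a"] by (simp add: * sums_iff)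
  also have "\<dots> \<le> M\<^sup>2" using sm assms(1) by (rule suminf_le_const)
  finally show "norm (hardy2_of a) \<le> M" using assms(2) by (rule power2_le_imp_le)
qed

lemma sum_hcoeff_le: "(\<Sum>n<N. (cmod (hcoeff f n))\<^sup>2) \<le> (norm f)\<^sup>2"
  using norm_hcoeff_sums[of f] by (metis sum_le_suminf sums_iff finite_lessThan zero_le_power2)

definition hmonom :: "nat \<Rightarrow> hardy2" where
  "hmonom n = hardy2_of (\<lambda>k. if k = n then 1 else 0)"

lemma hcoeff_hmonom: "hcoeff (hmonom n) k = (if k = n then 1 else 0)"
  unfolding hmonom_def
  by (rule hcoeff_hardy2_of) (rule summable_finite[of "{n}"], auto)

lemma cinner_hmonom: "cinner f (hmonom n) = hcoeff f n"
proof -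
  have "(\<lambda>k. hcoeff f k * cnj (hcoeff (hmonom n) k)) sums hcoeff f n"
    using sums_single[of n "hcoeff f"] by (simp add: hcoeff_hmonom if_distrib cong: if_cong)
  then show ?thesis using cinner_hcoeff_sums sums_unique2 by blast
qed

lemma cinner_hmonom_left: "cinner (hmonom n) f = cnj (hcoeff f n)"
  by (metis cinner_hmonom cinner_commute)

lemma hardy2_fun_hmonom:
  assumes "z \<in> ball 0 1" shows "hardy2_fun (hmonom n) z = z ^ n"
proof -
  have "(\<lambda>k. hcoeff (hmonom n) k * z ^ k) sums z ^ n"
    using sums_single[of n "\<lambda>k. z ^ k"]
    by (simp add: hcoeff_hmonom if_distrib[of "\<lambda>x. x * _"] cong: if_cong)
  then show ?thesis using hardy2_fun_sums[OF assms] sums_unique2 by blast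
qed

definition truncate :: "nat \<Rightarrow> hardy2 \<Rightarrow> hardy2" where
  "truncate N f = (\<Sum>n<N. hcoeff f n *\<^sub>C hmonom n)"

lemma hcoeff_truncate: "hcoeff (truncate N f) n = (if n < N then hcoeff f n else 0)"
  by (simp add: truncate_def hcoeff_sum hcoeff_scaleC hcoeff_hmonom if_distrib cong: if_cong)

lemma norm_truncate_sq: "(norm (truncate N f))\<^sup>2 = (\<Sum>n<N. (cmod (hcoeff f n))\<^sup>2)"
proof -
  have "(\<lambda>n. (cmod (hcoeff (truncate N f) n))\<^sup>2) sums (\<Sum>n<N. (cmod (hcoeff f n))\<^sup>2)"
    using sums_If_finite_set[of "{..<N}" "\<lambda>n. (cmod (hcoeff f n))\<^sup>2"]
    by (simp add: hcoeff_truncate if_distrib[of "\<lambda>x. (cmod x)\<^sup>2"] cong: if_cong)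
  then show ?thesis using norm_hcoeff_sums sums_unique2 by blast
qed

lemma norm_truncate_le: "norm (truncate N f) \<le> norm f"
  by (rule power2_le_imp_le) (simp_all add: norm_truncate_sq sum_hcoeff_le)

lemma truncate_tendsto: "(\<lambda>N. truncate N f) \<longlonglongrightarrow> f"
proof -
  have "(norm (f - truncate N f))\<^sup>2 = (norm f)\<^sup>2 - (\<Sum>n<N. (cmod (hcoeff f n))\<^sup>2)" for N
  proof -
    have "(\<lambda>n. (cmod (hcoeff f n))\<^sup>2 - (if n < N then (cmod (hcoeff f n))\<^sup>2 else 0))
        sums ((norm f)\<^sup>2 - (\<Sum>n<N. (cmod (hcoeff f n))\<^sup>2))"
      using sums_If_finite_set[of "{..<N}" "\<lambda>n. (cmod (hcoeff f n))\<^sup>2"]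
      by (intro sums_diff norm_hcoeff_sums) simp
    moreover have "(cmod (hcoeff (f - truncate N f) n))\<^sup>2 =
        (cmod (hcoeff f n))\<^sup>2 - (if n < N then (cmod (hcoeff f n))\<^sup>2 else 0)" for n
      by (simp add: hcoeff_diff hcoeff_truncate)
    ultimately show ?thesis
      using norm_hcoeff_sums[of "f - truncate N f"] by (metis (no_types, lifting) sums_cong sums_unique2)
  qed
  moreover have "(\<lambda>N. (norm f)\<^sup>2 - (\<Sum>n<N. (cmod (hcoeff f n))\<^sup>2)) \<longlonglongrightarrow> (norm f)\<^sup>2 - (norm f)\<^sup>2"
    using norm_hcoeff_sums[of f] by (intro tendsto_diff tendsto_const) (simp add: sums_def)
  ultimately have "(\<lambda>N. (norm (f - truncate N f))\<^sup>2) \<longlonglongrightarrow> 0" by simp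
  then have "(\<lambda>N. sqrt ((norm (f - truncate N f))\<^sup>2)) \<longlonglongrightarrow> sqrt 0" by (intro tendsto_real_sqrt)
  then have "(\<lambda>N. f - truncate N f) \<longlonglongrightarrow> 0" by (simp add: tendsto_norm_zero_iff)
  from tendsto_diff[OF tendsto_const[of f] this] show ?thesis by simp
qed

text \<open>The reproducing kernel of the Hardy space, \<open>z \<mapsto> 1 / (1 - w\<^sup>* z)\<close>.\<close>

definition szego :: "complex \<Rightarrow> hardy2" where
  "szego w = hardy2_of (\<lambda>n. cnj w ^ n)"

lemma hcoeff_szego:
  assumes "w \<in> ball 0 1" shows "hcoeff (szego w) n = cnj w ^ n"
  unfolding szego_def
proof (rule hcoeff_hardy2_of)
  have "(cmod w)\<^sup>2 < 1" using assms by (simp add: abs_square_less_1)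
  then have "summable (\<lambda>n. ((cmod w)\<^sup>2) ^ n)" by (intro summable_geometric) simp
  then show "summable (\<lambda>n. (cmod (cnj w ^ n))\<^sup>2)"
    by (simp add: norm_power power_mult[symmetric] mult.commute)
qed

lemma cinner_szego:
  assumes "w \<in> ball 0 1" shows "cinner f (szego w) = hardy2_fun f w"
  using cinner_hcoeff_sums[of f "szego w"] hardy2_fun_sums[OF assms, of f] sums_unique2
  by (fastforce simp: hcoeff_szego[OF assms])

lemma hcoeff_shift: "hcoeff (hardy2_shift_op f) n = (if n = 0 then 0 else hcoeff f (n - 1))"
  unfolding hcoeff_def hardy2_shift_op.rep_eq by (rule taylor_coeff_shift[OF hardy2_fun_holomorphic])

lemma shift_add: "hardy2_shift_op (f + g) = hardy2_shift_op f + hardy2_shift_op g"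
  and shift_diff: "hardy2_shift_op (f - g) = hardy2_shift_op f - hardy2_shift_op g"
  and shift_scaleC: "hardy2_shift_op (c *\<^sub>C f) = c *\<^sub>C hardy2_shift_op f"
  by (rule hardy2_eqI; simp add: hardy2_fun_shift hardy2_fun_add hardy2_fun_diff hardy2_fun_scaleC
      algebra_simps)+

definition backshift :: "hardy2 \<Rightarrow> hardy2" where
  "backshift f = hardy2_of (\<lambda>n. hcoeff f (Suc n))"

lemma hcoeff_backshift: "hcoeff (backshift f) n = hcoeff f (Suc n)"
  unfolding backshift_def
  by (rule hcoeff_hardy2_of) (subst summable_Suc_iff, rule hcoeff_summable)

lemma backshift_add: "backshift (f + g) = backshift f + backshift g"
  and backshift_diff: "backshift (f - g) = backshift f - backshift g"
  and backshift_scaleC: "backshift (c *\<^sub>C f) = c *\<^sub>C backshift f"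
  by (rule hardy2_eqI_hcoeff; simp add: hcoeff_backshift hcoeff_add hcoeff_diff hcoeff_scaleC)+

lemma backshift_shift [simp]: "backshift (hardy2_shift_op f) = f"
  by (rule hardy2_eqI_hcoeff) (simp add: hcoeff_backshift hcoeff_shift)

lemma shift_backshift: "hardy2_shift_op (backshift f) = f - hardy2_fun f 0 *\<^sub>C hmonom 0"
  by (rule hardy2_eqI_hcoeff)
    (simp add: hcoeff_backshift hcoeff_shift hcoeff_diff hcoeff_scaleC hcoeff_hmonom hcoeff_0)

lemma backshift_hmonom_0 [simp]: "backshift (hmonom 0) = 0"
  by (rule hardy2_eqI_hcoeff) (simp add: hcoeff_backshift hcoeff_hmonom hcoeff_zero)

lemma hmonom_Suc: "hmonom (Suc n) = hardy2_shift_op (hmonom n)"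
  by (rule hardy2_eqI_hcoeff) (auto simp: hcoeff_shift hcoeff_hmonom)

lemma hardy2_fun_backshift:
  assumes "z \<in> ball 0 1" shows "z * hardy2_fun (backshift f) z = hardy2_fun f z - hardy2_fun f 0"
  using arg_cong[OF shift_backshift, of "\<lambda>g. hardy2_fun g z" f] assms
  by (simp add: hardy2_fun_shift hardy2_fun_diff hardy2_fun_scaleC hardy2_fun_hmonom)

lemma cinner_shift_left: "cinner (hardy2_shift_op f) g = cinner f (backshift g)"
proof -
  have "(\<lambda>n. hcoeff (hardy2_shift_op f) (Suc n) * cnj (hcoeff g (Suc n))) sums cinner f (backshift g)"
    using cinner_hcoeff_sums[of f "backshift g"] by (simp add: hcoeff_shift hcoeff_backshift)
  then have "(\<lambda>n. hcoeff (hardy2_shift_op f) n * cnj (hcoeff g n)) sums cinner f (backshift g)"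
    by (subst (asm) sums_Suc_iff) (simp add: hcoeff_shift)
  then show ?thesis using cinner_hcoeff_sums sums_unique2 by blast
qed

lemma cinner_shift_right: "cinner f (hardy2_shift_op g) = cinner (backshift f) g"
  by (metis cinner_commute cinner_shift_left)

lemma cinner_shift_shift: "cinner (hardy2_shift_op f) (hardy2_shift_op g) = cinner f g"
  by (simp add: cinner_shift_left)

lemma szego_eq:
  assumes w: "w \<in> ball 0 1"
  shows "szego w = hmonom 0 + cnj w *\<^sub>C hardy2_shift_op (szego w)"
proof (rule hardy2_eqI_hcoeff)
  show "hcoeff (szego w) n = hcoeff (hmonom 0 + cnj w *\<^sub>C hardy2_shift_op (szego w)) n" for n
    by (cases n) (simp_all add: hcoeff_szego[OF w] hcoeff_add hcoeff_hmonom hcoeff_scaleC hcoeff_shift)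
qed

lemma norm_backshift_le: "norm (backshift f) \<le> norm f"
proof -
  have "(\<lambda>n. (cmod (hcoeff f (Suc n)))\<^sup>2) sums (norm (backshift f))\<^sup>2"
    using norm_hcoeff_sums[of "backshift f"] by (simp add: hcoeff_backshift)
  then have "(norm f)\<^sup>2 = (norm (backshift f))\<^sup>2 + (cmod (hcoeff f 0))\<^sup>2"
    by (subst (asm) sums_Suc_iff) (rule sums_unique2[OF norm_hcoeff_sums])
  then have "(norm (backshift f))\<^sup>2 \<le> (norm f)\<^sup>2" by simp
  then show ?thesis by (rule power2_le_imp_le) simp
qed

section \<open>Mean squares on circles\<close>

lemma integrable_circle:
  "continuous_on {0..2 * pi} f \<Longrightarrow> integrable (lebesgue_on {0..2 * pi}) (f :: real \<Rightarrow> complex)"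
  by (rule continuous_imp_integrable_real)

lemma integral_cis:
  "(LINT t|lebesgue_on {0..2 * pi}. cis (of_int k * t)) = (if k = 0 then of_real (2 * pi) else 0)"
proof (cases "k = 0")
  case True
  have "measure lebesgue {0..2 * pi} = 2 * pi" by simp
  then show ?thesis using True by (simp add: measure_restrict_space scaleR_conv_of_real)
next
  case False
  have "((\<lambda>t. cis (of_int k * t)) has_integral
      exp (\<i> * of_int k * of_real (2 * pi)) / (\<i> * of_int k) - exp (\<i> * of_int k * of_real 0) / (\<i> * of_int k))
      {0..2 * pi}"
  proof (rule fundamental_theorem_of_calculus)
    fix t :: real assume "t \<in> {0..2 * pi}"
    have "((\<lambda>z. exp (\<i> * of_int k * z) / (\<i> * of_int k)) has_field_derivative exp (\<i> * of_int k * of_real t))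
        (at (of_real t))"
      using False by (auto intro!: derivative_eq_intros)
    from has_vector_derivative_real_field[OF this]
    show "((\<lambda>t. exp (\<i> * of_int k * of_real t) / (\<i> * of_int k)) has_vector_derivative
        cis (of_int k * t)) (at t within {0..2 * pi})"
      by (simp add: cis_conv_exp mult_ac)
  qed simp
  moreover have "exp (\<i> * of_int k * of_real (2 * pi)) = 1"
    using exp_integer_2pi[of "of_int k"] by (simp add: mult_ac)
  ultimately have "integral {0..2 * pi} (\<lambda>t. cis (of_int k * t)) = 0"
    by (simp add: integral_unique)
  moreover have "integrable (lebesgue_on {0..2 * pi}) (\<lambda>t. cis (of_int k * t))"
    by (intro integrable_circle continuous_intros)
  ultimately show ?thesis using False by (simp add: lebesgue_integral_eq_integral)
qed

lemma integral_cis_series: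
  fixes b :: "nat \<Rightarrow> complex" and h :: "real \<Rightarrow> complex"
  assumes b: "summable (\<lambda>n. cmod (b n))" and h: "continuous_on {0..2 * pi} h"
  shows "(\<lambda>n. b n * (LINT t|lebesgue_on {0..2 * pi}. cis (real n * t) * h t)) sums
    (LINT t|lebesgue_on {0..2 * pi}. (\<Sum>n. b n * cis (real n * t)) * h t)"
proof -
  let ?L = "lebesgue_on {0..2 * pi}"
  have int: "integrable ?L (\<lambda>t. b n * (cis (real n * t) * h t))" for n
    by (intro integrable_circle continuous_intros h)
  have "integrable ?L (\<lambda>t. cmod (h t))"
    by (intro continuous_imp_integrable_real continuous_intros h)
  have sm: "summable (\<lambda>n. b n * (cis (real n * t) * h t))" for t
    by (rule summable_norm_cancel) (simp add: norm_mult summable_mult2[OF b])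
  have "(\<lambda>n. LINT t|?L. b n * (cis (real n * t) * h t)) sums
      (LINT t|?L. (\<Sum>n. b n * (cis (real n * t) * h t)))"
  proof (rule sums_integral[OF int])
    show "AE t in ?L. summable (\<lambda>n. cmod (b n * (cis (real n * t) * h t)))"
      by (simp add: norm_mult summable_mult2[OF b])
    show "summable (\<lambda>n. LINT t|?L. cmod (b n * (cis (real n * t) * h t)))"
      by (simp add: norm_mult summable_mult2[OF b])
  qed
  moreover have "(\<Sum>n. b n * (cis (real n * t) * h t)) = (\<Sum>n. b n * cis (real n * t)) * h t" for t
  proof -
    have "summable (\<lambda>n. b n * cis (real n * t))"
      by (rule summable_norm_cancel) (simp add: norm_mult b)
    then show ?thesis by (subst suminf_mult2) (simp_all add: mult.assoc)
  qed
  ultimately show ?thesis by simp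
qed

lemma holomorphic_circle_continuous:
  assumes "f holomorphic_on ball 0 1" "0 \<le> r" "r < 1"
  shows "continuous_on A (\<lambda>t. f (of_real r * cis t))"
proof (rule continuous_on_compose2[OF holomorphic_on_imp_continuous_on[OF assms(1)]])
  show "(\<lambda>t. of_real r * cis t) ` A \<subseteq> ball 0 1" using assms by (auto simp: norm_mult)
qed (intro continuous_intros)

text \<open>Parseval's identity on the circle of radius \<open>r < 1\<close>.\<close>

lemma circle_mean_square:
  assumes f: "f holomorphic_on ball 0 1" and r: "0 \<le> r" "r < 1"
  shows "(\<lambda>n. (cmod (taylor_coeff f n))\<^sup>2 * (r ^ n)\<^sup>2) sums
    ((LINT t|lebesgue_on {0..2 * pi}. (cmod (f (of_real r * cis t)))\<^sup>2) / (2 * pi))"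
proof -
  let ?L = "lebesgue_on {0..2 * pi}"
  define b where "b n = taylor_coeff f n * of_real r ^ n" for n
  define G where "G t = f (of_real r * cis t)" for t
  have ps: "(\<lambda>n. taylor_coeff f n * z ^ n) sums f z" if "z \<in> ball 0 1" for z
    using holomorphic_power_series[OF f that] by (simp add: taylor_coeff_def fps_expansion_def)
  have b: "summable (\<lambda>n. cmod (b n))"
    unfolding b_def
  proof (rule powser_insidea)
    show "summable (\<lambda>n. taylor_coeff f n * of_real ((1 + r) / 2) ^ n)"
      using ps[of "of_real ((1 + r) / 2)"] r by (intro sums_summable) (auto simp del: of_real_divide of_real_add)
    show "cmod (of_real r) < cmod (of_real ((1 + r) / 2))" using r by (simp del: of_real_divide of_real_add)
  qed
  have G_sums: "(\<Sum>n. b n * cis (real n * t)) = G t" for t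
    using ps[of "of_real r * cis t"] r
    by (simp add: norm_mult G_def b_def power_mult_distrib Complex.DeMoivre mult.assoc sums_iff)
  have G_cont: "continuous_on {0..2 * pi} G"
    unfolding G_def by (rule holomorphic_circle_continuous[OF f r])
  have coeff: "(LINT t|?L. cis (real n * t) * cnj (G t)) = 2 * pi * cnj (b n)" for n
  proof -
    have "(\<lambda>m. b m * (LINT t|?L. cis (real m * t) * cis (- real n * t))) sums
        (LINT t|?L. (\<Sum>m. b m * cis (real m * t)) * cis (- real n * t))"
      by (intro integral_cis_series b continuous_intros)
    moreover have "(LINT t|?L. cis (real m * t) * cis (- real n * t)) =
        (if m = n then of_real (2 * pi) else 0)" for m
      using integral_cis[of "int m - int n"] by (simp add: cis_mult left_diff_distrib)
    ultimately have "(\<lambda>m. b m * (if m = n then of_real (2 * pi) else 0)) sums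
        (LINT t|?L. G t * cis (- real n * t))"
      by (simp only: G_sums)
    then have "(\<lambda>m. if m = n then 2 * pi * b m else 0) sums (LINT t|?L. G t * cis (- real n * t))"
      by (simp add: if_distrib[of "(*) _"] mult.commute cong: if_cong)
    then have *: "(LINT t|?L. G t * cis (- real n * t)) = 2 * pi * b n"
      by (rule sums_unique2) (rule sums_single)
    have "(LINT t|?L. cis (real n * t) * cnj (G t)) = (LINT t|?L. cnj (G t * cis (- real n * t)))"
      by (simp add: cis_cnj mult.commute)
    also have "\<dots> = cnj (LINT t|?L. G t * cis (- real n * t))" by (rule Bochner_Integration.integral_cnj)
    finally show ?thesis unfolding * by simp
  qed
  have "(\<lambda>n. b n * (LINT t|?L. cis (real n * t) * cnj (G t))) sums
      (LINT t|?L. (\<Sum>n. b n * cis (real n * t)) * cnj (G t))"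
    by (intro integral_cis_series b continuous_intros G_cont)
  then have "(\<lambda>n. complex_of_real (2 * pi * (cmod (b n))\<^sup>2)) sums (LINT t|?L. complex_of_real ((cmod (G t))\<^sup>2))"
    unfolding coeff G_sums complex_norm_square of_real_mult by (simp add: mult_ac)
  then have "(\<lambda>n. 2 * pi * (cmod (b n))\<^sup>2) sums (LINT t|?L. (cmod (G t))\<^sup>2)"
    unfolding integral_complex_of_real by (simp only: sums_of_real_iff)
  then have "(\<lambda>n. 2 * pi * (cmod (b n))\<^sup>2 / (2 * pi)) sums ((LINT t|?L. (cmod (G t))\<^sup>2) / (2 * pi))"
    by (rule sums_divide)
  then show ?thesis
    using r by (simp add: b_def G_def norm_mult norm_power power_mult_distrib)
qed

section \<open>Multiplication by an inner function\<close>

lemma inner_function_bounded: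
  assumes "inner_function u"
  obtains M where "\<And>z. z \<in> ball 0 1 \<Longrightarrow> cmod (u z) \<le> M"
proof -
  have "bounded (u ` ball 0 1)" using assms by (simp add: inner_function_def)
  then obtain M where "\<forall>x\<in>u ` ball 0 1. cmod x \<le> M" unfolding bounded_iff by blast
  then show ?thesis by (intro that) blast
qed

text \<open>
  The squared coefficient norm of \<open>u p\<close> is the limit of the mean squares over circles of radius
  \<open>r \<rightarrow> 1\<close>, where \<open>\<bar>u\<bar>\<close> tends to 1 almost everywhere; so it does not depend on \<open>u\<close>, and \<open>u = 1\<close>
  gives the norm of \<open>p\<close> itself.
\<close>

lemma inner_mult_mean_square:
  assumes u: "inner_function u" and p: "p holomorphic_on ball 0 1" "continuous_on (cball 0 1) p"
  shows "(\<lambda>n. (cmod (taylor_coeff (\<lambda>z. u z * p z) n))\<^sup>2) sums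
    ((LINT t|lebesgue_on {0..2 * pi}. (cmod (p (cis t)))\<^sup>2) / (2 * pi))"
proof -
  let ?L = "lebesgue_on {0..2 * pi}"
  define r where "r j = 1 - 1 / real (j + 2)" for j
  have r: "0 \<le> r j" "r j < 1" for j by (auto simp: r_def field_simps)
  have r1: "r \<longlonglongrightarrow> 1"
  proof -
    have "(\<lambda>j. 1 - 1 / real (j + 2)) \<longlonglongrightarrow> 1 - 0"
      by (intro tendsto_intros LIMSEQ_ignore_initial_segment[OF lim_1_over_n])
    then show ?thesis by (simp add: r_def[abs_def])
  qed
  have r_left: "filterlim r (at_left 1) sequentially"
    using r1 by (intro filterlim_atI tendsto_imp_filterlim_at_left) (auto simp: r eventually_sequentially)
  define c where "c n = (cmod (taylor_coeff (\<lambda>z. u z * p z) n))\<^sup>2" for n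
  define I where "I = (LINT t|?L. (cmod (p (cis t)))\<^sup>2) / (2 * pi)"
  define J where "J j = (LINT t|?L. (cmod (u (r j * cis t) * p (r j * cis t)))\<^sup>2) / (2 * pi)" for j
  have hol: "u holomorphic_on ball 0 1" using u by (simp add: inner_function_def)
  have up: "(\<lambda>z. u z * p z) holomorphic_on ball 0 1" by (intro holomorphic_intros hol p)
  have J: "(\<lambda>n. c n * (r j ^ n)\<^sup>2) sums J j" for j
    unfolding c_def J_def by (rule circle_mean_square[OF up r])
  obtain M where M: "\<And>z. z \<in> ball 0 1 \<Longrightarrow> cmod (u z) \<le> M" using inner_function_bounded[OF u] by blast
  have "compact (p ` cball 0 1)" by (intro compact_continuous_image p compact_cball)
  then have "bounded (p ` cball 0 1)" by (rule compact_imp_bounded)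
  then obtain M' where "\<forall>x\<in>p ` cball 0 1. cmod x \<le> M'" unfolding bounded_iff by blast
  then have M': "\<And>z. z \<in> cball 0 1 \<Longrightarrow> cmod (p z) \<le> M'" by blast
  have p_cis: "continuous_on UNIV (\<lambda>t. p (of_real \<rho> * cis t))" if "0 \<le> \<rho>" "\<rho> \<le> 1" for \<rho>
    by (rule continuous_on_compose2[OF p(2)]) (use that in \<open>auto intro!: continuous_intros simp: norm_mult\<close>)
  have "(\<lambda>j. LINT t|?L. (cmod (u (r j * cis t) * p (r j * cis t)))\<^sup>2) \<longlonglongrightarrow> (LINT t|?L. (cmod (p (cis t)))\<^sup>2)"
  proof (rule integral_dominated_convergence)
    show "(\<lambda>t. (cmod (p (cis t)))\<^sup>2) \<in> borel_measurable ?L"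
      using p_cis[of 1]
      by (intro continuous_imp_measurable_on_sets_lebesgue continuous_intros)
        (auto intro: continuous_on_subset)
    show "(\<lambda>t. (cmod (u (r j * cis t) * p (r j * cis t)))\<^sup>2) \<in> borel_measurable ?L" for j
      by (rule continuous_imp_measurable_on_sets_lebesgue[OF continuous_on_power[OF
            continuous_on_norm[OF holomorphic_circle_continuous[OF up r(1) r(2)]]]]) simp
    show "integrable ?L (\<lambda>t. (M * M')\<^sup>2)" by (intro continuous_imp_integrable_real continuous_intros)
    have "cmod (u (r j * cis t) * p (r j * cis t)) \<le> M * M'" for j t
      unfolding norm_mult using M[of "r j * cis t"] M'[of "r j * cis t"] r[of j]
      by (intro mult_mono') (auto simp: norm_mult)
    then show "AE t in ?L. norm ((cmod (u (r j * cis t) * p (r j * cis t)))\<^sup>2) \<le> (M * M')\<^sup>2" for j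
      by (intro AE_I2) (auto intro!: power_mono)
    have "AE t in ?L. \<exists>w. ((\<lambda>r. u (complex_of_real r * cis t)) \<longlongrightarrow> w) (at_left 1) \<and> cmod w = 1"
      using u by (simp add: inner_function_def)
    then show "AE t in ?L. (\<lambda>j. (cmod (u (r j * cis t) * p (r j * cis t)))\<^sup>2) \<longlonglongrightarrow> (cmod (p (cis t)))\<^sup>2"
    proof eventually_elim
      case (elim t)
      then obtain w where w: "((\<lambda>r. u (complex_of_real r * cis t)) \<longlongrightarrow> w) (at_left 1)" "cmod w = 1" by blast
      have "(\<lambda>j. u (r j * cis t)) \<longlonglongrightarrow> w" by (rule filterlim_compose[OF w(1) r_left])
      moreover have "(\<lambda>j. p (r j * cis t)) \<longlonglongrightarrow> p (of_real 1 * cis t)"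
      proof (rule continuous_on_tendsto_compose[OF p(2)])
        show "(\<lambda>j. complex_of_real (r j) * cis t) \<longlonglongrightarrow> of_real 1 * cis t" by (intro tendsto_intros r1)
        show "\<forall>\<^sub>F j in sequentially. complex_of_real (r j) * cis t \<in> cball 0 1"
          using r by (intro always_eventually) (simp add: norm_mult less_imp_le)
      qed (simp add: norm_mult)
      ultimately have "(\<lambda>j. (cmod (u (r j * cis t) * p (r j * cis t)))\<^sup>2) \<longlonglongrightarrow>
          (cmod (w * p (of_real 1 * cis t)))\<^sup>2"
        by (intro tendsto_intros)
      then show ?case by (simp add: norm_mult w)
    qed
  qed
  then have JI: "J \<longlonglongrightarrow> I" unfolding J_def[abs_def] I_def by (intro tendsto_divide tendsto_const) auto
  have part: "(\<Sum>n<N. c n) \<le> I" for N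
  proof (rule LIMSEQ_le)
    have "(\<lambda>j. \<Sum>n<N. c n * (r j ^ n)\<^sup>2) \<longlonglongrightarrow> (\<Sum>n<N. c n * (1 ^ n)\<^sup>2)" by (intro tendsto_intros r1)
    then show "(\<lambda>j. \<Sum>n<N. c n * (r j ^ n)\<^sup>2) \<longlonglongrightarrow> (\<Sum>n<N. c n)" by simp
    show "J \<longlonglongrightarrow> I" by (rule JI)
    show "\<exists>j0. \<forall>j\<ge>j0. (\<Sum>n<N. c n * (r j ^ n)\<^sup>2) \<le> J j"
      using sum_le_suminf[OF sums_summable[OF J], of "{..<N}"] sums_unique[OF J]
      by (simp add: c_def)
  qed
  have sm: "summable c" by (rule summableI_nonneg_bounded[OF _ part]) (simp add: c_def)
  moreover have "suminf c \<le> I" using sm part by (rule suminf_le_const)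
  moreover have "I \<le> suminf c"
  proof (rule LIMSEQ_le_const2[OF JI])
    have "c n * (r j ^ n)\<^sup>2 \<le> c n" for j n
      using r[of j] by (intro mult_left_le) (auto simp: c_def power_le_one)
    then show "\<exists>j0. \<forall>j\<ge>j0. J j \<le> suminf c"
      using suminf_le[OF _ sums_summable[OF J] sm] sums_unique[OF J] by (simp add: c_def)
  qed
  ultimately have "c sums I" by (simp add: sums_iff)
  then show ?thesis by (simp add: c_def[abs_def] I_def)
qed

lemma inner_function_const_1: "inner_function (\<lambda>z. 1)"
  by (auto simp: inner_function_def image_constant_conv intro!: AE_I2 exI[of _ 1])

lemma taylor_coeff_mult:
  assumes "f holomorphic_on ball 0 1" "g holomorphic_on ball 0 1"
  shows "taylor_coeff (\<lambda>z. f z * g z) n = (\<Sum>i=0..n. taylor_coeff f i * taylor_coeff g (n - i))"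
  by (subst taylor_coeff_eqI[OF has_fps_expansion_mult[OF assms[THEN hardy2_set_has_fps]]])
    (simp add: fps_mult_nth taylor_coeff_def)

lemma taylor_coeff_cong:
  assumes "\<And>z. z \<in> ball 0 1 \<Longrightarrow> f z = g z"
  shows "taylor_coeff f n = taylor_coeff g n"
proof -
  have "eventually (\<lambda>z. z \<in> ball 0 1) (nhds (0::complex))" by (intro eventually_nhds_in_open) auto
  then have "eventually (\<lambda>z. f z = g z) (nhds 0)" by eventually_elim (rule assms)
  then show ?thesis by (simp add: taylor_coeff_def fps_expansion_cong)
qed

lemma inner_mult_truncate:
  assumes u: "inner_function u"
  shows "(\<lambda>n. (cmod (taylor_coeff (\<lambda>z. u z * hardy2_fun (truncate N f) z) n))\<^sup>2) sums
    (norm (truncate N f))\<^sup>2"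
proof -
  define p where "p z = (\<Sum>n<N. hcoeff f n * z ^ n)" for z
  have p: "p holomorphic_on ball 0 1" "continuous_on (cball 0 1) p"
    unfolding p_def by (intro holomorphic_intros continuous_intros)+
  have p_eq: "hardy2_fun (truncate N f) z = p z" if "z \<in> ball 0 1" for z
  proof -
    have "hardy2_fun (\<Sum>n\<in>I. hcoeff f n *\<^sub>C hmonom n) z = (\<Sum>n\<in>I. hcoeff f n * z ^ n)" for I
      by (induction I rule: infinite_finite_induct)
        (simp_all add: hardy2_fun_zero hardy2_fun_add hardy2_fun_scaleC hardy2_fun_hmonom[OF that])
    then show ?thesis by (simp add: truncate_def p_def)
  qed
  have tc: "taylor_coeff (\<lambda>z. v z * hardy2_fun (truncate N f) z) n = taylor_coeff (\<lambda>z. v z * p z) n" for v n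
    by (rule taylor_coeff_cong) (simp add: p_eq)
  have "(\<lambda>n. (cmod (taylor_coeff (\<lambda>z. 1 * hardy2_fun (truncate N f) z) n))\<^sup>2) sums (norm (truncate N f))\<^sup>2"
    using norm_hcoeff_sums[of "truncate N f"] by (simp add: hcoeff_def)
  then have "(norm (truncate N f))\<^sup>2 = (LINT t|lebesgue_on {0..2 * pi}. (cmod (p (cis t)))\<^sup>2) / (2 * pi)"
    unfolding tc using inner_mult_mean_square[OF inner_function_const_1 p] by (rule sums_unique2)
  then show ?thesis unfolding tc using inner_mult_mean_square[OF u p] by simp
qed

definition mult_op :: "(complex \<Rightarrow> complex) \<Rightarrow> hardy2 \<Rightarrow> hardy2" where
  "mult_op u f = Abs_hardy2 (\<lambda>z. if z \<in> ball 0 1 then u z * hardy2_fun f z else 0)"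

lemma mult_op_in_hardy2:
  assumes u: "inner_function u"
  shows "(\<lambda>z. if z \<in> ball 0 1 then u z * hardy2_fun f z else 0) \<in> hardy2_set" (is "?F \<in> _")
    and "(\<Sum>n. (cmod (taylor_coeff (\<lambda>z. u z * hardy2_fun f z) n))\<^sup>2) \<le> (norm f)\<^sup>2"
proof -
  have hol: "u holomorphic_on ball 0 1" using u by (simp add: inner_function_def)
  define c where "c n = taylor_coeff (\<lambda>z. u z * hardy2_fun f z) n" for n
  \<comment> \<open>The first \<open>N\<close> coefficients of the product only involve the first \<open>N\<close> coefficients of \<open>f\<close>.\<close>
  have c_trunc: "c n = taylor_coeff (\<lambda>z. u z * hardy2_fun (truncate N f) z) n" if "n < N" for n N
    unfolding c_def taylor_coeff_mult[OF hol hardy2_fun_holomorphic] hcoeff_def[symmetric] hcoeff_truncate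
    using that by (intro sum.cong) auto
  have part: "(\<Sum>n<N. (cmod (c n))\<^sup>2) \<le> (norm f)\<^sup>2" for N
  proof -
    note tr = inner_mult_truncate[OF u, of N f]
    have "(\<Sum>n<N. (cmod (c n))\<^sup>2) =
        (\<Sum>n<N. (cmod (taylor_coeff (\<lambda>z. u z * hardy2_fun (truncate N f) z) n))\<^sup>2)"
      using c_trunc[of _ N] by (intro sum.cong) auto
    also have "\<dots> \<le> (norm (truncate N f))\<^sup>2"
      using sum_le_suminf[OF sums_summable[OF tr], of "{..<N}"] sums_unique[OF tr] by simp
    also have "\<dots> \<le> (norm f)\<^sup>2" by (intro power_mono norm_truncate_le) simp
    finally show ?thesis .
  qed
  have sm: "summable (\<lambda>n. (cmod (c n))\<^sup>2)"
    by (rule summableI_nonneg_bounded[OF _ part]) simp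
  then show "(\<Sum>n. (cmod (taylor_coeff (\<lambda>z. u z * hardy2_fun f z) n))\<^sup>2) \<le> (norm f)\<^sup>2"
    using suminf_le_const[OF sm part] by (simp add: c_def)
  have "?F holomorphic_on ball 0 1 \<longleftrightarrow> (\<lambda>z. u z * hardy2_fun f z) holomorphic_on ball 0 1"
    by (rule holomorphic_cong) simp_all
  moreover have "(\<lambda>z. u z * hardy2_fun f z) holomorphic_on ball 0 1"
    by (intro holomorphic_intros hol hardy2_fun_holomorphic)
  moreover have "taylor_coeff ?F n = c n" for n
    unfolding c_def by (rule taylor_coeff_cong) simp
  ultimately show "?F \<in> hardy2_set" using sm by (simp add: hardy2_set_def)
qed

lemma hardy2_fun_mult_op:
  assumes "inner_function u" "z \<in> ball 0 1"
  shows "hardy2_fun (mult_op u f) z = u z * hardy2_fun f z"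
  unfolding mult_op_def using Abs_hardy2_inverse[OF mult_op_in_hardy2(1)[OF assms(1)]] assms(2) by simp

lemma hcoeff_mult_op:
  assumes "inner_function u"
  shows "hcoeff (mult_op u f) n = taylor_coeff (\<lambda>z. u z * hardy2_fun f z) n"
  unfolding hcoeff_def by (rule taylor_coeff_cong) (simp add: hardy2_fun_mult_op assms)

lemma mult_op_add: "inner_function u \<Longrightarrow> mult_op u (f + g) = mult_op u f + mult_op u g"
  and mult_op_diff: "inner_function u \<Longrightarrow> mult_op u (f - g) = mult_op u f - mult_op u g"
  and mult_op_scaleC: "inner_function u \<Longrightarrow> mult_op u (c *\<^sub>C f) = c *\<^sub>C mult_op u f"
  and mult_op_shift: "inner_function u \<Longrightarrow> mult_op u (hardy2_shift_op f) = hardy2_shift_op (mult_op u f)"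
  by (rule hardy2_eqI; simp add: hardy2_fun_mult_op hardy2_fun_add hardy2_fun_diff
      hardy2_fun_scaleC hardy2_fun_shift algebra_simps)+

lemma norm_mult_op:
  assumes u: "inner_function u" shows "norm (mult_op u f) = norm f"
proof -
  have le: "norm (mult_op u f) \<le> norm f" for f
  proof (rule power2_le_imp_le)
    show "(norm (mult_op u f))\<^sup>2 \<le> (norm f)\<^sup>2"
      using mult_op_in_hardy2(2)[OF u, of f] norm_hcoeff_sums[of "mult_op u f"]
      by (simp add: hcoeff_mult_op[OF u] sums_iff)
  qed simp
  have eq: "norm (mult_op u (truncate N f)) = norm (truncate N f)" for N
  proof -
    have "(norm (mult_op u (truncate N f)))\<^sup>2 = (norm (truncate N f))\<^sup>2"
      using norm_hcoeff_sums[of "mult_op u (truncate N f)"] inner_mult_truncate[OF u, of N f]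
      by (simp add: hcoeff_mult_op[OF u] sums_iff)
    then show ?thesis by (simp add: power2_eq_iff_nonneg)
  qed
  have "bounded_linear (mult_op u)"
  proof (rule bounded_linear_intro[where K = 1])
    show "mult_op u (r *\<^sub>R x) = r *\<^sub>R mult_op u x" for r x
      by (simp add: mult_op_scaleC[OF u] flip: scaleC_of_real)
  qed (simp_all add: mult_op_add[OF u] le)
  then have "(\<lambda>N. mult_op u (truncate N f)) \<longlonglongrightarrow> mult_op u f"
    by (rule bounded_linear.tendsto) (rule truncate_tendsto)
  then have "(\<lambda>N. norm (truncate N f)) \<longlonglongrightarrow> norm (mult_op u f)"
    using tendsto_norm by (fastforce simp: eq)
  then show ?thesis using tendsto_norm[OF truncate_tendsto[of f]] LIMSEQ_unique by blast
qed

lemma cinner_mult_op: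
  assumes u: "inner_function u" shows "cinner (mult_op u f) (mult_op u g) = cinner f g"
  by (rule cinner_eq_if_norm_eq) (simp add: norm_mult_op[OF u] flip: mult_op_scaleC[OF u] mult_op_diff[OF u])

lemma inner_function_mult:
  assumes u: "inner_function u" and v: "inner_function v"
  shows "inner_function (\<lambda>z. u z * v z)"
  unfolding inner_function_def
proof (intro conjI)
  show "(\<lambda>z. u z * v z) holomorphic_on ball 0 1"
    using u v by (auto simp: inner_function_def intro!: holomorphic_intros)
  obtain M where M: "\<And>z. z \<in> ball 0 1 \<Longrightarrow> cmod (u z) \<le> M" using inner_function_bounded[OF u] by blast
  obtain M' where M': "\<And>z. z \<in> ball 0 1 \<Longrightarrow> cmod (v z) \<le> M'" using inner_function_bounded[OF v] by blast
  have "\<forall>z\<in>ball 0 1. cmod (u z * v z) \<le> M * M'"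
    using M M' by (simp add: norm_mult mult_mono')
  then show "bounded ((\<lambda>z. u z * v z) ` ball 0 1)" by (auto simp: bounded_iff)
  have "AE t in lebesgue_on {0..2 * pi}.
      \<exists>w. ((\<lambda>r. u (complex_of_real r * cis t)) \<longlongrightarrow> w) (at_left 1) \<and> cmod w = 1"
    "AE t in lebesgue_on {0..2 * pi}.
      \<exists>w. ((\<lambda>r. v (complex_of_real r * cis t)) \<longlongrightarrow> w) (at_left 1) \<and> cmod w = 1"
    using u v by (simp_all add: inner_function_def)
  then show "AE t in lebesgue_on {0..2 * pi}.
      \<exists>w. ((\<lambda>r. u (complex_of_real r * cis t) * v (complex_of_real r * cis t)) \<longlongrightarrow> w) (at_left 1) \<and> cmod w = 1"
  proof eventually_elim
    case (elim t)
    then obtain w w' where "((\<lambda>r. u (complex_of_real r * cis t)) \<longlongrightarrow> w) (at_left 1)" "cmod w = 1"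
      "((\<lambda>r. v (complex_of_real r * cis t)) \<longlongrightarrow> w') (at_left 1)" "cmod w' = 1" by blast
    then show ?case by (intro exI[of _ "w * w'"]) (simp add: norm_mult tendsto_mult)
  qed
qed

text \<open>
  Evaluating the powers of \<open>u\<close>, all of norm 1, at a point of the disc gives the maximum principle.
\<close>

lemma inner_function_le_1:
  assumes u: "inner_function u" and z: "z \<in> ball 0 1"
  shows "cmod (u z) \<le> 1"
proof (rule ccontr)
  assume "\<not> cmod (u z) \<le> 1"
  then have gt: "cmod (u z) > 1" by simp
  define h where "h n = (mult_op u ^^ n) (hmonom 0)" for n
  have val: "hardy2_fun (h n) z = u z ^ n" for n
    by (induction n) (simp_all add: h_def hardy2_fun_hmonom hardy2_fun_mult_op u z[simplified])
  have nh: "norm (h n) = norm (hmonom 0)" for n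
    by (induction n) (simp_all add: h_def norm_mult_op u)
  have "cmod (u z) ^ n \<le> norm (hmonom 0) * norm (szego z)" for n
    using cmod_cinner_le[of "h n" "szego z"] by (simp add: cinner_szego z[simplified] val nh norm_power)
  moreover obtain n where "norm (hmonom 0) * norm (szego z) < cmod (u z) ^ n"
    using real_arch_pow[OF gt] by blast
  ultimately show False by (metis not_less)
qed

lemma norm_hmonom_0: "norm (hmonom 0) = 1"
proof -
  have "complex_of_real ((norm (hmonom 0))\<^sup>2) = of_real 1"
    unfolding cinner_self[symmetric] by (simp add: cinner_hmonom hcoeff_hmonom)
  then have "(norm (hmonom 0))\<^sup>2 = 1" by (simp only: of_real_eq_iff)
  then show ?thesis by (simp add: power2_eq_1_iff) (metis norm_ge_zero not_one_le_zero neg_0_le_iff_le)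
qed

text \<open>
  The squares of the Taylor coefficients of an inner function sum to 1; if the constant term had
  modulus 1, it would be the only term.
\<close>

lemma inner_function_0_less_1:
  assumes u: "inner_function u" "\<not> u constant_on ball 0 1"
  shows "cmod (u 0) < 1"
proof (rule ccontr)
  assume "\<not> cmod (u 0) < 1"
  with inner_function_le_1[OF u(1), of 0] have 1: "cmod (u 0) = 1" by simp
  define f where "f = mult_op u (hmonom 0)"
  have val: "hardy2_fun f z = u z" if "z \<in> ball 0 1" for z
    using that by (simp add: f_def hardy2_fun_mult_op u hardy2_fun_hmonom)
  have f0: "cinner f (hmonom 0) = u 0" using val[of 0] by (simp add: cinner_hmonom hcoeff_0)
  have "(norm (f - u 0 *\<^sub>C hmonom 0))\<^sup>2 = 1 + 1 - 2 * Re (cnj (u 0) * u 0)"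
    unfolding norm_diff_scaleC_sq f0 by (simp add: 1 f_def norm_mult_op u norm_hmonom_0)
  also have "cnj (u 0) * u 0 = 1" using 1 by (metis complex_norm_square mult.commute of_real_1 power_one)
  finally have "f = u 0 *\<^sub>C hmonom 0" by simp
  then have "u z = u 0" if "z \<in> ball 0 1" for z
    using val[OF that] that by (simp add: hardy2_fun_scaleC hardy2_fun_hmonom)
  then have "u constant_on ball 0 1" unfolding constant_on_def by blast
  with u show False by simp
qed

section \<open>Bessel's inequality\<close>

text \<open>
  The bound on combinations of the \<open>x n\<close> is dual to the bound on coefficients: the sum of squares
  is itself the inner product of \<open>f\<close> with the combination whose coefficients are \<open>\<langle>f, x n\<rangle>\<close>.
\<close>

lemma bessel_hardy2:
  fixes x :: "nat \<Rightarrow> hardy2"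
  assumes "\<And>a N. (norm (\<Sum>n<N. a n *\<^sub>C x n))\<^sup>2 \<le> (\<Sum>n<N. (cmod (a n))\<^sup>2)"
  shows "(\<Sum>n<N. (cmod (cinner f (x n)))\<^sup>2) \<le> (norm f)\<^sup>2"
proof -
  define s where "s = (\<Sum>n<N. (cmod (cinner f (x n)))\<^sup>2)"
  define y where "y = (\<Sum>n<N. cinner f (x n) *\<^sub>C x n)"
  have s0: "s \<ge> 0" by (simp add: s_def sum_nonneg)
  have "complex_of_real s = cinner f y"
    unfolding y_def s_def cinner_sum_right
    by (simp add: cinner_scaleC_right complex_norm_square mult.commute del: of_real_power)
  then have "s = cmod (cinner f y)" using s0 by (metis abs_of_nonneg norm_of_real)
  also have "\<dots> \<le> norm f * norm y" by (rule cmod_cinner_le)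
  finally have "s\<^sup>2 \<le> (norm f * norm y)\<^sup>2" using s0 by (rule power_mono)
  also have "\<dots> = (norm f)\<^sup>2 * (norm y)\<^sup>2" by (rule power_mult_distrib)
  also have "\<dots> \<le> (norm f)\<^sup>2 * s"
    using assms[of "\<lambda>n. cinner f (x n)" N] by (intro mult_left_mono) (simp_all add: y_def s_def)
  finally have "s * s \<le> (norm f)\<^sup>2 * s" by (simp add: power2_eq_square)
  then show ?thesis
    unfolding s_def[symmetric] using s0 by (cases "s = 0") simp_all
qed

lemma cinner_eq_by_truncation:
  assumes "\<And>N. cinner (h N) x = cinner y (truncate N g)" "h \<longlonglongrightarrow> h'"
  shows "cinner h' x = cinner y g"
proof (rule LIMSEQ_unique)
  show "(\<lambda>N. cinner (h N) x) \<longlonglongrightarrow> cinner h' x"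
    by (rule bounded_linear.tendsto[OF bounded_linear_cinner_left assms(2)])
  have "(\<lambda>N. cnj (cinner (truncate N g) y)) \<longlonglongrightarrow> cnj (cinner g y)"
    by (intro tendsto_cnj bounded_linear.tendsto[OF bounded_linear_cinner_left truncate_tendsto])
  then show "(\<lambda>N. cinner (h N) x) \<longlonglongrightarrow> cinner y g"
    unfolding assms(1) cinner_commute[of y] .
qed

section \<open>Model spaces\<close>

lemma szego_0: "szego 0 = hmonom 0"
  by (rule hardy2_eqI_hcoeff) (simp add: hcoeff_szego hcoeff_hmonom)

lemma cinner_backshift_backshift:
  "cinner (backshift f) (backshift g) = cinner f g - hardy2_fun f 0 * cnj (hardy2_fun g 0)"
  unfolding cinner_shift_left[symmetric] shift_backshift
  by (simp add: cinner_simps cinner_hmonom_left hcoeff_0)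

definition inner_elem :: "(complex \<Rightarrow> complex) \<Rightarrow> hardy2" where
  "inner_elem u = mult_op u (hmonom 0)"

text \<open>The reproducing kernel of the model space at \<open>w\<close>.\<close>

definition model_kernel :: "(complex \<Rightarrow> complex) \<Rightarrow> complex \<Rightarrow> hardy2" where
  "model_kernel u w = szego w - cnj (u w) *\<^sub>C mult_op u (szego w)"

text \<open>The difference quotient \<open>z \<mapsto> (u z - u 0) / z\<close>; it is the conjugate of the kernel at 0.\<close>

definition model_cokernel :: "(complex \<Rightarrow> complex) \<Rightarrow> hardy2" where
  "model_cokernel u = backshift (inner_elem u)"

locale inner_fn =
  fixes u :: "complex \<Rightarrow> complex"
  assumes inner: "inner_function u"
begin

abbreviation "K \<equiv> model_space u"
abbreviation "M \<equiv> mult_op u"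
abbreviation "T \<equiv> model_op u"
abbreviation "ue \<equiv> inner_elem u"
abbreviation "k \<equiv> model_kernel u"
abbreviation "kt \<equiv> model_cokernel u"

lemmas M_simps = mult_op_add[OF inner] mult_op_diff[OF inner] mult_op_scaleC[OF inner]
  mult_op_shift[OF inner]

lemma fun_M: "z \<in> ball 0 1 \<Longrightarrow> hardy2_fun (M f) z = u z * hardy2_fun f z"
  by (rule hardy2_fun_mult_op[OF inner])

lemma fun_ue: "z \<in> ball 0 1 \<Longrightarrow> hardy2_fun ue z = u z"
  by (simp add: inner_elem_def fun_M hardy2_fun_hmonom)

lemma cinner_M: "cinner (M f) (M g) = cinner f g"
  by (rule cinner_mult_op[OF inner])

lemma cinner_ue_M: "cinner ue (M g) = cnj (hardy2_fun g 0)"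
  by (simp add: inner_elem_def cinner_M cinner_hmonom_left hcoeff_0)

lemma cinner_ue_ue: "cinner ue ue = 1"
  by (simp add: inner_elem_def cinner_M cinner_hmonom hcoeff_hmonom)

lemma denominator_nonzero:
  assumes "cmod a < 1" "z \<in> ball 0 1" shows "1 - cnj a * u z \<noteq> 0"
proof -
  have "cmod a * cmod (u z) \<le> cmod a * 1"
    using inner_function_le_1[OF inner assms(2)] by (intro mult_left_mono) simp_all
  then have "cmod (cnj a * u z) < 1" using assms(1) by (simp add: norm_mult)
  then show ?thesis by (metis norm_one order_less_irrefl right_minus_eq)
qed

lemma mult_range_eq: "mult_range u = range M"
proof (intro set_eqI iffI)
  fix f assume "f \<in> mult_range u"
  then obtain g where "\<forall>z\<in>ball 0 1. hardy2_fun f z = u z * hardy2_fun g z"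
    by (auto simp: mult_range_def)
  then have "f = M g" by (intro hardy2_eqI) (simp add: fun_M)
  then show "f \<in> range M" by blast
qed (auto simp: mult_range_def fun_M)

lemma K_iff: "f \<in> K \<longleftrightarrow> (\<forall>h. cinner f (M h) = 0)"
  by (auto simp: model_space_def mult_range_eq)

lemma csubspace_K: "csubspace K"
  by (simp add: csubspace_def K_iff cinner_simps)

lemmas K_intros [intro] = csubspace_intros[OF csubspace_K]

lemma cinner_K_M: "f \<in> K \<Longrightarrow> cinner f (M h) = 0"
  by (simp add: K_iff)

lemma cinner_M_K: "f \<in> K \<Longrightarrow> cinner (M h) f = 0"
  using cinner_K_M[of f h] cinner_commute[of "M h" f] by simp

lemma cinner_K_ue: "f \<in> K \<Longrightarrow> cinner f ue = 0" "f \<in> K \<Longrightarrow> cinner ue f = 0"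
  by (simp_all add: inner_elem_def cinner_K_M cinner_M_K)

lemma backshift_K [intro]: "f \<in> K \<Longrightarrow> backshift f \<in> K"
  by (auto simp: K_iff cinner_shift_right[symmetric] M_simps[symmetric])

lemma kt_K [intro, simp]: "kt \<in> K"
  unfolding K_iff model_cokernel_def
  by (simp add: cinner_shift_right[symmetric] M_simps(4)[symmetric] cinner_ue_M hardy2_fun_shift)

lemma k_K [intro, simp]: "w \<in> ball 0 1 \<Longrightarrow> k w \<in> K"
  unfolding K_iff
proof
  fix h assume w: "w \<in> ball 0 1"
  have *: "cinner (szego w) f = cnj (hardy2_fun f w)" for f
    using cinner_szego[OF w, of f] cinner_commute[of "szego w" f] by simp
  show "cinner (k w) (M h) = 0"
    by (simp add: model_kernel_def cinner_simps cinner_M * fun_M[OF w])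
qed

lemma cinner_k: "w \<in> ball 0 1 \<Longrightarrow> f \<in> K \<Longrightarrow> cinner f (k w) = hardy2_fun f w"
  by (simp only: model_kernel_def cinner_diff_right cinner_scaleC_right cinner_szego cinner_K_M) simp

lemma k0_eq: "k 0 = hmonom 0 - cnj (u 0) *\<^sub>C ue"
  by (simp add: model_kernel_def szego_0 inner_elem_def)

lemma fun_k0: "w \<in> ball 0 1 \<Longrightarrow> hardy2_fun (k 0) w = 1 - cnj (u 0) * u w"
  by (simp only: k0_eq hardy2_fun_diff hardy2_fun_scaleC hardy2_fun_hmonom fun_ue) simp

lemma fun_kt: "w \<in> ball 0 1 \<Longrightarrow> w * hardy2_fun kt w = u w - u 0"
  by (simp add: model_cokernel_def hardy2_fun_backshift fun_ue)

lemma cinner_kt_kt: "cinner kt kt = 1 - u 0 * cnj (u 0)"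
  by (simp add: model_cokernel_def cinner_backshift_backshift cinner_ue_ue fun_ue)

lemma cinner_k0_k0: "cinner (k 0) (k 0) = 1 - u 0 * cnj (u 0)"
  by (simp add: cinner_k fun_k0 mult.commute)

text \<open>
  For \<open>f\<close> in the model space, \<open>z f\<close> is orthogonal to \<open>z u H\<^sup>2\<close>; so its projection only subtracts
  a multiple of \<open>u\<close>.
\<close>

lemma cinner_shift_K_M:
  assumes f: "f \<in> K"
  shows "cinner (hardy2_shift_op f) (M h) = cnj (hardy2_fun h 0) * cinner f kt"
proof -
  have h: "h = hardy2_fun h 0 *\<^sub>C hmonom 0 + hardy2_shift_op (backshift h)"
    by (simp add: shift_backshift)
  show ?thesis
    by (subst h) (simp add: M_simps cinner_simps cinner_shift_shift cinner_K_M[OF f]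
        cinner_shift_left model_cokernel_def inner_elem_def)
qed

lemma shift_diff_K:
  assumes f: "f \<in> K" shows "hardy2_shift_op f - cinner f kt *\<^sub>C ue \<in> K"
  by (simp add: K_iff cinner_simps cinner_shift_K_M[OF f] cinner_ue_M)

lemma T_eq: assumes f: "f \<in> K" shows "T f = hardy2_shift_op f - cinner f kt *\<^sub>C ue"
  unfolding model_op_def
proof (rule orth_proj_eqI[OF csubspace_K shift_diff_K[OF f]])
  show "cinner (hardy2_shift_op f - (hardy2_shift_op f - cinner f kt *\<^sub>C ue)) z = 0" if "z \<in> K" for z
    using that by (simp add: cinner_simps cinner_K_ue)
qed

lemma T_K [intro]: "f \<in> K \<Longrightarrow> T f \<in> K"
  by (simp add: T_eq shift_diff_K)

lemma T_add: "f \<in> K \<Longrightarrow> g \<in> K \<Longrightarrow> T (f + g) = T f + T g"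
  by (simp add: T_eq K_intros shift_add cinner_simps scaleC_simps)

lemma T_diff: "f \<in> K \<Longrightarrow> g \<in> K \<Longrightarrow> T (f - g) = T f - T g"
  by (simp add: T_eq K_intros shift_diff cinner_simps scaleC_simps)

lemma T_scaleC: "f \<in> K \<Longrightarrow> T (c *\<^sub>C f) = c *\<^sub>C T f"
  by (simp add: T_eq K_intros shift_scaleC cinner_simps scaleC_simps)

lemma cinner_T: "f \<in> K \<Longrightarrow> g \<in> K \<Longrightarrow> cinner (T f) g = cinner f (backshift g)"
  by (simp add: T_eq cinner_simps cinner_shift_left cinner_K_ue)

text \<open>
  With the backward shift \<open>S\<^sup>*\<close> as adjoint, the defects \<open>I - T\<^sup>* T\<close> and \<open>I - T T\<^sup>*\<close> come only from the
  term in \<open>u\<close> of \<open>T f\<close> and from \<open>z S\<^sup>* f = f - f(0)\<close>, and so have rank one.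
\<close>

lemma adj_T: "f \<in> K \<Longrightarrow> adj_on K T f = backshift f"
  by (rule adj_on_eqI[OF csubspace_K]) (auto simp: cinner_T)

lemma backshift_T: "f \<in> K \<Longrightarrow> backshift (T f) = f - cinner f kt *\<^sub>C kt"
  by (simp add: T_eq backshift_diff backshift_scaleC flip: model_cokernel_def)

lemma T_backshift:
  assumes f: "f \<in> K" shows "T (backshift f) = f - hardy2_fun f 0 *\<^sub>C k 0"
proof -
  have "cinner (backshift f) kt = - (hardy2_fun f 0 * cnj (u 0))"
    by (simp add: model_cokernel_def cinner_backshift_backshift fun_ue cinner_K_ue f)
  then show ?thesis
    by (simp add: T_eq[OF backshift_K[OF f]] shift_backshift k0_eq scaleC_simps)
qed

lemma T_kt: "T kt = - (u 0 *\<^sub>C k 0)"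
  by (simp add: T_eq cinner_kt_kt k0_eq scaleC_simps)
    (simp add: model_cokernel_def shift_backshift fun_ue)

lemma backshift_k0: "backshift (k 0) = - (cnj (u 0) *\<^sub>C kt)"
  by (simp add: k0_eq backshift_diff backshift_scaleC model_cokernel_def)

lemma cinner_k_kt:
  assumes w: "w \<in> ball 0 1" shows "cnj w * cinner (k w) kt = cnj (u w - u 0)"
proof -
  have "cinner (k w) kt = cnj (hardy2_fun kt w)"
    using cinner_k[OF w kt_K] cinner_commute[of "k w" kt] by simp
  then show ?thesis using fun_kt[OF w] by (metis complex_cnj_mult)
qed

text \<open>
  The resolvent of the model operator, applied to the vectors that span its two defect spaces,
  stays explicit.
\<close>

lemma resolvent_k0:
  assumes w: "w \<in> ball 0 1" shows "k w - cnj w *\<^sub>C T (k w) = k 0"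
proof -
  have *: "cnj w *\<^sub>C hardy2_shift_op (szego w) = szego w - hmonom 0"
    using szego_eq[OF w] by (metis add_diff_cancel_left')
  have "cnj w *\<^sub>C hardy2_shift_op (k w) = k w - hmonom 0 + cnj (u w) *\<^sub>C ue"
  proof -
    have "cnj w *\<^sub>C hardy2_shift_op (k w) =
        cnj w *\<^sub>C hardy2_shift_op (szego w) - cnj (u w) *\<^sub>C M (cnj w *\<^sub>C hardy2_shift_op (szego w))"
      by (simp add: model_kernel_def shift_diff shift_scaleC M_simps scaleC_simps mult.commute)
    then show ?thesis
      unfolding * by (simp add: model_kernel_def M_simps scaleC_simps inner_elem_def)
  qed
  then show ?thesis
    by (simp add: T_eq[OF k_K[OF w]] scaleC_diff_right scaleC_scaleC cinner_k_kt[OF w] k0_eq)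
      (simp add: scaleC_simps)
qed

lemma resolvent_kt:
  assumes w: "w \<in> ball 0 1"
  shows "(kt - (cnj w * u 0) *\<^sub>C k w) - cnj w *\<^sub>C T (kt - (cnj w * u 0) *\<^sub>C k w) = kt"
proof -
  have "T (kt - (cnj w * u 0) *\<^sub>C k w) = - (u 0 *\<^sub>C k 0) - (cnj w * u 0) *\<^sub>C T (k w)"
    using w by (simp add: T_diff T_scaleC T_kt K_intros)
  also have "\<dots> = - (u 0 *\<^sub>C (k w - cnj w *\<^sub>C T (k w))) - (cnj w * u 0) *\<^sub>C T (k w)"
    by (simp only: resolvent_k0[OF w])
  finally show ?thesis by (simp add: scaleC_simps mult.commute)
qed

section \<open>The conjugation of a model space\<close>

lemma norm_M: "norm (M f) = norm f"
  by (rule norm_mult_op[OF inner])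

abbreviation "bs n \<equiv> (backshift ^^ n) ue"

lemma hcoeff_bs: "hcoeff (bs n) j = hcoeff ue (n + j)"
  by (induction n arbitrary: j) (simp_all add: hcoeff_backshift)

lemma backshift_pow_M_hmonom: "(backshift ^^ (m + n)) (M (hmonom m)) = bs n"
proof (induction m)
  case (Suc m)
  then show ?case
    by (simp add: hmonom_Suc M_simps funpow_Suc_right del: funpow.simps)
qed (simp add: inner_elem_def)

lemma norm_backshift_pow_le: "norm ((backshift ^^ n) f) \<le> norm f"
  by (induction n) (auto intro: order_trans[OF norm_backshift_le])

lemma backshift_pow_sum:
  "(backshift ^^ n) (\<Sum>i\<in>I. c i *\<^sub>C f i) = (\<Sum>i\<in>I. c i *\<^sub>C (backshift ^^ n) (f i))"
proof -
  have add: "(backshift ^^ n) (f + g) = (backshift ^^ n) f + (backshift ^^ n) g" for f g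
    by (induction n) (simp_all add: backshift_add)
  have sc: "(backshift ^^ n) (c *\<^sub>C f) = c *\<^sub>C (backshift ^^ n) f" for c f
    by (induction n) (simp_all add: backshift_scaleC)
  have "(backshift ^^ n) 0 = 0" using sc[of 0 0] by simp
  then show ?thesis
    by (induction I rule: infinite_finite_induct) (simp_all add: add sc)
qed

lemma M_sum: "M (\<Sum>i\<in>I. c i *\<^sub>C f i) = (\<Sum>i\<in>I. c i *\<^sub>C M (f i))"
proof -
  have "M 0 = 0" using M_simps(3)[of 0 0] by simp
  then show ?thesis by (induction I rule: infinite_finite_induct) (simp_all add: M_simps)
qed

lemma norm_sum_hmonom_sq:
  fixes p :: "nat \<Rightarrow> nat"
  assumes "inj_on p {..<N}"
  shows "(norm (\<Sum>j<N. a j *\<^sub>C hmonom (p j)))\<^sup>2 = (\<Sum>j<N. (cmod (a j))\<^sup>2)"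
proof -
  let ?P = "\<Sum>j<N. a j *\<^sub>C hmonom (p j)"
  have coeff: "hcoeff ?P (p j) = a j" if "j < N" for j
  proof -
    have "hcoeff ?P (p j) = (\<Sum>i<N. if i = j then a i else 0)"
      unfolding hcoeff_sum using assms that
      by (intro sum.cong) (auto simp: hcoeff_scaleC hcoeff_hmonom inj_on_def)
    also have "\<dots> = a j" using that by (subst sum.delta) simp_all
    finally show ?thesis .
  qed
  have "cinner ?P ?P = (\<Sum>j<N. a j * cnj (hcoeff ?P (p j)))"
    by (subst cinner_sum_left) (simp add: cinner_scaleC_left cinner_hmonom_left)
  also have "\<dots> = complex_of_real (\<Sum>j<N. (cmod (a j))\<^sup>2)"
    by (simp add: coeff complex_norm_square del: of_real_power)
  finally show ?thesis unfolding cinner_self by (simp only: of_real_eq_iff)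
qed

text \<open>
  Since \<open>S\<^sup>*\<^sup>j\<^sup>+\<^sup>1 u = S\<^sup>*\<^sup>N (z\<^sup>N\<^sup>-\<^sup>1\<^sup>-\<^sup>j u)\<close> for the backward shift \<open>S\<^sup>*\<close>, a combination of these vectors is
  the image under a contraction of a combination of orthonormal ones.
\<close>

lemma norm_sum_bs_sq: "(norm (\<Sum>j<N. a j *\<^sub>C bs (Suc j)))\<^sup>2 \<le> (\<Sum>j<N. (cmod (a j))\<^sup>2)"
proof -
  let ?p = "\<Sum>j<N. a j *\<^sub>C hmonom (N - Suc j)"
  have "(\<Sum>j<N. a j *\<^sub>C bs (Suc j)) = (\<Sum>j<N. a j *\<^sub>C (backshift ^^ N) (M (hmonom (N - Suc j))))"
  proof (intro sum.cong refl)
    fix j assume "j \<in> {..<N}"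
    then have "N = (N - Suc j) + Suc j" by simp
    then show "a j *\<^sub>C bs (Suc j) = a j *\<^sub>C (backshift ^^ N) (M (hmonom (N - Suc j)))"
      by (metis backshift_pow_M_hmonom)
  qed
  also have "\<dots> = (backshift ^^ N) (M ?p)" by (simp add: backshift_pow_sum M_sum)
  finally have "norm (\<Sum>j<N. a j *\<^sub>C bs (Suc j)) \<le> norm ?p"
    using norm_backshift_pow_le[of N "M ?p"] by (simp add: norm_M)
  then have "(norm (\<Sum>j<N. a j *\<^sub>C bs (Suc j)))\<^sup>2 \<le> (norm ?p)\<^sup>2" by (simp add: power_mono)
  also have "\<dots> = (\<Sum>j<N. (cmod (a j))\<^sup>2)" by (rule norm_sum_hmonom_sq) (auto simp: inj_on_def)
  finally show ?thesis .
qed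

text \<open>
  On the unit circle this is \<open>f \<mapsto> u \<cdot> \<zeta>\<^sup>* \<cdot> f\<^sup>*\<close> (followed by the projection onto \<open>H\<^sup>2\<close>), whose
  \<open>n\<close>-th coefficient is \<open>\<langle>u, z\<^sup>n\<^sup>+\<^sup>1 f\<rangle>\<close>.
\<close>

definition J :: "hardy2 \<Rightarrow> hardy2" where
  "J f = hardy2_of (\<lambda>n. cinner (bs (Suc n)) f)"

lemma J_bound: "(\<Sum>n<N. (cmod (cinner (bs (Suc n)) f))\<^sup>2) \<le> (norm f)\<^sup>2"
  using bessel_hardy2[OF norm_sum_bs_sq, of f N] by (subst cinner_commute) simp

lemma hcoeff_J: "hcoeff (J f) n = cinner (bs (Suc n)) f"
  unfolding J_def by (rule hardy2_of_bounded(1)[OF J_bound norm_ge_zero])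

lemma norm_J_le: "norm (J f) \<le> norm f"
  unfolding J_def by (rule hardy2_of_bounded(2)[OF J_bound norm_ge_zero])

lemma J_add: "J (f + g) = J f + J g"
  and J_diff: "J (f - g) = J f - J g"
  and J_scaleC: "J (c *\<^sub>C f) = cnj c *\<^sub>C J f"
  by (rule hardy2_eqI_hcoeff; simp add: hcoeff_J hcoeff_add hcoeff_diff hcoeff_scaleC cinner_simps)+

lemma J_hmonom: "J (hmonom n) = bs (Suc n)"
  by (rule hardy2_eqI_hcoeff)
    (simp add: hcoeff_J cinner_hmonom hcoeff_bs add.commute del: funpow.simps)

text \<open>
  In the monomials, \<open>J\<close> is a Hankel matrix: the entry at \<open>(m, n)\<close> is the coefficient of \<open>u\<close> at
  \<open>m + n + 1\<close>. The bilinear form \<open>\<langle>J f, g\<rangle>\<^sup>*\<close> is therefore symmetric.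
\<close>

lemma J_swap: "cinner (J f) g = cinner (J g) f"
proof -
  have sum: "J (\<Sum>n\<in>I. c n *\<^sub>C hmonom n) = (\<Sum>n\<in>I. cnj (c n) *\<^sub>C bs (Suc n))" for c and I :: "nat set"
  proof -
    have "J 0 = 0" using J_scaleC[of 0 0] by simp
    then show ?thesis
      by (induction I rule: infinite_finite_induct) (simp_all add: J_add J_scaleC J_hmonom del: funpow.simps)
  qed
  have "cinner (J (truncate N g)) f = cinner (J f) (truncate N g)" for N
    unfolding truncate_def sum
    by (simp add: cinner_sum_left cinner_sum_right cinner_simps cinner_hmonom hcoeff_J del: funpow.simps)
  moreover have "(\<lambda>N. J (truncate N g)) \<longlonglongrightarrow> J g"
  proof (rule LIM_zero_cancel, rule Lim_null_comparison)
    show "\<forall>\<^sub>F N in sequentially. norm (J (truncate N g) - J g) \<le> norm (truncate N g - g)"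
      by (intro always_eventually) (simp add: norm_J_le flip: J_diff)
    show "(\<lambda>N. norm (truncate N g - g)) \<longlonglongrightarrow> 0"
      using LIM_zero[OF truncate_tendsto[of g]] by (rule tendsto_norm_zero)
  qed
  ultimately have "cinner (J g) f = cinner (J f) g" by (rule cinner_eq_by_truncation)
  then show ?thesis by simp
qed

lemma cinner_bs_M: "cinner (bs (Suc n)) (M h) = 0"
proof (induction n arbitrary: h)
  case 0
  have "cinner (bs (Suc 0)) (M h) = cinner ue (M (hardy2_shift_op h))"
    by (simp add: M_simps cinner_shift_right)
  then show ?case by (simp add: cinner_ue_M hardy2_fun_shift)
next
  case (Suc n)
  have "cinner (bs (Suc (Suc n))) (M h) = cinner (bs (Suc n)) (M (hardy2_shift_op h))"
    by (simp add: M_simps cinner_shift_right)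
  then show ?case by (simp only: Suc)
qed

lemma J_M: "J (M h) = 0"
  by (rule hardy2_eqI_hcoeff) (simp add: hcoeff_J cinner_bs_M hcoeff_zero del: funpow.simps)

lemma J_ue: "J ue = 0"
  unfolding inner_elem_def by (rule J_M)

lemma J_K [intro]: "J f \<in> K"
  by (simp add: K_iff J_swap[of f] J_M)

lemma cinner_ue_bs: "cinner ue (bs n) = (if n = 0 then 1 else 0)"
proof (cases n)
  case (Suc m)
  then show ?thesis
    using cinner_bs_M[of m "hmonom 0"] cinner_commute[of ue "bs n"] by (simp add: inner_elem_def)
qed (simp add: cinner_ue_ue)

text \<open>
  As \<open>S\<^sup>* h = \<zeta>\<^sup>* (h - h(0))\<close> on the circle, \<open>J (S\<^sup>* h)\<close> is the projection of
  \<open>\<zeta> (u \<zeta>\<^sup>* h\<^sup>*) - h(0)\<^sup>* u\<close> onto \<open>H\<^sup>2\<close>. The constant term is the coefficient of \<open>u \<zeta>\<^sup>* h\<^sup>*\<close> at \<open>\<zeta>\<^sup>-\<^sup>1\<close>,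
  that is \<open>\<langle>u, h\<rangle>\<close>, which vanishes for \<open>h = S\<^sup>*\<^sup>n u\<close> unless \<open>n = 0\<close>.
\<close>

lemma J_bs_Suc:
  "J (bs (Suc n)) = (if n = 0 then hmonom 0 else 0) + hardy2_shift_op (J (bs n)) - cnj (hcoeff ue n) *\<^sub>C ue"
proof (rule hardy2_eqI_hcoeff)
  have *: "cinner (bs (Suc m)) (bs (Suc n)) = cinner (bs m) (bs n) - hcoeff ue m * cnj (hcoeff ue n)" for m
    by (simp add: cinner_backshift_backshift hcoeff_bs flip: hcoeff_0)
  fix m
  show "hcoeff (J (bs (Suc n))) m = hcoeff ((if n = 0 then hmonom 0 else 0) +
      hardy2_shift_op (J (bs n)) - cnj (hcoeff ue n) *\<^sub>C ue) m"
    unfolding hcoeff_J * hcoeff_diff hcoeff_add hcoeff_scaleC hcoeff_shift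
    by (cases m) (auto simp: cinner_ue_bs hcoeff_hmonom hcoeff_zero mult.commute)
qed

lemma J_kt: "J kt = k 0"
  using J_bs_Suc[of 0]
  by (simp add: J_ue k0_eq model_cokernel_def hcoeff_0 fun_ue)
    (metis add.right_neutral cancel_comm_monoid_add_class.diff_cancel shift_diff)

text \<open>This says that \<open>J (J e\<^sub>n)\<close> is the projection of \<open>e\<^sub>n = z\<^sup>n\<close> onto the model space.\<close>

lemma cinner_K_J_bs: "f \<in> K \<Longrightarrow> cinner f (J (bs (Suc n))) = hcoeff f n"
proof (induction n arbitrary: f)
  case 0
  then show ?case using J_kt by (simp add: model_cokernel_def cinner_k hcoeff_0)
next
  case (Suc n)
  have "cinner f (J (bs (Suc (Suc n)))) = cinner (backshift f) (J (bs (Suc n)))"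
    by (subst J_bs_Suc) (simp add: cinner_simps cinner_shift_right cinner_K_ue Suc del: funpow.simps)
  then show ?case using Suc by (simp add: backshift_K hcoeff_backshift del: funpow.simps)
qed

lemma J_J: assumes f: "f \<in> K" shows "J (J f) = f"
proof (rule hardy2_eqI_hcoeff)
  fix n
  have "cinner (bs (Suc n)) (J f) = cnj (cinner (J f) (bs (Suc n)))" by (rule cinner_commute)
  also have "\<dots> = cnj (cinner (J (bs (Suc n))) f)" by (simp only: J_swap[of f])
  also have "\<dots> = cinner f (J (bs (Suc n)))" by (rule cinner_commute[symmetric])
  finally show "hcoeff (J (J f)) n = hcoeff f n"
    unfolding hcoeff_J cinner_K_J_bs[OF f] .
qed

lemma conjugation_J: "conjugation_on K J"
  unfolding conjugation_on_def
proof (intro conjI ballI allI)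
  show "norm (J f) = norm f" if "f \<in> K" for f
    using norm_J_le[of f] norm_J_le[of "J f"] J_J[OF that] by simp
qed (auto simp: J_add J_scaleC J_J)

lemma J_k0: "J (k 0) = kt"
  using J_J[OF kt_K] by (simp add: J_kt)

lemma J_T: assumes "f \<in> K" shows "J (T f) = backshift (J f)"
proof (rule hardy2_eqI_hcoeff)
  show "hcoeff (J (T f)) n = hcoeff (backshift (J f)) n" for n
    by (simp add: T_eq[OF assms] J_diff J_scaleC J_ue hcoeff_J hcoeff_backshift cinner_shift_right)
qed

lemma cinner_J_right_swap: "cinner f (J g) = cinner g (J f)"
  using J_swap[of g f] by (metis cinner_commute)

lemma symmetric_T: "symmetric_wrt K J T"
  unfolding symmetric_wrt_def
proof (intro ballI)
  fix f g assume fg: "f \<in> K" "g \<in> K"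
  have "cinner (T f) (J g) = cinner f (backshift (J g))" using fg by (intro cinner_T J_K) auto
  also have "\<dots> = cinner f (J (T g))" by (simp add: J_T fg)
  finally show "cinner (T f) (J g) = cinner (T g) (J f)" by (simp only: cinner_J_right_swap)
qed

section \<open>The adjoint of multiplication by an inner function\<close>

text \<open>
  For another inner function \<open>w\<close>, the adjoint splits the model space of \<open>w u\<close>: the component of \<open>h\<close> in
  \<open>u K\<^sub>w\<close> is \<open>u\<close> times the image of \<open>h\<close>.
\<close>

definition M_adj :: "hardy2 \<Rightarrow> hardy2" where
  "M_adj f = hardy2_of (\<lambda>n. cinner f (M (hmonom n)))"

lemma cinner_M_adj: "cinner (M_adj f) g = cinner f (M g)"
proof -
  have "(norm (\<Sum>n<N. a n *\<^sub>C M (hmonom n)))\<^sup>2 \<le> (\<Sum>n<N. (cmod (a n))\<^sup>2)" for a N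
    using norm_sum_hmonom_sq[of id N a] by (simp add: norm_M flip: M_sum)
  from hardy2_of_bounded(1)[OF bessel_hardy2[OF this, where f = f] norm_ge_zero]
  have coeff: "hcoeff (M_adj f) n = cinner f (M (hmonom n))" for n by (simp add: M_adj_def)
  have "cinner (M (truncate N g)) f = cnj (cinner (M_adj f) (truncate N g))" for N
    unfolding truncate_def M_sum
    by (simp add: cinner_sum_left cinner_sum_right cinner_simps cinner_hmonom coeff)
      (simp add: cinner_commute[of f])
  then have "cinner (M (truncate N g)) f = cinner (truncate N g) (M_adj f)" for N
    by (metis cinner_commute)
  moreover have "(\<lambda>N. M (truncate N g)) \<longlonglongrightarrow> M g"
  proof (rule LIM_zero_cancel, rule Lim_null_comparison)
    show "\<forall>\<^sub>F N in sequentially. norm (M (truncate N g) - M g) \<le> norm (truncate N g - g)"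
      by (intro always_eventually) (simp add: norm_M flip: M_simps(2))
    show "(\<lambda>N. norm (truncate N g - g)) \<longlonglongrightarrow> 0"
      using LIM_zero[OF truncate_tendsto[of g]] by (rule tendsto_norm_zero)
  qed
  then have "(\<lambda>N. cinner (M (truncate N g)) f) \<longlonglongrightarrow> cinner (M g) f"
    by (rule bounded_linear.tendsto[OF bounded_linear_cinner_left])
  moreover have "(\<lambda>N. cinner (truncate N g) (M_adj f)) \<longlonglongrightarrow> cinner g (M_adj f)"
    by (rule bounded_linear.tendsto[OF bounded_linear_cinner_left truncate_tendsto])
  ultimately have "cinner (M g) f = cinner g (M_adj f)" by (simp add: LIMSEQ_unique)
  then show ?thesis by (metis cinner_commute)
qed

end

section \<open>Defect operators of a compressed shift\<close>

locale nonconst_inner_fn = inner_fn +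
  assumes nonconst: "\<not> u constant_on ball 0 1"
begin

lemma u0_less_1: "cmod (u 0) < 1"
  by (rule inner_function_0_less_1[OF inner nonconst])

lemma defect_number_nonzero: "1 - u 0 * cnj (u 0) \<noteq> 0"
proof -
  have "(cmod (u 0))\<^sup>2 < 1" using u0_less_1 by (simp add: abs_square_less_1)
  then have "complex_of_real (1 - (cmod (u 0))\<^sup>2) \<noteq> 0" by (simp only: of_real_eq_0_iff)
  then show ?thesis by (simp add: complex_norm_square del: of_real_power)
qed

lemma kt_nonzero: "kt \<noteq> 0"
  using defect_number_nonzero cinner_kt_kt by (metis cinner_zero_left)

lemma k0_nonzero: "k 0 \<noteq> 0"
  using defect_number_nonzero cinner_k0_k0 by (metis cinner_zero_left)

lemma defect_op_eq:
  assumes "g \<in> K" shows "defect_op K T g = (cinner g kt / of_real (norm kt)) *\<^sub>C kt"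
  unfolding defect_op_def
  by (rule sqrt_on_rank_one[OF csubspace_K kt_K kt_nonzero _ assms])
    (simp add: adj_T T_K backshift_T)

lemma codefect_op_eq:
  assumes "g \<in> K" shows "codefect_op K T g = (cinner g (k 0) / of_real (norm (k 0))) *\<^sub>C k 0"
  unfolding codefect_op_def
  by (rule sqrt_on_rank_one[OF csubspace_K _ k0_nonzero _ assms])
    (simp_all add: adj_T T_backshift cinner_k)

lemma defect_space_eq: "defect_space K T = range (\<lambda>c. c *\<^sub>C kt)"
proof -
  have "defect_op K T ` K = range (\<lambda>c. c *\<^sub>C kt)"
  proof (intro set_eqI iffI)
    fix x assume "x \<in> range (\<lambda>c. c *\<^sub>C kt)"
    then obtain c where c: "x = c *\<^sub>C kt" by blast
    have "x = defect_op K T ((c / of_real (norm kt)) *\<^sub>C kt)"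
      using kt_nonzero
      by (simp add: c defect_op_eq K_intros cinner_simps cinner_self power2_eq_square)
    then show "x \<in> defect_op K T ` K" by (auto intro: K_intros)
  qed (auto simp: defect_op_eq)
  then show ?thesis by (simp add: defect_space_def closure_closed closed_complex_line)
qed

lemma codefect_space_eq: "codefect_space K T = range (\<lambda>c. c *\<^sub>C k 0)"
proof -
  have "codefect_op K T ` K = range (\<lambda>c. c *\<^sub>C k 0)"
  proof (intro set_eqI iffI)
    fix x assume "x \<in> range (\<lambda>c. c *\<^sub>C k 0)"
    then obtain c where c: "x = c *\<^sub>C k 0" by blast
    have "x = codefect_op K T ((c / of_real (norm (k 0))) *\<^sub>C k 0)"
      using k0_nonzero
      by (simp add: c codefect_op_eq K_intros cinner_simps cinner_self power2_eq_square)
    moreover have "(c / of_real (norm (k 0))) *\<^sub>C k 0 \<in> K" by (intro K_intros k_K) simp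
    ultimately show "x \<in> codefect_op K T ` K" by blast
  qed (auto simp: codefect_op_eq)
  then show ?thesis by (simp add: codefect_space_def closure_closed closed_complex_line)
qed

end

section \<open>The operator matrix\<close>

locale inner_pair = U: nonconst_inner_fn u + V: nonconst_inner_fn v for u v
begin

abbreviation "S \<equiv> model_space u \<times> model_space v"

lemma csubspace_S: "csubspace S"
  by (intro csubspace_Times U.csubspace_K V.csubspace_K)

text \<open>
  Both defect spaces are lines, so that the contraction \<open>Y\<close> between them is a number \<open>y\<close>, and
  the square roots in \<open>D\<^sub>* Y D\<close> multiply up to the operator \<open>g \<mapsto> y \<langle>g, k'\<^sub>v\<rangle> k\<^sub>u\<close> of rank one,
  where \<open>k'\<^sub>v\<close> and \<open>k\<^sub>u\<close> span the two defect spaces.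
\<close>

lemma corner_scalar:
  fixes X Y :: "hardy2 \<Rightarrow> hardy2"
  defines "D \<equiv> defect_space V.K V.T"
  assumes Y: "contraction_on D (codefect_space U.K U.T) Y"
    and X: "\<forall>g\<in>V.K. X g = codefect_op U.K U.T (Y (defect_op V.K V.T g))"
  obtains y where "\<And>g. g \<in> V.K \<Longrightarrow> X g = (y * cinner g V.kt) *\<^sub>C U.k 0"
    and "onorm_on D Y = cmod y" and "cmod y \<le> 1" and "(\<forall>g\<in>D. Y g = 0) \<longleftrightarrow> y = 0"
proof -
  have nz: "norm V.kt \<noteq> 0" "norm (U.k 0) \<noteq> 0" using V.kt_nonzero U.k0_nonzero by simp_all
  have D: "D = range (\<lambda>c. c *\<^sub>C V.kt)" by (simp add: D_def V.defect_space_eq)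
  have kt: "V.kt \<in> D" unfolding D by (metis rangeI scaleC_one)
  have "Y V.kt \<in> codefect_space U.K U.T"
    using Y kt by (simp add: contraction_on_def bounded_op_on_def)
  then obtain c where c: "Y V.kt = c *\<^sub>C U.k 0" by (auto simp: U.codefect_space_eq)
  have Y_eq: "Y (a *\<^sub>C V.kt) = (a * c) *\<^sub>C U.k 0" for a
    using Y kt c by (simp add: contraction_on_def bounded_op_on_def scaleC_scaleC)
  define y where "y = c * of_real (norm (U.k 0) / norm V.kt)"
  have ratio: "norm (Y (a *\<^sub>C V.kt)) = cmod y * norm (a *\<^sub>C V.kt)" for a
    using nz by (simp add: Y_eq norm_scaleC y_def norm_mult norm_divide)
  show ?thesis
  proof (rule that)
    show "X g = (y * cinner g V.kt) *\<^sub>C U.k 0" if g: "g \<in> V.K" for g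
      using nz X g
      by (simp add: V.defect_op_eq[OF g] Y_eq U.codefect_op_eq U.K_intros cinner_simps
          cinner_self power2_eq_square scaleC_scaleC y_def mult_ac)
    show "onorm_on D Y = cmod y"
      unfolding onorm_on_def
    proof (rule cSup_eq_maximum)
      have "norm (Y V.kt) / norm V.kt = cmod y" using ratio[of 1] nz by simp
      then show "cmod y \<in> (\<lambda>x. norm (Y x) / norm x) ` D" using kt by force
      show "r \<le> cmod y" if "r \<in> (\<lambda>x. norm (Y x) / norm x) ` D" for r
        using that unfolding D by (auto simp: ratio)
    qed
    have "norm (Y V.kt) \<le> norm V.kt" using Y kt by (simp add: contraction_on_def)
    then show "cmod y \<le> 1" using ratio[of 1] nz by simp
    have "(\<forall>g\<in>D. Y g = 0) \<longleftrightarrow> (\<forall>a. norm (Y (a *\<^sub>C V.kt)) = 0)" unfolding D by auto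
    also have "\<dots> \<longleftrightarrow> y = 0" unfolding ratio using nz by (auto simp: norm_scaleC dest: spec[of _ 1])
    finally show "(\<forall>g\<in>D. Y g = 0) \<longleftrightarrow> y = 0" .
  qed
qed

definition block_op :: "complex \<Rightarrow> hardy2 \<times> hardy2 \<Rightarrow> hardy2 \<times> hardy2" where
  "block_op y p = (U.T (fst p) + (y * cinner (snd p) V.kt) *\<^sub>C U.k 0, V.T (snd p))"

definition block_adj :: "complex \<Rightarrow> hardy2 \<times> hardy2 \<Rightarrow> hardy2 \<times> hardy2" where
  "block_adj y p = (backshift (fst p), backshift (snd p) + (cnj y * hardy2_fun (fst p) 0) *\<^sub>C V.kt)"

lemma block_op_S: "p \<in> S \<Longrightarrow> block_op y p \<in> S"
  by (auto simp: block_op_def intro!: U.K_intros)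

lemma block_adj_S: "p \<in> S \<Longrightarrow> block_adj y p \<in> S"
  by (auto simp: block_adj_def intro!: V.K_intros)

lemma cinner_block_op:
  assumes p: "p \<in> S" and q: "q \<in> S"
  shows "cinner (block_op y p) q = cinner p (block_adj y q)"
proof -
  have "cinner (U.k 0) (fst q) = cnj (hardy2_fun (fst q) 0)"
    using q U.cinner_k[of 0 "fst q"] cinner_commute[of "U.k 0" "fst q"] by (simp add: mem_Times_iff)
  then show ?thesis
    using p q
    by (simp add: block_op_def block_adj_def cinner_prod_def cinner_simps mem_Times_iff
        U.cinner_T V.cinner_T)
qed

lemma adj_block_op: "p \<in> S \<Longrightarrow> adj_on S (block_op y) p = block_adj y p"
  by (rule adj_on_eqI[OF csubspace_S]) (auto simp: cinner_block_op block_adj_S)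

end

section \<open>Necessity\<close>

text \<open>
  Here \<open>P\<close>, \<open>Q\<close> stand for \<open>u - u(0)\<close>, \<open>v - v(0)\<close> and \<open>A\<close>, \<open>B\<close> for the kernels at 0, so that \<open>P / A\<close>
  and \<open>Q / B\<close> are the normalised inner functions. Dividing by \<open>A B\<close> makes each relation an affine one
  between \<open>P / A\<close> and \<open>Q / B\<close>, because \<open>m / A = 1 + u(0)\<^sup>* P / A\<close> and \<open>n / B = 1 + v(0)\<^sup>* Q / B\<close>;
  \<open>at_0\<close> removes the constant terms. If the coefficient of \<open>Q / B\<close> vanishes in the second relation, it
  does not in the first, since \<open>y \<noteq> 0\<close>.
\<close>

lemma proportional_if_relations:
  fixes A B P Q :: "'a \<Rightarrow> complex" and u0 v0 y al1 al2 be1 be2 m n :: complex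
  assumes y: "y \<noteq> 0" and mn: "m \<noteq> 0" "n \<noteq> 0" "cnj m = m" "cnj n = n"
    and m: "\<And>w. w \<in> W \<Longrightarrow> m = A w + cnj u0 * P w" and n: "\<And>w. w \<in> W \<Longrightarrow> n = B w + cnj v0 * Q w"
    and at_0: "al1 * cnj be1 * m + al2 * cnj be2 * n = 0"
    and 1: "\<And>w. w \<in> W \<Longrightarrow> al1 * (cnj be1 * A w + cnj y * cnj be2 * B w * P w) + al2 * cnj be2 * B w = 0"
    and 2: "\<And>w. w \<in> W \<Longrightarrow>
      cnj y * Q w * A w = be1 * (cnj al1 * A w + cnj y * cnj al2 * B w * P w) + be2 * cnj al2 * B w"
  obtains c where "\<And>w. w \<in> W \<Longrightarrow> Q w * A w = c * (P w * B w)"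
proof -
  define \<kappa> where "\<kappa> = al1 * cnj be1"
  have k: "n * (al2 * cnj be2) = - \<kappa> * m" using at_0 by (simp add: \<kappa>_def algebra_simps eq_neg_iff_add_eq_0)
  have k': "n * (be2 * cnj al2) = - cnj \<kappa> * m"
    using arg_cong[OF k, of cnj] by (simp add: mn mult_ac)
  have AB: "n * A w - m * B w = cnj v0 * Q w * A w - cnj u0 * P w * B w" if "w \<in> W" for w
    unfolding m[OF that] n[OF that] by algebra
  have r1: "\<kappa> * cnj v0 * (Q w * A w) = (\<kappa> * cnj u0 - n * cnj y * al1 * cnj be2) * (P w * B w)"
    if w: "w \<in> W" for w
  proof -
    have "0 = n * (al1 * (cnj be1 * A w + cnj y * cnj be2 * B w * P w) + al2 * cnj be2 * B w)"
      by (simp add: 1[OF w])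
    also have "\<dots> = \<kappa> * (n * A w) + n * cnj y * al1 * cnj be2 * (P w * B w) + (n * (al2 * cnj be2)) * B w"
      unfolding \<kappa>_def by algebra
    also have "\<dots> = \<kappa> * (n * A w - m * B w) + n * cnj y * al1 * cnj be2 * (P w * B w)"
      unfolding k by algebra
    finally show ?thesis unfolding AB[OF w] by algebra
  qed
  have r2: "(n * cnj y - cnj \<kappa> * cnj v0) * (Q w * A w) =
      (n * cnj y * be1 * cnj al2 - cnj \<kappa> * cnj u0) * (P w * B w)"
    if w: "w \<in> W" for w
  proof -
    have ck: "cnj \<kappa> = be1 * cnj al1" by (simp add: \<kappa>_def)
    have "n * (cnj y * Q w * A w) = cnj \<kappa> * (n * A w) + n * cnj y * be1 * cnj al2 * (P w * B w)
        + (n * (be2 * cnj al2)) * B w"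
      unfolding 2[OF w] ck by algebra
    also have "\<dots> = cnj \<kappa> * (n * A w - m * B w) + n * cnj y * be1 * cnj al2 * (P w * B w)"
      unfolding k' by algebra
    finally show ?thesis unfolding AB[OF w] by algebra
  qed
  have divide: "\<exists>c. \<forall>w\<in>W. Q w * A w = c * (P w * B w)"
    if "d \<noteq> 0" "\<And>w. w \<in> W \<Longrightarrow> d * (Q w * A w) = e * (P w * B w)" for d e
    using that by (intro exI[of _ "e / d"]) (simp add: field_simps)
  have "\<exists>c. \<forall>w\<in>W. Q w * A w = c * (P w * B w)"
  proof (cases "n * cnj y - cnj \<kappa> * cnj v0 = 0")
    case True
    then have "cnj \<kappa> * cnj v0 \<noteq> 0" using y mn by auto
    then have "\<kappa> * cnj v0 \<noteq> 0" by simp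
    then show ?thesis using r1 by (rule divide)
  next
    case False
    then show ?thesis using r2 by (rule divide)
  qed
  then show ?thesis using that by blast
qed

text \<open>
  On the unit circle \<open>\<bar>u - a\<bar> = \<bar>1 - a\<^sup>* u\<bar>\<close>, because \<open>\<bar>u\<bar> = 1\<close> there.
\<close>

lemma (in inner_fn) norm_M_diff_scaleC: "norm (M h - a *\<^sub>C h) = norm (h - cnj a *\<^sub>C M h)"
proof -
  have "Re (cnj a * cinner (M h) h) = Re (a * cinner h (M h))"
    by (subst cinner_commute) (simp add: cinner_commute[of h "M h"])
  then have "(norm (M h - a *\<^sub>C h))\<^sup>2 = (norm (h - cnj a *\<^sub>C M h))\<^sup>2"
    unfolding norm_diff_scaleC_sq norm_M by simp
  then show ?thesis by (simp add: power2_eq_iff_nonneg)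
qed

context inner_pair
begin

text \<open>
  On the unit circle \<open>\<bar>v - v(0)\<bar> = \<bar>1 - v(0)\<^sup>* v\<bar>\<close>, and likewise for \<open>u\<close>; so the two sides differ in
  norm by the factor \<open>\<bar>c\<bar>\<close>, and they are not zero.
\<close>

lemma cmod_factor_eq_1:
  assumes rel: "\<And>w. w \<in> ball 0 1 \<Longrightarrow>
    (v w - v 0) * (1 - cnj (u 0) * u w) = c * ((u w - u 0) * (1 - cnj (v 0) * v w))"
  shows "cmod c = 1"
proof -
  define h where "h = U.k 0"
  define h' where "h' = V.k 0"
  have val: "hardy2_fun h w = 1 - cnj (u 0) * u w" "hardy2_fun h' w = 1 - cnj (v 0) * v w"
    if "w \<in> ball 0 1" for w
    using that by (simp_all only: h_def h'_def U.fun_k0 V.fun_k0)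
  have "V.M h - v 0 *\<^sub>C h = c *\<^sub>C (U.M h' - u 0 *\<^sub>C h')"
  proof (rule hardy2_eqI)
    fix w :: complex assume w: "w \<in> ball 0 1"
    show "hardy2_fun (V.M h - v 0 *\<^sub>C h) w = hardy2_fun (c *\<^sub>C (U.M h' - u 0 *\<^sub>C h')) w"
      using rel[OF w]
      unfolding hardy2_fun_diff hardy2_fun_scaleC V.fun_M[OF w] U.fun_M[OF w] val[OF w]
      by (simp add: left_diff_distrib[symmetric])
  qed
  then have "norm (V.M h - v 0 *\<^sub>C h) = cmod c * norm (U.M h' - u 0 *\<^sub>C h')"
    by (simp add: norm_scaleC)
  then have *: "norm (h - cnj (v 0) *\<^sub>C V.M h) = cmod c * norm (h' - cnj (u 0) *\<^sub>C U.M h')"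
    by (simp only: U.norm_M_diff_scaleC V.norm_M_diff_scaleC)
  have eq: "h - cnj (v 0) *\<^sub>C V.M h = h' - cnj (u 0) *\<^sub>C U.M h'"
  proof (rule hardy2_eqI)
    fix w :: complex assume w: "w \<in> ball 0 1"
    show "hardy2_fun (h - cnj (v 0) *\<^sub>C V.M h) w = hardy2_fun (h' - cnj (u 0) *\<^sub>C U.M h') w"
      unfolding hardy2_fun_diff hardy2_fun_scaleC V.fun_M[OF w] U.fun_M[OF w] val[OF w] by algebra
  qed
  have "hardy2_fun (h - cnj (v 0) *\<^sub>C V.M h) 0 = (1 - u 0 * cnj (u 0)) * (1 - v 0 * cnj (v 0))"
    by (simp add: hardy2_fun_diff hardy2_fun_scaleC V.fun_M val algebra_simps)
  then have "h - cnj (v 0) *\<^sub>C V.M h \<noteq> 0"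
    using U.defect_number_nonzero V.defect_number_nonzero by (metis hardy2_fun_zero mult_eq_0_iff)
  then show ?thesis using * unfolding eq by simp
qed

text \<open>
  Solving \<open>(v - v(0)) / (1 - v(0)\<^sup>* v) = c (u - u(0)) / (1 - u(0)\<^sup>* u)\<close> for \<open>v\<close> composes two disc
  automorphisms with a rotation; \<open>a\<close> is the point that \<open>u\<close> has to take for \<open>v\<close> to vanish.
\<close>

lemma blaschke_of_proportional:
  assumes rel: "\<And>w. w \<in> ball 0 1 \<Longrightarrow>
    (v w - v 0) * (1 - cnj (u 0) * u w) = c * ((u w - u 0) * (1 - cnj (v 0) * v w))"
  shows "\<exists>a\<in>ball 0 1. \<exists>\<mu>\<in>sphere 0 1. \<forall>z\<in>ball 0 1. v z = \<mu> * blaschke_factor a (u z)"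
proof -
  have c1: "cmod c = 1" by (rule cmod_factor_eq_1[OF rel])
  then have c: "c * cnj c = 1" by (simp add: complex_norm_square[symmetric])
  define D where "D = 1 - cnj (v 0) * c * u 0"
  define a where "a = (u 0 - v 0 * cnj c) / cnj D"
  define \<mu> where "\<mu> = - c * cnj D / D"
  have ca: "cmod (v 0 * cnj c) < 1" using V.u0_less_1 c1 by (simp add: norm_mult)
  have D0: "D \<noteq> 0"
  proof
    assume "D = 0"
    then have "cmod (cnj (v 0) * c * u 0) = 1" by (simp add: D_def)
    moreover have "cmod (v 0) * cmod (u 0) < 1 * 1"
      using U.u0_less_1 V.u0_less_1 by (intro mult_strict_mono') simp_all
    ultimately show False by (simp add: norm_mult c1)
  qed
  then have D0': "cnj D \<noteq> 0" by simp
  have "cmod a = cmod (Moebius_function 0 (v 0 * cnj c) (u 0))"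
  proof -
    have "1 - cnj (v 0 * cnj c) * u 0 = D" by (simp add: D_def)
    then show ?thesis by (simp add: Moebius_function_def a_def norm_divide)
  qed
  also have "\<dots> < 1" by (rule Moebius_function_norm_lt_1[OF ca U.u0_less_1])
  finally have a: "a \<in> ball 0 1" by simp
  have \<mu>: "\<mu> \<in> sphere 0 1" using D0 c1 by (simp add: \<mu>_def norm_mult norm_divide)
  have "v z = \<mu> * blaschke_factor a (u z)" if z: "z \<in> ball 0 1" for z
  proof -
    have nz: "1 - cnj a * u z \<noteq> 0" using a by (intro U.denominator_nonzero z) simp
    have cna: "cnj a * D = cnj (u 0) - cnj (v 0) * c" using D0 by (simp add: a_def)
    have am: "\<mu> * a * D = - c * (u 0 - v 0 * cnj c)" "\<mu> * D = - c * cnj D"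
      using D0 D0' by (simp_all add: a_def \<mu>_def)
    have cD: "cnj D = 1 - v 0 * cnj c * cnj (u 0)" by (simp add: D_def)
    have "(v z * (1 - cnj a * u z)) * D = v z * (D - (cnj a * D) * u z)" by algebra
    also have "\<dots> = v z * (1 - cnj (v 0) * c * u 0 - (cnj (u 0) - cnj (v 0) * c) * u z)"
      unfolding cna by (simp add: D_def)
    also have "\<dots> = c * u z - c * u 0 + v 0 - v 0 * cnj (u 0) * u z"
      using rel[OF z] by algebra
    also have "\<dots> = - c * (u 0 - v 0 * cnj c) - (- c * (1 - v 0 * cnj c * cnj (u 0))) * u z"
      using c by algebra
    also have "\<dots> = (\<mu> * (a - u z)) * D"
      unfolding cD[symmetric] am[symmetric] by algebra
    finally have "v z * (1 - cnj a * u z) = \<mu> * (a - u z)" using D0 by simp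
    then show ?thesis using nz by (simp add: blaschke_factor_def field_simps)
  qed
  then show ?thesis using a \<mu> by blast
qed

lemma defect_block_op:
  assumes p: "p \<in> S"
  obtains a b where "p - block_adj y (block_op y p) = (a *\<^sub>C U.kt, b *\<^sub>C V.kt)"
proof -
  obtain f g where fg: "p = (f, g)" "f \<in> U.K" "g \<in> V.K" using p by auto
  show ?thesis
    by (rule that)
      (simp add: fg block_op_def block_adj_def backshift_add backshift_scaleC U.backshift_T
        V.backshift_T U.backshift_k0 scaleC_simps flip: scaleC_minus_left scaleC_add_left scaleC_diff_left)
qed

text \<open>
  On the span of \<open>(k\<^sub>u, 0)\<close> and \<open>(0, k\<^sub>v)\<close>, the operator \<open>I - T T\<^sup>*\<close> acts by a two by two matrix whose
  determinant is \<open>1 - \<bar>y\<bar>\<^sup>2\<close> up to the squared norms of \<open>k\<^sub>u\<close> and \<open>k\<^sub>v\<close>. The preimages are read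
  off from its inverse.
\<close>

lemma spanning_defect_vectors:
  assumes y: "cmod y < 1"
  shows "\<exists>x\<in>S. (U.k 0, 0) = x - block_op y (block_adj y x)"
    and "\<exists>x\<in>S. (0, V.k 0) = x - block_op y (block_adj y x)"
proof -
  define m where "m = 1 - u 0 * cnj (u 0)"
  define n where "n = 1 - v 0 * cnj (v 0)"
  define r where "r = 1 - y * cnj y"
  have "(cmod y)\<^sup>2 < 1" using y by (simp add: abs_square_less_1)
  then have "complex_of_real (1 - (cmod y)\<^sup>2) \<noteq> 0" by (simp only: of_real_eq_0_iff)
  then have r: "r \<noteq> 0" by (simp add: r_def complex_norm_square del: of_real_power)
  have m0: "m \<noteq> 0" "n \<noteq> 0"
    using U.defect_number_nonzero V.defect_number_nonzero by (simp_all add: m_def n_def)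
  have val: "hardy2_fun (U.k 0) 0 = m" "hardy2_fun (V.k 0) 0 = n"
    by (simp_all add: U.fun_k0 V.fun_k0 m_def n_def mult.commute)
  have eq: "(s *\<^sub>C U.k 0, t *\<^sub>C V.k 0) - block_op y (block_adj y (s *\<^sub>C U.k 0, t *\<^sub>C V.k 0)) =
      ((s * m * (1 - y * cnj y * n) + y * cnj (v 0) * (t * n)) *\<^sub>C U.k 0,
       (t * n + cnj y * v 0 * (s * m)) *\<^sub>C V.k 0)" for s t
  proof -
    have K: "s *\<^sub>C U.k 0 \<in> U.K" "t *\<^sub>C V.k 0 \<in> V.K" by (intro U.K_intros V.K_intros U.k_K V.k_K; simp)+
    have f: "U.T (backshift (s *\<^sub>C U.k 0)) = s *\<^sub>C U.k 0 - (s * m) *\<^sub>C U.k 0"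
      and g: "V.T (backshift (t *\<^sub>C V.k 0)) = t *\<^sub>C V.k 0 - (t * n) *\<^sub>C V.k 0"
      using U.T_backshift[OF K(1)] V.T_backshift[OF K(2)] by (simp_all add: hardy2_fun_scaleC val)
    have c: "cinner (backshift (t *\<^sub>C V.k 0)) V.kt = - (t * n * cnj (v 0))"
      unfolding model_cokernel_def cinner_backshift_backshift
      by (simp add: V.cinner_K_ue K(2) V.fun_ue hardy2_fun_scaleC val)
    have "V.T (backshift (t *\<^sub>C V.k 0) + (cnj y * (s * m)) *\<^sub>C V.kt) =
        t *\<^sub>C V.k 0 - (t * n) *\<^sub>C V.k 0 - (cnj y * (s * m) * v 0) *\<^sub>C V.k 0"
      using K by (simp add: V.T_add V.T_scaleC V.T_kt g V.K_intros V.backshift_K scaleC_simps)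
    then show ?thesis
      by (simp add: block_op_def block_adj_def f hardy2_fun_scaleC val cinner_simps c V.cinner_kt_kt
          flip: n_def) (simp add: scaleC_simps algebra_simps)
  qed
  have in_S: "(s *\<^sub>C U.k 0, t *\<^sub>C V.k 0) \<in> S" for s t
    by (auto intro!: U.K_intros V.K_intros)
  have id: "n + v 0 * cnj (v 0) = 1" by (simp add: n_def)
  show "\<exists>x\<in>S. (U.k 0, 0) = x - block_op y (block_adj y x)"
  proof (intro bexI[OF _ in_S])
    have "1 / (r * m) * m * (1 - y * cnj y * n) + y * cnj (v 0) * (- cnj y * v 0 / (r * n) * n) =
        (1 - y * cnj y * (n + v 0 * cnj (v 0))) / r"
      using m0 r by (simp add: field_simps)
    also have "\<dots> = 1" using r by (simp add: id r_def)
    finally have 1: "1 / (r * m) * m * (1 - y * cnj y * n) + y * cnj (v 0) * (- cnj y * v 0 / (r * n) * n) = 1" .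
    have 2: "- cnj y * v 0 / (r * n) * n + cnj y * v 0 * (1 / (r * m) * m) = 0"
      using m0 r by (simp add: field_simps)
    show "(U.k 0, 0) = ((1 / (r * m)) *\<^sub>C U.k 0, (- cnj y * v 0 / (r * n)) *\<^sub>C V.k 0) -
        block_op y (block_adj y ((1 / (r * m)) *\<^sub>C U.k 0, (- cnj y * v 0 / (r * n)) *\<^sub>C V.k 0))"
      unfolding eq 1 2 by simp
  qed
  show "\<exists>x\<in>S. (0, V.k 0) = x - block_op y (block_adj y x)"
  proof (intro bexI[OF _ in_S])
    have 1: "- y * cnj (v 0) / (r * m) * m * (1 - y * cnj y * n) +
        y * cnj (v 0) * ((1 - y * cnj y * n) / (r * n) * n) = 0"
      using m0 r by (simp add: field_simps)
    have "(1 - y * cnj y * n) / (r * n) * n + cnj y * v 0 * (- y * cnj (v 0) / (r * m) * m) =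
        (1 - y * cnj y * (n + v 0 * cnj (v 0))) / r"
      using m0 r by (simp add: field_simps)
    also have "\<dots> = 1" using r by (simp add: id r_def)
    finally have 2: "(1 - y * cnj y * n) / (r * n) * n + cnj y * v 0 * (- y * cnj (v 0) / (r * m) * m) = 1" .
    show "(0, V.k 0) = ((- y * cnj (v 0) / (r * m)) *\<^sub>C U.k 0, ((1 - y * cnj y * n) / (r * n)) *\<^sub>C V.k 0) -
        block_op y (block_adj y ((- y * cnj (v 0) / (r * m)) *\<^sub>C U.k 0, ((1 - y * cnj y * n) / (r * n)) *\<^sub>C V.k 0))"
      unfolding eq 1 2 by simp
  qed
qed

text \<open>
  A conjugation with \<open>T = C T\<^sup>* C\<close> maps the range of \<open>I - T T\<^sup>*\<close> to that of \<open>I - T\<^sup>* T\<close>, and it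
  exchanges the resolvents of \<open>T\<close> and \<open>T\<^sup>*\<close>. The matrix entries of the resolvent of \<open>T\<close> between
  vectors of the first, two-dimensional space are therefore entries between vectors of the second. As
  all of them are explicit in \<open>u w\<close> and \<open>v w\<close>, where \<open>w\<^sup>*\<close> is the parameter of the resolvent, this
  is a pair of algebraic relations between \<open>u\<close> and \<open>v\<close>.
\<close>

lemma proportional_if_complex_symmetric:
  assumes cs: "complex_symmetric_on S (block_op y)" and y: "y \<noteq> 0" "cmod y < 1"
  obtains c where "\<And>w. w \<in> ball 0 1 \<Longrightarrow>
    (v w - v 0) * (1 - cnj (u 0) * u w) = c * ((u w - u 0) * (1 - cnj (v 0) * v w))"
proof -
  obtain C where C: "conjugation_on S C"
    and sym: "\<And>x. x \<in> S \<Longrightarrow> block_op y x = C (adj_on S (block_op y) (C x))"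
    using cs by (auto simp: complex_symmetric_on_def)
  note CD = conjugation_onD[OF C]
  note SI = csubspace_intros[OF csubspace_S]
  have CT: "C (block_op y x) = block_adj y (C x)" if "x \<in> S" for x
    using that by (simp add: sym adj_block_op CD block_adj_S)
  have TC: "C (block_adj y x) = block_op y (C x)" if "x \<in> S" for x
    using that by (simp add: sym adj_block_op CD)
  have C_defect: "\<exists>a b. C (x - block_op y (block_adj y x)) = (a *\<^sub>C U.kt, b *\<^sub>C V.kt)" if x: "x \<in> S" for x
  proof -
    have "C (x - block_op y (block_adj y x)) = C x - block_adj y (block_op y (C x))"
      using x by (simp add: conjugation_diff[OF csubspace_S C] block_op_S block_adj_S CT TC)
    then show ?thesis using defect_block_op[OF CD(1)[OF x]] by metis
  qed
  obtain al1 al2 where al: "C (U.k 0, 0) = (al1 *\<^sub>C U.kt, al2 *\<^sub>C V.kt)"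
    using spanning_defect_vectors(1)[OF y(2)] C_defect by metis
  obtain be1 be2 where be: "C (0, V.k 0) = (be1 *\<^sub>C U.kt, be2 *\<^sub>C V.kt)"
    using spanning_defect_vectors(2)[OF y(2)] C_defect by metis
  have exchange: "cinner \<xi> b = cinner \<zeta> (C a)"
    if "a \<in> S" "b \<in> S" "\<xi> \<in> S" "\<zeta> \<in> S"
      and a: "\<xi> - cnj w *\<^sub>C block_op y \<xi> = a" and b: "\<zeta> - cnj w *\<^sub>C block_op y \<zeta> = C b"
    for a b \<xi> \<zeta> w
  proof -
    have "C a = C \<xi> - w *\<^sub>C block_adj y (C \<xi>)"
      using that(3) unfolding a[symmetric]
      by (simp add: conjugation_diff[OF csubspace_S C] CD block_op_S SI CT)
    then have "cinner \<zeta> (C a) = cinner \<zeta> (C \<xi>) - cnj w * cinner (block_op y \<zeta>) (C \<xi>)"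
      using that(3,4) by (simp add: cinner_simps cinner_block_op CD)
    also have "\<dots> = cinner (C b) (C \<xi>)" unfolding b[symmetric] by (simp add: cinner_simps)
    also have "\<dots> = cinner \<xi> b" using that by (simp add: conjugation_cinner[OF csubspace_S C])
    finally show ?thesis by simp
  qed
  define A where "A w = 1 - cnj (u 0) * u w" for w
  define B where "B w = 1 - cnj (v 0) * v w" for w
  define P where "P w = u w - u 0" for w
  define Q where "Q w = v w - v 0" for w
  have z0: "0 \<in> ball (0::complex) 1" by simp
  have k_S: "(U.k 0, 0) \<in> S" "(0, V.k 0) \<in> S"
    using U.k_K[OF z0] V.k_K[OF z0] U.K_intros(1) V.K_intros(1) by simp_all
  \<comment> \<open>The resolvent applied to a vector of the second space, and its matrix entries there.\<close>
  define \<zeta> where "\<zeta> w b1 b2 = (b1 *\<^sub>C (U.kt - (cnj w * u 0) *\<^sub>C U.k w) + (cnj w * y * b2 * cnj (B w)) *\<^sub>C U.k w,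
      b2 *\<^sub>C (V.kt - (cnj w * v 0) *\<^sub>C V.k w))" for w b1 b2
  have \<zeta>_S: "\<zeta> w b1 b2 \<in> S" if "w \<in> ball 0 1" for w b1 b2
    unfolding \<zeta>_def using that by (intro SigmaI U.K_intros V.K_intros U.k_K V.k_K U.kt_K V.kt_K)
  have vkt: "cinner (V.kt - (cnj w * v 0) *\<^sub>C V.k w) V.kt = cnj (B w)" if w: "w \<in> ball 0 1" for w
  proof -
    have "cinner (V.kt - (cnj w * v 0) *\<^sub>C V.k w) V.kt =
        1 - v 0 * cnj (v 0) - v 0 * (cnj w * cinner (V.k w) V.kt)"
      by (simp add: cinner_simps V.cinner_kt_kt)
    then show ?thesis unfolding V.cinner_k_kt[OF w] by (simp add: B_def algebra_simps)
  qed
  have ukt: "cinner (U.kt - (cnj w * u 0) *\<^sub>C U.k w) U.kt = cnj (A w)" if w: "w \<in> ball 0 1" for w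
  proof -
    have "cinner (U.kt - (cnj w * u 0) *\<^sub>C U.k w) U.kt =
        1 - u 0 * cnj (u 0) - u 0 * (cnj w * cinner (U.k w) U.kt)"
      by (simp add: cinner_simps U.cinner_kt_kt)
    then show ?thesis unfolding U.cinner_k_kt[OF w] by (simp add: A_def algebra_simps)
  qed
  have \<zeta>_res: "\<zeta> w b1 b2 - cnj w *\<^sub>C block_op y (\<zeta> w b1 b2) = (b1 *\<^sub>C U.kt, b2 *\<^sub>C V.kt)"
    if w: "w \<in> ball 0 1" for w b1 b2
  proof -
    define f where "f = U.kt - (cnj w * u 0) *\<^sub>C U.k w"
    define g where "g = V.kt - (cnj w * v 0) *\<^sub>C V.k w"
    have f: "f \<in> U.K" "f - cnj w *\<^sub>C U.T f = U.kt"
      using U.resolvent_kt[OF w] w by (auto simp: f_def intro!: U.K_intros)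
    have g: "g \<in> V.K" "g - cnj w *\<^sub>C V.T g = V.kt"
      using V.resolvent_kt[OF w] w by (auto simp: g_def intro!: V.K_intros)
    define e where "e = cnj w * y * b2 * cnj (B w)"
    have Tf: "U.T (b1 *\<^sub>C f + e *\<^sub>C U.k w) = b1 *\<^sub>C U.T f + e *\<^sub>C U.T (U.k w)"
      using f w by (simp add: U.T_add U.T_scaleC U.K_intros)
    have "b1 *\<^sub>C f + e *\<^sub>C U.k w - cnj w *\<^sub>C (b1 *\<^sub>C U.T f + e *\<^sub>C U.T (U.k w) + (y * (b2 * cnj (B w))) *\<^sub>C U.k 0) =
        b1 *\<^sub>C (f - cnj w *\<^sub>C U.T f) + e *\<^sub>C (U.k w - cnj w *\<^sub>C U.T (U.k w)) - e *\<^sub>C U.k 0"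
      by (simp add: scaleC_simps e_def mult_ac)
    also have "\<dots> = b1 *\<^sub>C U.kt" unfolding f(2) U.resolvent_k0[OF w] by simp
    finally have 1: "b1 *\<^sub>C f + e *\<^sub>C U.k w -
        cnj w *\<^sub>C (b1 *\<^sub>C U.T f + e *\<^sub>C U.T (U.k w) + (y * (b2 * cnj (B w))) *\<^sub>C U.k 0) = b1 *\<^sub>C U.kt" .
    have 2: "b2 *\<^sub>C g - cnj w *\<^sub>C V.T (b2 *\<^sub>C g) = b2 *\<^sub>C V.kt"
      unfolding V.T_scaleC[OF g(1)] g(2)[symmetric] by (simp add: scaleC_simps mult.commute)
    have \<zeta>: "\<zeta> w b1 b2 = (b1 *\<^sub>C f + e *\<^sub>C U.k w, b2 *\<^sub>C g)" by (simp add: \<zeta>_def f_def g_def e_def)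
    have "cinner (b2 *\<^sub>C g) V.kt = b2 * cnj (B w)"
      unfolding g_def cinner_scaleC_left vkt[OF w] ..
    then show ?thesis
      unfolding \<zeta> block_op_def fst_conv snd_conv Tf scaleC_Pair by (simp only: diff_Pair 1 2)
  qed
  have \<zeta>_cinner: "cinner (\<zeta> w b1 b2) (a1 *\<^sub>C U.kt, a2 *\<^sub>C V.kt) =
      cnj a1 * (b1 * cnj (A w) + y * b2 * cnj (B w) * cnj (P w)) + cnj a2 * b2 * cnj (B w)"
    if w: "w \<in> ball 0 1" for w b1 b2 a1 a2
  proof -
    have "cinner (\<zeta> w b1 b2) (a1 *\<^sub>C U.kt, a2 *\<^sub>C V.kt) =
        cnj a1 * (b1 * cinner (U.kt - (cnj w * u 0) *\<^sub>C U.k w) U.kt +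
          y * b2 * cnj (B w) * (cnj w * cinner (U.k w) U.kt)) +
        cnj a2 * (b2 * cinner (V.kt - (cnj w * v 0) *\<^sub>C V.k w) V.kt)"
      unfolding \<zeta>_def cinner_Pair cinner_scaleC_right cinner_add_left cinner_scaleC_left
      by (simp only: mult_ac)
    then show ?thesis
      unfolding ukt[OF w] vkt[OF w] U.cinner_k_kt[OF w] by (simp add: P_def mult_ac)
  qed
  have 1: "al1 * (cnj be1 * A w + cnj y * cnj be2 * B w * P w) + al2 * cnj be2 * B w = 0"
    if w: "w \<in> ball 0 1" for w
  proof -
    have "(U.k w, 0) - cnj w *\<^sub>C block_op y (U.k w, 0) = (U.k 0, 0)"
      using V.T_scaleC[of 0 0] V.K_intros(1) U.resolvent_k0[OF w]
      by (simp add: block_op_def scaleC_Pair)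
    from exchange[OF k_S(1,2) _ \<zeta>_S[OF w] this \<zeta>_res[OF w, of be1 be2, folded be]]
    have "0 = cinner (\<zeta> w be1 be2) (al1 *\<^sub>C U.kt, al2 *\<^sub>C V.kt)"
      using U.k_K[OF w] V.K_intros(1) by (simp add: al cinner_Pair)
    from arg_cong[OF this, of cnj] show ?thesis unfolding \<zeta>_cinner[OF w] by simp
  qed
  have 2: "cnj y * Q w * A w = be1 * (cnj al1 * A w + cnj y * cnj al2 * B w * P w) + be2 * cnj al2 * B w"
    if w: "w \<in> ball 0 1" for w
  proof -
    define e where "e = y * (cnj w * cinner (V.k w) V.kt)"
    have kw: "U.k w \<in> U.K" "V.k w \<in> V.K" using w by simp_all
    have "e *\<^sub>C U.k w - cnj w *\<^sub>C (e *\<^sub>C U.T (U.k w) + (y * cinner (V.k w) V.kt) *\<^sub>C U.k 0) =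
        e *\<^sub>C (U.k w - cnj w *\<^sub>C U.T (U.k w)) - e *\<^sub>C U.k 0"
      by (simp add: scaleC_simps e_def mult_ac)
    also have "\<dots> = 0" unfolding U.resolvent_k0[OF w] by simp
    finally have fst_eq: "e *\<^sub>C U.k w -
        cnj w *\<^sub>C (e *\<^sub>C U.T (U.k w) + (y * cinner (V.k w) V.kt) *\<^sub>C U.k 0) = 0" .
    have "(e *\<^sub>C U.k w, V.k w) - cnj w *\<^sub>C block_op y (e *\<^sub>C U.k w, V.k w) = (0, V.k 0)"
      by (simp only: block_op_def fst_conv snd_conv U.T_scaleC[OF kw(1)] scaleC_Pair diff_Pair
          fst_eq V.resolvent_k0[OF w])
    from exchange[OF k_S(2,1) _ \<zeta>_S[OF w] this \<zeta>_res[OF w, of al1 al2, folded al]]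
    have "e * cinner (U.k w) (U.k 0) = cinner (\<zeta> w al1 al2) (be1 *\<^sub>C U.kt, be2 *\<^sub>C V.kt)"
      using kw U.K_intros by (simp add: be cinner_Pair cinner_scaleC_left)
    moreover have "cinner (U.k w) (U.k 0) = cnj (A w)"
      using U.cinner_k[OF w U.k_K[OF z0]] U.fun_k0[OF w] cinner_commute[of "U.k w" "U.k 0"]
      by (simp add: A_def)
    ultimately have "y * cnj (Q w) * cnj (A w) = cinner (\<zeta> w al1 al2) (be1 *\<^sub>C U.kt, be2 *\<^sub>C V.kt)"
      unfolding e_def V.cinner_k_kt[OF w] by (simp add: Q_def)
    from arg_cong[OF this, of cnj] show ?thesis unfolding \<zeta>_cinner[OF w] by simp
  qed
  define m where "m = 1 - u 0 * cnj (u 0)"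
  define n where "n = 1 - v 0 * cnj (v 0)"
  have at_0: "al1 * cnj be1 * m + al2 * cnj be2 * n = 0"
    using 1[OF z0] by (simp add: A_def B_def P_def m_def n_def mult_ac)
  have mn: "m \<noteq> 0" "n \<noteq> 0" "cnj m = m" "cnj n = n"
    using U.defect_number_nonzero V.defect_number_nonzero by (simp_all add: m_def n_def mult.commute)
  have m: "m = A w + cnj (u 0) * P w" and n: "n = B w + cnj (v 0) * Q w" for w
    by (simp_all add: m_def n_def A_def B_def P_def Q_def algebra_simps)
  show ?thesis
  proof (rule proportional_if_relations[OF y(1) mn m n at_0 1 2])
    fix c assume c: "\<And>w. w \<in> ball 0 1 \<Longrightarrow> Q w * A w = c * (P w * B w)"
    show thesis by (rule that[of c]) (use c in \<open>simp add: A_def B_def P_def Q_def\<close>)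
  qed
qed

end

section \<open>The Crofoot transform\<close>

text \<open>
  If \<open>v = \<mu> b\<^sub>\<rho>(u)\<close>, multiplication by \<open>s / (1 - \<rho>\<^sup>* u)\<close> with \<open>s\<^sup>2 = 1 - \<bar>\<rho>\<bar>\<^sup>2\<close> maps the model space
  of \<open>u\<close> unitarily onto that of \<open>v\<close>. The relation is symmetric in \<open>u\<close> and \<open>v\<close>, and it gives
  \<open>(1 - \<rho>\<^sup>* u) (1 - \<rho>\<^sup>* \<mu>\<^sup>* v) = s\<^sup>2\<close>; so the multiplier is \<open>(1 - \<rho>\<^sup>* \<mu>\<^sup>* v) / s\<close>, a combination of
  two isometries, and its inverse is obtained by exchanging the roles of \<open>u\<close> and \<open>v\<close>.
\<close>

locale crofoot = U: nonconst_inner_fn u + V: nonconst_inner_fn v for u v +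
  fixes \<rho> \<mu> :: complex
  assumes rho: "cmod \<rho> < 1" and mu: "cmod \<mu> = 1"
    and rel: "\<And>z. z \<in> ball 0 1 \<Longrightarrow> v z * (1 - cnj \<rho> * u z) = \<mu> * (\<rho> - u z)"
begin

definition s :: real where "s = sqrt (1 - (cmod \<rho>)\<^sup>2)"

definition transform :: "hardy2 \<Rightarrow> hardy2" where
  "transform f = (1 / of_real s) *\<^sub>C (f - cnj (\<rho> * \<mu>) *\<^sub>C V.M f)"

lemma s_sq: "s\<^sup>2 = 1 - (cmod \<rho>)\<^sup>2"
  using rho by (simp add: s_def abs_square_le_1)

lemma s_pos: "s > 0"
  using rho by (simp add: s_def abs_square_less_1)

lemma s_mult: "complex_of_real s * of_real s = 1 - \<rho> * cnj \<rho>"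
proof -
  have "complex_of_real (s\<^sup>2) = of_real (1 - (cmod \<rho>)\<^sup>2)" by (simp only: s_sq)
  then show ?thesis by (simp add: complex_norm_square power2_eq_square[of "complex_of_real s"] del: of_real_power)
      (simp add: power2_eq_square)
qed

lemma s_nonzero: "complex_of_real s \<noteq> 0"
  using s_pos by simp

lemma mu_cnj: "\<mu> * cnj \<mu> = 1"
  using mu by (simp add: complex_norm_square[symmetric])

lemma rel': "z \<in> ball 0 1 \<Longrightarrow> u z * (1 - cnj (\<mu> * \<rho>) * v z) = cnj \<mu> * (\<mu> * \<rho> - v z)"
proof -
  assume z: "z \<in> ball 0 1"
  show ?thesis using rel[OF z] mu_cnj by (simp only: complex_cnj_mult) algebra
qed

lemma reverse: "crofoot v u (\<mu> * \<rho>) (cnj \<mu>)"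
  by unfold_locales (use rel' rho mu in \<open>simp_all add: norm_mult del: complex_cnj_mult\<close>)

lemma transform_add: "transform (f + g) = transform f + transform g"
  by (simp add: transform_def V.M_simps scaleC_simps)

lemma transform_diff: "transform (f - g) = transform f - transform g"
  by (simp add: transform_def V.M_simps scaleC_simps)

lemma transform_scaleC: "transform (c *\<^sub>C f) = c *\<^sub>C transform f"
  by (simp add: transform_def V.M_simps scaleC_simps mult_ac)

lemma transform_shift: "transform (hardy2_shift_op f) = hardy2_shift_op (transform f)"
  by (simp add: transform_def V.M_simps shift_diff shift_scaleC)

lemma fun_transform:
  "z \<in> ball 0 1 \<Longrightarrow> of_real s * hardy2_fun (transform f) z = (1 - cnj (\<rho> * \<mu>) * v z) * hardy2_fun f z"
  using s_nonzero by (simp add: transform_def hardy2_fun_scaleC hardy2_fun_diff V.fun_M algebra_simps)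

lemma cinner_K_VM: assumes f: "f \<in> U.K" shows "cinner f (V.M h) = cnj (\<rho> * \<mu>) * cinner f h"
proof -
  have "V.M h - cnj \<rho> *\<^sub>C U.M (V.M h) = (\<mu> * \<rho>) *\<^sub>C h - \<mu> *\<^sub>C U.M h"
  proof (rule hardy2_eqI)
    fix z :: complex assume z: "z \<in> ball 0 1"
    show "hardy2_fun (V.M h - cnj \<rho> *\<^sub>C U.M (V.M h)) z = hardy2_fun ((\<mu> * \<rho>) *\<^sub>C h - \<mu> *\<^sub>C U.M h) z"
      using rel[OF z]
      unfolding hardy2_fun_diff hardy2_fun_scaleC U.fun_M[OF z] V.fun_M[OF z] by algebra
  qed
  from arg_cong[OF this, of "cinner f"] show ?thesis
    by (simp add: cinner_simps U.cinner_K_M[OF f] mult_ac)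
qed

lemma transform_K: assumes f: "f \<in> U.K" shows "transform f \<in> V.K"
  unfolding V.K_iff
  by (simp add: transform_def cinner_simps V.cinner_M cinner_K_VM[OF f])

lemma norm_transform: assumes f: "f \<in> U.K" shows "norm (transform f) = norm f"
proof -
  let ?c = "cnj (\<rho> * \<mu>)"
  have c: "cmod ?c = cmod \<rho>" using mu by (simp add: norm_mult)
  have "cnj ?c * cinner f (V.M f) = cnj ?c * ?c * cinner f f" by (simp only: cinner_K_VM[OF f] mult.assoc)
  also have "cnj ?c * ?c = of_real ((cmod \<rho>)\<^sup>2)"
    unfolding c[symmetric] complex_norm_square by (rule mult.commute)
  finally have "Re (cnj ?c * cinner f (V.M f)) = (cmod \<rho>)\<^sup>2 * (norm f)\<^sup>2" by (simp add: cinner_self)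
  then have "(norm (f - ?c *\<^sub>C V.M f))\<^sup>2 = (s * norm f)\<^sup>2"
    unfolding norm_diff_scaleC_sq power_mult_distrib s_sq c V.norm_M by (simp add: algebra_simps)
  then have "norm (f - ?c *\<^sub>C V.M f) = s * norm f"
    using s_pos by (simp add: power2_eq_iff_nonneg)
  then show ?thesis using s_pos by (simp add: transform_def norm_scaleC norm_divide)
qed

lemma cinner_transform:
  assumes "f \<in> U.K" "g \<in> U.K" shows "cinner (transform f) (transform g) = cinner f g"
  by (rule cinner_eq_if_norm_eq)
    (use assms in \<open>simp add: norm_transform U.K_intros flip: transform_scaleC transform_diff\<close>)

lemma transform_inverse: "transform ((1 / of_real s) *\<^sub>C (g - cnj \<rho> *\<^sub>C U.M g)) = g"
proof (rule hardy2_eqI)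
  fix z :: complex assume z: "z \<in> ball 0 1"
  have eq: "(1 - cnj (\<rho> * \<mu>) * v z) * (1 - cnj \<rho> * u z) = of_real s * of_real s"
    using rel[OF z] mu_cnj s_mult by (simp only: complex_cnj_mult) algebra
  let ?g = "hardy2_fun g z"
  have "of_real s * (of_real s * hardy2_fun (transform ((1 / of_real s) *\<^sub>C (g - cnj \<rho> *\<^sub>C U.M g))) z) =
      of_real s * ((1 - cnj (\<rho> * \<mu>) * v z) * (1 / of_real s * (?g - cnj \<rho> * (u z * ?g))))"
    unfolding fun_transform[OF z] hardy2_fun_scaleC hardy2_fun_diff U.fun_M[OF z] ..
  also have "\<dots> = (of_real s * (1 / of_real s)) * ((1 - cnj (\<rho> * \<mu>) * v z) * (1 - cnj \<rho> * u z)) * ?g"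
    by algebra
  also have "\<dots> = of_real s * (of_real s * ?g)"
    unfolding eq using s_nonzero by simp
  finally have "of_real s * (of_real s * hardy2_fun (transform ((1 / of_real s) *\<^sub>C (g - cnj \<rho> *\<^sub>C U.M g))) z) =
      of_real s * (of_real s * ?g)" .
  then show "hardy2_fun (transform ((1 / of_real s) *\<^sub>C (g - cnj \<rho> *\<^sub>C U.M g))) z = hardy2_fun g z"
    using s_nonzero by simp
qed

definition \<kappa> :: complex where "\<kappa> = - cnj \<mu> * (1 - cnj \<rho> * u 0) / of_real s"

lemma kappa_nonzero: "\<kappa> \<noteq> 0"
  using U.denominator_nonzero[OF rho, of 0] s_nonzero mu by (auto simp: \<kappa>_def)

lemma transform_kt: "transform U.kt = \<kappa> *\<^sub>C V.kt"
proof -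
  have "hardy2_shift_op (transform U.kt) = hardy2_shift_op (\<kappa> *\<^sub>C V.kt)"
  proof (rule hardy2_eqI)
    fix z :: complex assume z: "z \<in> ball 0 1"
    have "of_real s * (z * hardy2_fun (transform U.kt) z) = (1 - cnj (\<rho> * \<mu>) * v z) * (z * hardy2_fun U.kt z)"
      using fun_transform[OF z, of U.kt] by algebra
    also have "\<dots> = - cnj \<mu> * (1 - cnj \<rho> * u 0) * (v z - v 0)"
      unfolding U.fun_kt[OF z] complex_cnj_mult using rel[OF z] rel[of 0] mu_cnj by simp algebra
    also have "\<dots> = of_real s * (\<kappa> * (z * hardy2_fun V.kt z))"
      using s_nonzero by (simp add: V.fun_kt[OF z] \<kappa>_def)
    finally show "hardy2_fun (hardy2_shift_op (transform U.kt)) z = hardy2_fun (hardy2_shift_op (\<kappa> *\<^sub>C V.kt)) z"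
      using s_nonzero by (simp add: hardy2_fun_shift hardy2_fun_scaleC mult.left_commute)
  qed
  then show ?thesis by (metis backshift_shift)
qed

lemma cinner_kt_transform: assumes f: "f \<in> U.K" shows "cinner f U.kt = cnj \<kappa> * cinner (transform f) V.kt"
  using cinner_transform[OF f U.kt_K] by (simp add: transform_kt cinner_simps)

lemma T_transform:
  assumes f: "f \<in> U.K"
  shows "V.T (transform f) = transform (U.T f) + (\<rho> / of_real s * cinner f U.kt) *\<^sub>C V.k 0"
proof -
  have ue: "transform U.ue = (1 / of_real s) *\<^sub>C (\<rho> *\<^sub>C hmonom 0 - cnj \<mu> *\<^sub>C V.ue)"
  proof (rule hardy2_eqI)
    fix z :: complex assume z: "z \<in> ball 0 1"
    have "(1 - cnj (\<rho> * \<mu>) * v z) * u z = \<rho> - cnj \<mu> * v z"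
      unfolding complex_cnj_mult using rel[OF z] mu_cnj by algebra
    then have "of_real s * hardy2_fun (transform U.ue) z = \<rho> - cnj \<mu> * v z"
      unfolding fun_transform[OF z] U.fun_ue[OF z] .
    then show "hardy2_fun (transform U.ue) z =
        hardy2_fun ((1 / of_real s) *\<^sub>C (\<rho> *\<^sub>C hmonom 0 - cnj \<mu> *\<^sub>C V.ue)) z"
      using s_nonzero
      unfolding hardy2_fun_scaleC hardy2_fun_diff V.fun_ue[OF z] hardy2_fun_hmonom[OF z]
      by (simp add: nonzero_eq_divide_eq mult.commute)
  qed
  have "cnj (v 0) * (1 - \<rho> * cnj (u 0)) = cnj \<mu> * (cnj \<rho> - cnj (u 0))"
    using arg_cong[OF rel[of 0], of cnj] by simp
  then have "- \<mu> * (1 - \<rho> * cnj (u 0)) * (\<rho> * cnj (v 0) - cnj \<mu>) = of_real s * of_real s"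
    unfolding s_mult using mu_cnj by algebra
  moreover have "cnj \<kappa> * (\<rho> * cnj (v 0) - cnj \<mu>) =
      (- \<mu> * (1 - \<rho> * cnj (u 0)) * (\<rho> * cnj (v 0) - cnj \<mu>)) / of_real s"
    by (simp add: \<kappa>_def)
  ultimately have "cnj \<kappa> * (\<rho> * cnj (v 0) - cnj \<mu>) = of_real s"
    using s_nonzero by simp
  then have coeff: "1 / cnj \<kappa> = (\<rho> * cnj (v 0) - cnj \<mu>) / of_real s"
    using kappa_nonzero s_nonzero by (simp add: field_simps)
  have *: "cinner (transform f) V.kt = (\<rho> * cnj (v 0) - cnj \<mu>) / of_real s * cinner f U.kt"
    unfolding coeff[symmetric] using cinner_kt_transform[OF f] kappa_nonzero by simp
  show ?thesis
    unfolding V.T_eq[OF transform_K[OF f]] U.T_eq[OF f] transform_diff transform_shift transform_scaleC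
      * ue V.k0_eq
    by (simp add: scaleC_simps algebra_simps diff_divide_distrib)
qed

end

section \<open>Sufficiency\<close>

context inner_pair
begin

lemma symmetric_if_zero:
  assumes "bounded_op_on S S (block_op 0)" shows "complex_symmetric_on S (block_op 0)"
proof (rule complex_symmetric_onI[OF csubspace_S assms])
  show "conjugation_on S (\<lambda>p. (U.J (fst p), V.J (snd p)))"
    using conjugation_onD[OF U.conjugation_J] conjugation_onD[OF V.conjugation_J]
    by (auto simp: conjugation_on_def fst_snd_scaleC scaleC_Pair intro!: norm_Pair_eqI)
  show "symmetric_wrt S (\<lambda>p. (U.J (fst p), V.J (snd p))) (block_op 0)"
    using U.symmetric_T V.symmetric_T
    by (auto simp: symmetric_wrt_def block_op_def cinner_Pair)
qed

text \<open>
  If \<open>\<bar>y\<bar> = 1\<close>, then \<open>(f, g) \<mapsto> y\<^sup>* v f + g\<close> is a unitary map onto the model space of \<open>u v\<close>, by the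
  orthogonal decomposition of the latter into \<open>v K\<^sub>u\<close> and \<open>K\<^sub>v\<close>, and it takes the operator matrix to
  the compressed shift.
\<close>

lemma symmetric_if_unimodular:
  assumes bd: "bounded_op_on S S (block_op y)" and y: "cmod y = 1"
  shows "complex_symmetric_on S (block_op y)"
proof -
  interpret UV: inner_fn "\<lambda>z. u z * v z"
    by unfold_locales (rule inner_function_mult[OF U.inner V.inner])
  define \<alpha> where "\<alpha> = cnj y"
  have \<alpha>: "\<alpha> * y = 1" "cmod \<alpha> = 1" using y by (simp_all add: \<alpha>_def mult.commute complex_norm_square[symmetric])
  have UVM: "UV.M h = V.M (U.M h)" for h
    by (rule hardy2_eqI) (simp add: UV.fun_M U.fun_M V.fun_M)
  have UVue: "UV.ue = V.M U.ue" by (simp add: inner_elem_def UVM)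
  define W where "W p = \<alpha> *\<^sub>C V.M (fst p) + snd p" for p
  show ?thesis
  proof (rule complex_symmetric_on_transport[OF csubspace_S bd UV.csubspace_K UV.conjugation_J
        UV.symmetric_T, of W "\<lambda>h. (cnj \<alpha> *\<^sub>C V.M_adj h, h - V.M (V.M_adj h))"])
    show "W p \<in> UV.K" if "p \<in> S" for p
      using that unfolding UV.K_iff
      by (auto simp: W_def UVM cinner_simps V.cinner_M U.cinner_K_M V.cinner_K_M)
    show "W (p + q) = W p + W q" for p q by (simp add: W_def V.M_simps scaleC_simps)
    show "W (c *\<^sub>C p) = c *\<^sub>C W p" for c p
      by (simp add: W_def V.M_simps fst_snd_scaleC scaleC_simps mult.commute)
    show "norm (W p) = norm p" if S: "p \<in> S" for p
    proof -
      obtain f g where p: "p = (f, g)" "f \<in> U.K" "g \<in> V.K" using S by auto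
      have "(norm (g - (- \<alpha>) *\<^sub>C V.M f))\<^sup>2 = (norm g)\<^sup>2 + (norm f)\<^sup>2"
        unfolding norm_diff_scaleC_sq by (simp add: \<alpha> V.norm_M V.cinner_K_M[OF p(3)])
      then have "norm (W p) = sqrt ((norm g)\<^sup>2 + (norm f)\<^sup>2)"
        by (simp add: W_def p scaleC_minus_left add.commute real_sqrt_unique)
      then show ?thesis by (simp add: p norm_Pair add.commute)
    qed
    show "(cnj \<alpha> *\<^sub>C V.M_adj h, h - V.M (V.M_adj h)) \<in> S" if h: "h \<in> UV.K" for h
    proof -
      have "V.M_adj h \<in> U.K"
        using h unfolding U.K_iff UV.K_iff by (simp add: V.cinner_M_adj UVM)
      moreover have "h - V.M (V.M_adj h) \<in> V.K"
        unfolding V.K_iff by (simp add: cinner_simps V.cinner_M V.cinner_M_adj)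
      ultimately show ?thesis by (simp add: U.K_intros)
    qed
    show "W (cnj \<alpha> *\<^sub>C V.M_adj h, h - V.M (V.M_adj h)) = h" for h
      using \<alpha> by (simp add: W_def V.M_simps scaleC_scaleC complex_norm_square[symmetric])
    show "W (block_op y p) = UV.T (W p)" if p: "p \<in> S" for p
    proof -
      obtain f g where fg: "p = (f, g)" "f \<in> U.K" "g \<in> V.K" using p by auto
      have "cinner (W p) UV.kt = cinner (hardy2_shift_op (W p)) (V.M U.ue)"
        by (simp add: model_cokernel_def cinner_shift_left UVue)
      also have "\<dots> = \<alpha> * cinner (V.M (hardy2_shift_op f)) (V.M U.ue) + cinner (hardy2_shift_op g) (V.M U.ue)"
        by (simp add: W_def fg shift_add shift_scaleC cinner_simps V.M_simps)
      also have "\<dots> = \<alpha> * cinner f U.kt + cnj (u 0) * cinner g V.kt"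
        unfolding V.cinner_M V.cinner_shift_K_M[OF fg(3)]
        by (simp add: U.fun_ue cinner_shift_left model_cokernel_def)
      finally have c: "cinner (W p) UV.kt = \<alpha> * cinner f U.kt + cnj (u 0) * cinner g V.kt" .
      have "W (block_op y p) = \<alpha> *\<^sub>C V.M (U.T f) + (\<alpha> * y * cinner g V.kt) *\<^sub>C V.M (U.k 0) + V.T g"
        by (simp add: W_def block_op_def fg V.M_simps scaleC_simps mult.assoc)
      also have "\<dots> = \<alpha> *\<^sub>C V.M (U.T f) + cinner g V.kt *\<^sub>C V.M (U.k 0) + V.T g"
        unfolding \<alpha>(1) by simp
      also have "V.M (U.k 0) = V.ue - cnj (u 0) *\<^sub>C V.M U.ue"
        by (simp add: U.k0_eq V.M_simps inner_elem_def)
      finally have "W (block_op y p) = \<alpha> *\<^sub>C V.M (hardy2_shift_op f) + hardy2_shift_op g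
          - (\<alpha> * cinner f U.kt + cnj (u 0) * cinner g V.kt) *\<^sub>C V.M U.ue"
        by (simp add: U.T_eq[OF fg(2)] V.T_eq[OF fg(3)] V.M_simps scaleC_simps mult_ac)
      also have "\<dots> = hardy2_shift_op (W p) - cinner (W p) UV.kt *\<^sub>C UV.ue"
        unfolding c by (simp add: W_def fg shift_add shift_scaleC V.M_simps UVue)
      also have "\<dots> = UV.T (W p)"
      proof (rule UV.T_eq[symmetric])
        show "W p \<in> UV.K"
          using fg unfolding UV.K_iff
          by (auto simp: W_def UVM cinner_simps V.cinner_M U.cinner_K_M V.cinner_K_M)
      qed
      finally show ?thesis .
    qed
  qed
qed

text \<open>
  The Crofoot transform makes the operator matrix equivalent to
  \<open>T\<^sub>u \<otimes> I + (k\<^sub>u \<otimes> k'\<^sub>u) \<otimes> R\<close> on \<open>K\<^sub>u \<otimes> \<complex>\<^sup>2\<close> with a matrix \<open>R\<close> having the rows \<open>(0, a)\<close> and \<open>(0, c)\<close>. The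
  conjugation of the model space, tensored with the conjugation \<open>x \<mapsto> Q x\<^sup>*\<close> of \<open>\<complex>\<^sup>2\<close> for which
  \<open>R\<close> is complex symmetric, does the rest. Here \<open>Q\<close> is the symmetric unitary matrix with
  the rows \<open>(p, q)\<close> and \<open>(q, r)\<close>.
\<close>

lemma symmetric_if_blaschke:
  assumes bd: "bounded_op_on S S (block_op y)" and y: "y \<noteq> 0"
    and a: "cmod \<rho> < 1" and mu: "cmod \<mu> = 1"
    and rel: "\<And>z. z \<in> ball 0 1 \<Longrightarrow> v z * (1 - cnj \<rho> * u z) = \<mu> * (\<rho> - u z)"
  shows "complex_symmetric_on S (block_op y)"
proof -
  interpret F: crofoot u v \<rho> \<mu> using a mu rel by unfold_locales auto
  interpret G: crofoot v u "\<mu> * \<rho>" "cnj \<mu>" by (rule F.reverse)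
  define a where "a = y * cnj G.\<kappa>"
  define c where "c = - (\<mu> * \<rho> / of_real G.s * cnj G.\<kappa>)"
  have a0: "a \<noteq> 0" using y G.kappa_nonzero by (simp add: a_def)
  \<comment> \<open>Symmetry of the form amounts to \<open>a p\<^sup>* + c q\<^sup>* = 0\<close>; for a unitary \<open>Q\<close> this makes its second
    column proportional to \<open>(a, c)\<close>, and \<open>t\<close> normalises that column.\<close>
  define t where "t = 1 / sqrt ((cmod a)\<^sup>2 + (cmod c)\<^sup>2)"
  define q where "q = a * of_real t"
  define r where "r = c * of_real t"
  define p where "p = - (a / cnj a) * cnj c * of_real t"
  have pos: "(cmod a)\<^sup>2 + (cmod c)\<^sup>2 > 0" using a0 by (simp add: add_pos_nonneg)
  have t: "t\<^sup>2 * ((cmod a)\<^sup>2 + (cmod c)\<^sup>2) = 1" using pos a0 by (simp add: t_def power_divide)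
  have n: "(cmod q)\<^sup>2 + (cmod r)\<^sup>2 = 1" "(cmod p)\<^sup>2 + (cmod q)\<^sup>2 = 1"
    using t a0 by (simp_all add: q_def r_def p_def norm_mult norm_divide power_mult_distrib algebra_simps)
  have orth: "p * cnj q + q * cnj r = 0" using a0 by (simp add: p_def q_def r_def field_simps)
  have form: "a * cnj p + c * cnj q = 0" using a0 by (simp add: p_def q_def field_simps)
  have nn: "p * cnj p + q * cnj q = 1" "q * cnj q + r * cnj r = 1"
    using arg_cong[OF n(1), of complex_of_real] arg_cong[OF n(2), of complex_of_real]
    by (simp_all add: complex_norm_square add.commute del: of_real_power)
  have orth': "q * cnj p + r * cnj q = 0" using arg_cong[OF orth, of cnj] by (simp add: mult.commute add.commute)
  let ?S0 = "U.K \<times> U.K"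
  define A0 where "A0 w = (U.T (fst w) + (a * cinner (snd w) U.kt) *\<^sub>C U.k 0,
      U.T (snd w) + (c * cinner (snd w) U.kt) *\<^sub>C U.k 0)" for w
  define C0 where "C0 w = (p *\<^sub>C U.J (fst w) + q *\<^sub>C U.J (snd w), q *\<^sub>C U.J (fst w) + r *\<^sub>C U.J (snd w))" for w
  have C0: "conjugation_on ?S0 C0"
    unfolding conjugation_on_def
  proof (intro conjI ballI allI)
    fix w assume w: "w \<in> ?S0"
    then obtain f g where fg: "w = (f, g)" "f \<in> U.K" "g \<in> U.K" by auto
    show "C0 w \<in> ?S0" by (simp add: C0_def U.K_intros U.J_K)
    show "C0 (b *\<^sub>C w) = cnj b *\<^sub>C C0 w" for b
      by (simp add: C0_def fst_snd_scaleC scaleC_Pair U.J_scaleC scaleC_simps mult.commute)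
    show "C0 (w + w') = C0 w + C0 w'" for w'
      by (simp add: C0_def U.J_add scaleC_simps)
    have "C0 (C0 w) = ((p * cnj p + q * cnj q) *\<^sub>C f + (p * cnj q + q * cnj r) *\<^sub>C g,
        (q * cnj p + r * cnj q) *\<^sub>C f + (q * cnj q + r * cnj r) *\<^sub>C g)"
      by (simp add: C0_def fg U.J_add U.J_scaleC U.J_J scaleC_simps)
    then show "C0 (C0 w) = w" unfolding nn orth orth' by (simp add: fg)
    have nJ: "norm (U.J f) = norm f" "norm (U.J g) = norm g"
      using fg conjugation_onD(2)[OF U.conjugation_J] by auto
    have expand: "(norm (b *\<^sub>C x + d *\<^sub>C z))\<^sup>2 =
        (cmod b)\<^sup>2 * (norm x)\<^sup>2 + (cmod d)\<^sup>2 * (norm z)\<^sup>2 + 2 * Re (b * cnj d * cinner x z)" for b d and x z :: hardy2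
      using norm_diff_scaleC_sq[of "b *\<^sub>C x" "- d" z]
      by (simp add: scaleC_minus_left norm_scaleC power_mult_distrib cinner_simps mult.assoc mult.left_commute)
    have "(norm (p *\<^sub>C U.J f + q *\<^sub>C U.J g))\<^sup>2 + (norm (q *\<^sub>C U.J f + r *\<^sub>C U.J g))\<^sup>2 =
        ((cmod p)\<^sup>2 + (cmod q)\<^sup>2) * (norm f)\<^sup>2 + ((cmod q)\<^sup>2 + (cmod r)\<^sup>2) * (norm g)\<^sup>2 +
        2 * Re ((p * cnj q + q * cnj r) * cinner (U.J f) (U.J g))"
      unfolding expand nJ by (simp add: algebra_simps)
    then show "norm (C0 w) = norm w"
      unfolding n orth C0_def fg fst_conv snd_conv by (intro norm_Pair_eqI) simp
  qed
  have sym: "symmetric_wrt ?S0 C0 A0"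
    unfolding symmetric_wrt_def
  proof (intro ballI)
    have kJ: "cinner (U.k 0) (U.J f) = cinner f U.kt" for f
      by (subst U.cinner_J_right_swap) (simp add: U.J_k0)
    have TJ: "cinner (U.T f) (U.J g) = cinner (U.T g) (U.J f)" if "f \<in> U.K" "g \<in> U.K" for f g
      using U.symmetric_T that by (simp add: symmetric_wrt_def)
    fix w w' assume "w \<in> ?S0" "w' \<in> ?S0"
    then obtain f g f' g' where w: "w = (f, g)" "w' = (f', g')" "f \<in> U.K" "g \<in> U.K" "f' \<in> U.K" "g' \<in> U.K"
      by auto
    have expand: "cinner (A0 (f, g)) (C0 (f', g')) =
        cnj p * cinner (U.T f) (U.J f') + cnj q * (cinner (U.T f) (U.J g') + cinner (U.T g) (U.J f'))
        + cnj r * cinner (U.T g) (U.J g')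
        + (a * cnj p + c * cnj q) * (cinner g U.kt * cinner f' U.kt)
        + (a * cnj q + c * cnj r) * (cinner g U.kt * cinner g' U.kt)" for f g f' g'
      by (simp add: A0_def C0_def cinner_Pair cinner_simps kJ algebra_simps)
    show "cinner (A0 w) (C0 w') = cinner (A0 w') (C0 w)"
      unfolding w(1,2) expand form using w TJ[of f f'] TJ[of f g'] TJ[of g f'] TJ[of g g']
      by (simp add: mult.commute add.commute)
  qed
  have transform_transform: "G.transform (F.transform h) = h" for h
  proof -
    have "G.s = F.s" using mu by (simp add: F.s_def G.s_def norm_mult)
    then show ?thesis using G.transform_inverse[of h] by (simp add: F.transform_def mult.commute)
  qed
  show ?thesis
  proof (rule complex_symmetric_on_transport[OF csubspace_S bd
        csubspace_Times[OF U.csubspace_K U.csubspace_K] C0 sym,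
        of "\<lambda>w. (fst w, G.transform (snd w))" "\<lambda>w. (fst w, F.transform (snd w))"])
    show "(fst w, G.transform (snd w)) \<in> ?S0" if "w \<in> S" for w
      using that by (auto simp: G.transform_K)
    show "(fst (w + w'), G.transform (snd (w + w'))) = (fst w, G.transform (snd w)) + (fst w', G.transform (snd w'))"
      for w w' by (simp add: G.transform_add)
    show "(fst (b *\<^sub>C w), G.transform (snd (b *\<^sub>C w))) = b *\<^sub>C (fst w, G.transform (snd w))" for b w
      by (simp add: fst_snd_scaleC scaleC_Pair G.transform_scaleC)
    show "norm (fst w, G.transform (snd w)) = norm w" if "w \<in> S" for w
      using that by (auto simp: G.norm_transform norm_Pair)
    show "(fst w, F.transform (snd w)) \<in> S" if "w \<in> ?S0" for w
      using that by (auto simp: F.transform_K)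
    show "(fst (fst w, F.transform (snd w)), G.transform (snd (fst w, F.transform (snd w)))) = w" if "w \<in> ?S0" for w
      using that by (auto simp: transform_transform)
    show "(fst (block_op y w), G.transform (snd (block_op y w))) = A0 (fst w, G.transform (snd w))" if S: "w \<in> S" for w
    proof -
      obtain f g where w: "w = (f, g)" "g \<in> V.K" using S by auto
      have "G.transform (V.T g) = U.T (G.transform g) - (\<mu> * \<rho> / of_real G.s * cinner g V.kt) *\<^sub>C U.k 0"
        by (simp add: G.T_transform[OF w(2)])
      then show ?thesis
        by (simp add: w block_op_def A0_def G.cinner_kt_transform[OF w(2)] a_def c_def scaleC_minus_left mult.assoc)
    qed
  qed
qed

end

section \<open>The characterisation\<close>

theorem theorem5p2:
  fixes u v :: "complex \<Rightarrow> complex" and X Y :: "hardy2 \<Rightarrow> hardy2"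
    and T :: "hardy2 \<times> hardy2 \<Rightarrow> hardy2 \<times> hardy2"
  assumes "inner_function u" and "\<not> u constant_on ball 0 1"
    and "inner_function v" and "\<not> v constant_on ball 0 1"
    and "bounded_op_on (model_space v) (model_space u) X"
    and "T = upper_block (model_op u) X (model_op v)"
    and "contraction_on (model_space u \<times> model_space v) (model_space u \<times> model_space v) T"
    and "contraction_on (defect_space (model_space v) (model_op v))
           (codefect_space (model_space u) (model_op u)) Y"
    and "\<forall>g\<in>model_space v.
           X g = codefect_op (model_space u) (model_op u)
                   (Y (defect_op (model_space v) (model_op v) g))"
  shows "complex_symmetric_on (model_space u \<times> model_space v) T \<longleftrightarrow>
     (\<forall>g\<in>defect_space (model_space v) (model_op v). Y g = 0) \<or>
     onorm_on (defect_space (model_space v) (model_op v)) Y = 1 \<or>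
     (0 < onorm_on (defect_space (model_space v) (model_op v)) Y \<and>
      onorm_on (defect_space (model_space v) (model_op v)) Y < 1 \<and>
      (\<exists>a\<in>ball 0 1. \<exists>\<mu>\<in>sphere 0 1. \<forall>z\<in>ball 0 1. v z = \<mu> * blaschke_factor a (u z)))"
proof -
  interpret inner_pair u v using assms(1-4) by unfold_locales
  obtain y where X: "\<And>g. g \<in> V.K \<Longrightarrow> X g = (y * cinner g V.kt) *\<^sub>C U.k 0"
    and norm_Y: "onorm_on (defect_space V.K V.T) Y = cmod y" and y: "cmod y \<le> 1"
    and zero_Y: "(\<forall>g\<in>defect_space V.K V.T. Y g = 0) \<longleftrightarrow> y = 0"
    using corner_scalar[OF assms(8,9)] by blast
  have T: "T p = block_op y p" if "p \<in> S" for p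
    using that by (auto simp: assms(6) upper_block_def block_op_def X)
  have "bounded_op_on S S T" using assms(7) by (simp add: contraction_on_def)
  then have bd: "bounded_op_on S S (block_op y)"
    using bounded_op_on_cong[OF csubspace_S T] by simp
  have cs: "complex_symmetric_on S T \<longleftrightarrow> complex_symmetric_on S (block_op y)"
    by (rule complex_symmetric_on_cong[OF csubspace_S T])
  show ?thesis
    unfolding cs norm_Y zero_Y
  proof
    assume sym: "complex_symmetric_on S (block_op y)"
    consider "y = 0" | "cmod y = 1" | "y \<noteq> 0" "cmod y < 1" using y by linarith
    then show "y = 0 \<or> cmod y = 1 \<or> (0 < cmod y \<and> cmod y < 1 \<and>
        (\<exists>a\<in>ball 0 1. \<exists>\<mu>\<in>sphere 0 1. \<forall>z\<in>ball 0 1. v z = \<mu> * blaschke_factor a (u z)))"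
    proof cases
      case 3
      obtain c where c: "\<And>w. w \<in> ball 0 1 \<Longrightarrow>
          (v w - v 0) * (1 - cnj (u 0) * u w) = c * ((u w - u 0) * (1 - cnj (v 0) * v w))"
        using proportional_if_complex_symmetric[OF sym 3] by blast
      show ?thesis using 3 blaschke_of_proportional[OF c] by simp
    qed simp_all
  next
    assume "y = 0 \<or> cmod y = 1 \<or> (0 < cmod y \<and> cmod y < 1 \<and>
        (\<exists>a\<in>ball 0 1. \<exists>\<mu>\<in>sphere 0 1. \<forall>z\<in>ball 0 1. v z = \<mu> * blaschke_factor a (u z)))"
    then consider "y = 0" | "cmod y = 1" | a \<mu> where "y \<noteq> 0" "cmod a < 1" "cmod \<mu> = 1"
      "\<And>z. z \<in> ball 0 1 \<Longrightarrow> v z = \<mu> * blaschke_factor a (u z)"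
      by (auto simp del: mem_ball)
    then show "complex_symmetric_on S (block_op y)"
    proof cases
      case 1
      then show ?thesis using bd symmetric_if_zero by simp
    next
      case 2
      then show ?thesis using bd symmetric_if_unimodular by blast
    next
      case (3 a \<mu>)
      show ?thesis
      proof (rule symmetric_if_blaschke[OF bd 3(1-3)])
        fix z :: complex assume z: "z \<in> ball 0 1"
        show "v z * (1 - cnj a * u z) = \<mu> * (a - u z)"
          using U.denominator_nonzero[OF 3(2) z] by (simp add: 3(4)[OF z] blaschke_factor_def)
      qed
    qed
  qed
qed

end
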